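(* Let $(X_n)_{n\ge 0}$ be a time homogeneous Markov chain on a standard Borel space $(\Omega,\mathcal F)$, let $\mathcal S\subset\mathcal F$ be a finite collection of pairwise disjoint sets, each $S\in\mathcal S$ having a unique quasistationary distribution $\nu=\nu_S$, and let $N\ge 1$ (number of replicas), $T_{corr}\ge 1$, $T_{poll}\ge 1$ be integers ($T_{corr}$ being the same for each $S\in\mathcal S$). Assume: (1) (Exact dephasing) in every Dephasing Step of the parallel replica algorithm, the points $x_1,\dots,x_N$ are drawn independently (and independently of the history of the algorithm) and exactly from the quasistationary distribution $\nu$ in the current set $S$. (2) (Exact decorrelation) for every $S\in\mathcal S$, every $A\in\mathcal F$ with $A\subset S$, and every initial distribution of $X_0$ for which the conditioning event has positive probability, $$\mathbb P(X_{T_{corr}}\in A\mid X_1\in S,\dots,X_{T_{corr}}\in S)=\nu_S(A).$$ (3) (Uniform ergodicity) there is a (unique) probability measure $\mu$ on $(\Omega,\mathcal F)$ with $\lim_{n\to\infty}\sup_\xi\|\mathbb P_\xi(X_n\in\cdot)-\mu\|=0$, the supremum being over all probability measures $\xi$ on $(\Omega,\mathcal F)$ and $\|\cdot\|$ being the total variation norm. (4) (Doeblin-like condition) there exist $\alpha\in(0,1)$, $S\in\mathcal S$ with $\mu(S)>0$, and a probability measure $\lambda$ on $(\Omega,\mathcal F)$ supported in $S$ such that $\mathbb P_x(X_1\in C)\ge\alpha\lambda(C)$ for all $x\in S$ and all $C\in\mathcal F$ with $C\subset S$. (5) (Escape rates) there exists $\delta>0$ such that $\mathbb P_{\nu_S}(X_1\notin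 S)\ge\delta$ for all $S\in\mathcal S$. Then for any probability measure $\xi$ on $(\Omega,\mathcal F)$ and any bounded measurable function $f:\Omega\to\mathbb R$, the parallel replica algorithm started from $X_0\sim\xi$ satisfies $$\mathbb P_\xi\left(\lim_{T_{sim}\to\infty}\frac{f_{sim}}{T_{sim}}=\int_\Omega f\,d\mu\right)=1.$$
   Context: Notation: $\mathbb P_\xi$ is the law when $X_0\sim\xi$, and $\mathbb P_x=\mathbb P_{\delta_x}$. A probability measure $\nu$ supported in $S$ is a quasistationary distribution (QSD) in $S$ if for all $n\ge 0$ and all measurable $A\subset S$, $\nu(A)=\mathbb P_\nu(X_n\in A\mid X_1\in S,\dots,X_n\in S)$. The parallel replica algorithm (for a bounded measurable $f:\Omega\to\mathbb R$). Initially $T_{sim}=0$, $f_{sim}=0$, $X_0\sim\xi$. Then iterate the following three steps. Decorrelation Step. Evolve $(X_n)$ (with the law of the Markov chain) from time $n=T_{sim}$, starting at the current value $X_{T_{sim}}$, until time $n=\sigma$, where $\sigma$ is the smallest $n\ge T_{sim}+T_{corr}-1$ such that there exists $S\in\mathcal S$ with $X_n\in S,\,X_{n-1}\in S,\dots,X_{n-T_{corr}+1}\in S$. Update $f_{sim}\leftarrow f_{sim}+\sum_{n=T_{sim}+1}^{\sigma}f(X_n)$, then set $T_{sim}=\sigma$, and let $S$ be the element of $\mathcal S$ containing $X_\sigma$. Dephasing Step. Generate $N$ independent samples $x_1,\dots,x_N$ of the QSD $\nu$ in $S$. ($f_{sim}$ and $T_{sim}$ are unchanged.) Parallel Step. (i)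 Set $M=1$, $\tau_{acc}=0$. Let $(X^1_n)_{n\ge0},\dots,(X^N_n)_{n\ge0}$ be Markov chains with the same transition law as $(X_n)_{n\ge 0}$, independent of $(X_n)_{n\ge0}$ and of one another, with $X_0^i=x_i$. (ii) Evolve all the replicas from time $(M-1)T_{poll}$ to time $MT_{poll}$. (iii) If none of the replicas leaves $S$ during this time, update $$f_{sim}\leftarrow f_{sim}+\sum_{i=1}^N\sum_{j=(M-1)T_{poll}+1}^{MT_{poll}}f(X^i_j),\qquad \tau_{acc}\leftarrow\tau_{acc}+NT_{poll},\qquad M\leftarrow M+1,$$ and return to (ii). Otherwise, let $K$ be the smallest index such that $(X^K_n)$ leaves $S$ during this time, let $\tau^K\in[(M-1)T_{poll}+1,MT_{poll}]$ be its first exit time from $S$, and update $$f_{sim}\leftarrow f_{sim}+\sum_{i=1}^{K-1}\sum_{j=(M-1)T_{poll}+1}^{MT_{poll}}f(X^i_j)+\sum_{j=(M-1)T_{poll}+1}^{\tau^K}f(X^K_j),$$ $$\tau_{acc}\leftarrow\tau_{acc}+(K-1)T_{poll}+(\tau^K-(M-1)T_{poll}).$$ Then update $T_{sim}\leftarrow T_{sim}+\tau_{acc}$, set $X_{T_{sim}}=X^K_{\tau^K}$, and return to the Decorrelation Step. The limit $T_{sim}\to\infty$ of $f_{sim}/T_{sim}$ is taken along the successive values of the pair $(f_{sim},T_{sim})$ at the completion of the Decorrelation and Parallel Steps as the algorithm is iterated indefinitely. *)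

theory Defs
  imports "HOL-Probability.Probability"
begin

section \<open>Markov chains on standard Borel spaces\<close>

definition standard_borel :: "'a measure \<Rightarrow> bool" where
  "standard_borel Om \<longleftrightarrow>
     (\<exists>X. topspace X = space Om \<and> completely_metrizable_space X \<and> second_countable X \<and>
          sets Om = sigma_sets (space Om) {U. openin X U})"

text \<open>
  The law on sequences built from initial law and transition kernels by the Ionescu-Tulcea
  theorem: given \<open>\<omega> 0, ..., \<omega> (i - 1)\<close>, the \<open>i\<close>-th coordinate has law \<open>Q i \<omega>\<close>.
\<close>

definition ionescu_tulcea_law ::
    "'s measure \<Rightarrow> (nat \<Rightarrow> (nat \<Rightarrow> 's) \<Rightarrow> 's measure) \<Rightarrow> (nat \<Rightarrow> 's) measure" where
  "ionescu_tulcea_law E Q =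
     projective_family.lim UNIV (Ionescu_Tulcea.CI Q (\<lambda>_. E)) (\<lambda>_. E)"

text \<open>
  A time homogeneous Markov chain is given by its transition kernel \<open>P\<close>, and
  \<open>chain_law Om P \<xi>\<close> is the law of the whole path \<open>(X\<^sub>0, X\<^sub>1, ...)\<close> with \<open>X\<^sub>0 \<sim> \<xi>\<close>;
  so \<open>X\<^sub>n\<close> is the coordinate map \<open>\<lambda>\<omega>. \<omega> n\<close>.
\<close>

definition chain_law :: "'a measure \<Rightarrow> ('a \<Rightarrow> 'a measure) \<Rightarrow> 'a measure \<Rightarrow> (nat \<Rightarrow> 'a) measure" where
  "chain_law Om P \<xi> =
     ionescu_tulcea_law Om (\<lambda>i \<omega>. case i of 0 \<Rightarrow> \<xi> | Suc n \<Rightarrow> P (\<omega> n))"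

text \<open>
  Since division by zero yields zero, \<open>measure \<nu> S = 1\<close> together with the conditional identity
  (for \<open>A = S\<close>) forces all conditioning events to have positive probability.
\<close>

definition quasistationary ::
    "'a measure \<Rightarrow> ('a \<Rightarrow> 'a measure) \<Rightarrow> 'a set \<Rightarrow> 'a measure \<Rightarrow> bool" where
  "quasistationary Om P S \<nu> \<longleftrightarrow>
     \<nu> \<in> space (prob_algebra Om) \<and> measure \<nu> S = 1 \<and>
     (\<forall>n. \<forall>A\<in>sets Om. A \<subseteq> S \<longrightarrow>
        measure \<nu> A = \<P>(\<omega> in chain_law Om P \<nu>. \<omega> n \<in> A \<bar> \<forall>i\<in>{1..n}. \<omega> i \<in> S))"

text \<open>
  The norm of the signed measure \<open>M - N\<close>, with the normalisation under which two probability
  measures are at distance at most one.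
\<close>

definition tv_dist :: "'a measure \<Rightarrow> 'a measure \<Rightarrow> real" where
  "tv_dist M N = (SUP A\<in>sets M. \<bar>measure M A - measure N A\<bar>)"


section \<open>The parallel replica algorithm\<close>

text \<open>
  A state \<open>(running, X, f_sim, T_sim)\<close> records the data held at the completion of a step, with
  \<open>X\<close> the value \<open>X\<close> at time \<open>T_sim\<close>. The flag is set to \<open>False\<close>, forever, as soon as a step
  fails to terminate.
\<close>

type_synonym 'a pr_state = "bool \<times> 'a \<times> real \<times> nat"

definition pr_space :: "'a measure \<Rightarrow> 'a pr_state measure" where
  "pr_space Om = count_space UNIV \<Otimes>\<^sub>M (Om \<Otimes>\<^sub>M (borel \<Otimes>\<^sub>M count_space UNIV))"

definition running :: "'a pr_state \<Rightarrow> bool" where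
  "running s = fst s"

definition X_cur :: "'a pr_state \<Rightarrow> 'a" where
  "X_cur s = fst (snd s)"

definition f_sim :: "'a pr_state \<Rightarrow> real" where
  "f_sim s = fst (snd (snd s))"

definition T_sim :: "'a pr_state \<Rightarrow> nat" where
  "T_sim s = snd (snd (snd s))"

definition stuck :: "'a pr_state \<Rightarrow> 'a pr_state" where
  "stuck s = (False, snd s)"

text \<open>
  Decorrelation step. The path \<open>\<omega>\<close> is indexed from the start of the step, so that \<open>\<omega> n\<close> is
  \<open>X\<close> at time \<open>T_sim + n\<close>.
\<close>

definition decorrelated :: "'a set set \<Rightarrow> nat \<Rightarrow> (nat \<Rightarrow> 'a) \<Rightarrow> nat \<Rightarrow> bool" where
  "decorrelated \<S> T_corr \<omega> n \<longleftrightarrow> n + 1 \<ge> T_corr \<and> (\<exists>S\<in>\<S>. \<forall>j<T_corr. \<omega> (n - j) \<in> S)"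

definition decorrelation_update ::
    "'a set set \<Rightarrow> nat \<Rightarrow> ('a \<Rightarrow> real) \<Rightarrow> 'a pr_state \<Rightarrow> (nat \<Rightarrow> 'a) \<Rightarrow> 'a pr_state" where
  "decorrelation_update \<S> T_corr f s \<omega> =
     (if \<exists>n. decorrelated \<S> T_corr \<omega> n
      then let \<sigma> = (LEAST n. decorrelated \<S> T_corr \<omega> n)
           in (True, \<omega> \<sigma>, f_sim s + (\<Sum>n=1..\<sigma>. f (\<omega> n)), T_sim s + \<sigma>)
      else stuck s)"

definition decorrelation_step ::
    "'a measure \<Rightarrow> ('a \<Rightarrow> 'a measure) \<Rightarrow> 'a set set \<Rightarrow> nat \<Rightarrow> ('a \<Rightarrow> real) \<Rightarrow>
     'a pr_state \<Rightarrow> 'a pr_state measure" where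
  "decorrelation_step Om P \<S> T_corr f s =
     (if running s
      then distr (chain_law Om P (return Om (X_cur s))) (pr_space Om)
             (decorrelation_update \<S> T_corr f s)
      else return (pr_space Om) (stuck s))"

text \<open>
  Parallel step, for replicas \<open>Y 1, ..., Y N\<close>. Round \<open>M\<close> covers the times in
  \<open>poll_window T_poll M\<close>; the step ends in the first round in which some replica leaves \<open>S\<close>,
  all earlier rounds contributing in full.
\<close>

definition poll_window :: "nat \<Rightarrow> nat \<Rightarrow> nat set" where
  "poll_window T_poll M = {(M - 1) * T_poll + 1 .. M * T_poll}"

definition leaves :: "'a set \<Rightarrow> nat \<Rightarrow> (nat \<Rightarrow> nat \<Rightarrow> 'a) \<Rightarrow> nat \<Rightarrow> nat \<Rightarrow> bool" where
  "leaves S T_poll Y M i \<longleftrightarrow> (\<exists>j\<in>poll_window T_poll M. Y i j \<notin> S)"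

definition parallel_update ::
    "nat \<Rightarrow> nat \<Rightarrow> ('a \<Rightarrow> real) \<Rightarrow> 'a set \<Rightarrow> 'a pr_state \<Rightarrow> (nat \<Rightarrow> nat \<Rightarrow> 'a) \<Rightarrow> 'a pr_state" where
  "parallel_update N T_poll f S s Y =
     (if \<exists>M\<ge>1. \<exists>i\<in>{1..N}. leaves S T_poll Y M i
      then let M = (LEAST M. M \<ge> 1 \<and> (\<exists>i\<in>{1..N}. leaves S T_poll Y M i));
               K = (LEAST i. i \<in> {1..N} \<and> leaves S T_poll Y M i);
               \<tau> = (LEAST j. j \<in> poll_window T_poll M \<and> Y K j \<notin> S);
               \<tau>_acc = (M - 1) * (N * T_poll) + (K - 1) * T_poll + (\<tau> - (M - 1) * T_poll)
           in (True, Y K \<tau>,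
               f_sim s
                 + (\<Sum>m=1..<M. \<Sum>i=1..N. \<Sum>j\<in>poll_window T_poll m. f (Y i j))
                 + (\<Sum>i=1..<K. \<Sum>j\<in>poll_window T_poll M. f (Y i j))
                 + (\<Sum>j=(M - 1) * T_poll + 1..\<tau>. f (Y K j)),
               T_sim s + \<tau>_acc)
      else stuck s)"

text \<open>
  \<open>D\<close> is the law of the dephased points \<open>x 1, ..., x N\<close>; given these, the replicas are
  independent chains started at the \<open>x i\<close>.
\<close>

definition replica_law ::
    "'a measure \<Rightarrow> ('a \<Rightarrow> 'a measure) \<Rightarrow> nat \<Rightarrow> (nat \<Rightarrow> 'a) measure \<Rightarrow> (nat \<Rightarrow> nat \<Rightarrow> 'a) measure" where
  "replica_law Om P N D = D \<bind> (\<lambda>x. \<Pi>\<^sub>M i\<in>{1..N}. chain_law Om P (return Om (x i)))"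

text \<open>
  \<open>D S\<close> is the law of the dephased points when the current set is \<open>S\<close>. A running state whose
  value lies in no element of \<open>\<S>\<close> does not arise after a decorrelation step.
\<close>

definition dephasing_parallel_step ::
    "'a measure \<Rightarrow> ('a \<Rightarrow> 'a measure) \<Rightarrow> 'a set set \<Rightarrow> nat \<Rightarrow> nat \<Rightarrow> ('a \<Rightarrow> real) \<Rightarrow>
     ('a set \<Rightarrow> (nat \<Rightarrow> 'a) measure) \<Rightarrow> 'a pr_state \<Rightarrow> 'a pr_state measure" where
  "dephasing_parallel_step Om P \<S> N T_poll f D s =
     (if running s \<and> (\<exists>S\<in>\<S>. X_cur s \<in> S)
      then let S = (THE S. S \<in> \<S> \<and> X_cur s \<in> S)
           in distr (replica_law Om P N (D S)) (pr_space Om) (parallel_update N T_poll f S s)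
      else return (pr_space Om) (stuck s))"

text \<open>
  A dephasing mechanism \<open>deph\<close> gives the conditional law \<open>deph k h S\<close> of the points
  \<open>(x 1, ..., x N)\<close> drawn after \<open>k\<close> completed steps with history \<open>h\<close> (the states \<open>h 0, ..., h k\<close>)
  when the current set is \<open>S\<close>.
\<close>

type_synonym 'a dephasing = "nat \<Rightarrow> (nat \<Rightarrow> 'a pr_state) \<Rightarrow> 'a set \<Rightarrow> (nat \<Rightarrow> 'a) measure"

text \<open>
  Exactness: conditionally on the history, the points are i.i.d. with law \<open>\<nu> S\<close>; as this law does
  not depend on the history, they are independent of it given the current set.
\<close>

definition exact_dephasing ::
    "'a measure \<Rightarrow> 'a set set \<Rightarrow> nat \<Rightarrow> ('a set \<Rightarrow> 'a measure) \<Rightarrow> 'a dephasing \<Rightarrow> bool" where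
  "exact_dephasing Om \<S> N \<nu> deph \<longleftrightarrow>
     (\<forall>k. \<forall>h\<in>space (\<Pi>\<^sub>M i\<in>{0..k}. pr_space Om). \<forall>S\<in>\<S>. deph k h S = (\<Pi>\<^sub>M i\<in>{1..N}. \<nu> S))"

text \<open>
  The law of the successive states of the algorithm: state \<open>0\<close> is the initial one, states
  \<open>1, 3, 5, ...\<close> are those at the completion of the decorrelation steps, and states
  \<open>2, 4, 6, ...\<close> those at the completion of the parallel steps.
\<close>

definition parrep_kernel ::
    "'a measure \<Rightarrow> ('a \<Rightarrow> 'a measure) \<Rightarrow> 'a set set \<Rightarrow> nat \<Rightarrow> nat \<Rightarrow> nat \<Rightarrow> 'a dephasing \<Rightarrow>
     ('a \<Rightarrow> real) \<Rightarrow> 'a measure \<Rightarrow> nat \<Rightarrow> (nat \<Rightarrow> 'a pr_state) \<Rightarrow> 'a pr_state measure" where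
  "parrep_kernel Om P \<S> N T_corr T_poll deph f \<xi> i h =
     (case i of
        0 \<Rightarrow> distr \<xi> (pr_space Om) (\<lambda>x. (True, x, 0, 0))
      | Suc k \<Rightarrow>
          if even k then decorrelation_step Om P \<S> T_corr f (h k)
          else dephasing_parallel_step Om P \<S> N T_poll f (deph k h) (h k))"

definition parrep_law ::
    "'a measure \<Rightarrow> ('a \<Rightarrow> 'a measure) \<Rightarrow> 'a set set \<Rightarrow> nat \<Rightarrow> nat \<Rightarrow> nat \<Rightarrow> 'a dephasing \<Rightarrow>
     ('a \<Rightarrow> real) \<Rightarrow> 'a measure \<Rightarrow> (nat \<Rightarrow> 'a pr_state) measure" where
  "parrep_law Om P \<S> N T_corr T_poll deph f \<xi> =
     ionescu_tulcea_law (pr_space Om) (parrep_kernel Om P \<S> N T_corr T_poll deph f \<xi>)"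


section \<open>Well-definedness\<close>

text \<open>
  The constructions above use pushforwards, products, binds and projective limits of measures,
  which are meaningful only for measurable arguments. Here this is verified:
  \<open>chain_law\<close> and \<open>parrep_law\<close> are probability measures, with the finite-dimensional
  distributions described by \<open>ionescu_tulcea_law_restrict\<close>.
\<close>

lemma ionescu_tulceaI:
  assumes Q: "\<And>i. Q i \<in> (\<Pi>\<^sub>M j\<in>{0..<i}. E) \<rightarrow>\<^sub>M prob_algebra E"
  shows "Ionescu_Tulcea Q (\<lambda>_. E)"
  unfolding Ionescu_Tulcea_def
proof (intro conjI allI impI)
  show "Q i \<in> (\<Pi>\<^sub>M j\<in>{0..<i}. E) \<rightarrow>\<^sub>M subprob_algebra E" for i
    by (rule measurable_prob_algebraD[OF Q])
  fix i :: nat and x assume "x \<in> space (\<Pi>\<^sub>M j\<in>{0..<i}. E)"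
  from measurable_space[OF Q this] show "prob_space (Q i x)"
    by (simp add: space_prob_algebra)
qed

lemma ionescu_tulcea_law_prob:
  assumes "\<And>i. Q i \<in> (\<Pi>\<^sub>M j\<in>{0..<i}. E) \<rightarrow>\<^sub>M prob_algebra E"
  shows "ionescu_tulcea_law E Q \<in> space (prob_algebra (\<Pi>\<^sub>M j\<in>(UNIV::nat set). E))"
proof -
  interpret Ionescu_Tulcea Q "\<lambda>_. E" by (rule ionescu_tulceaI[OF assms])
  have "emeasure PF.lim (PF.emb UNIV {} (space (PiM {} (\<lambda>_. E)))) = 1"
    using prob_space.emeasure_space_1[OF PF.prob_space_P, of "{}"]
    by (subst lim) (auto simp: PF.space_P)
  then have "prob_space PF.lim"
    by (intro prob_spaceI) (simp add: prod_emb_def space_PiM vimage_def fun_eq_iff)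
  then show ?thesis
    by (simp add: ionescu_tulcea_law_def space_prob_algebra)
qed

lemma measurable_ionescu_tulcea_law:
  assumes Q: "\<And>i. (\<lambda>(x, \<omega>). Q x i \<omega>) \<in> (L \<Otimes>\<^sub>M (\<Pi>\<^sub>M j\<in>{0..<i}. E)) \<rightarrow>\<^sub>M prob_algebra E"
  shows "(\<lambda>x. ionescu_tulcea_law E (Q x)) \<in> L \<rightarrow>\<^sub>M prob_algebra (\<Pi>\<^sub>M j\<in>(UNIV::nat set). E)"
proof (rule measurable_prob_algebra_generated[OF sets_PiM Int_stable_prod_algebra prod_algebra_sets_into_space])
  have Qx: "Q x i \<in> (\<Pi>\<^sub>M j\<in>{0..<i}. E) \<rightarrow>\<^sub>M prob_algebra E" if "x \<in> space L" for x i
    using measurable_compose[OF measurable_Pair1'[OF that] Q] by simp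
  show "prob_space (ionescu_tulcea_law E (Q x))"
    "sets (ionescu_tulcea_law E (Q x)) = sets (\<Pi>\<^sub>M j\<in>(UNIV::nat set). E)" if "x \<in> space L" for x
    using ionescu_tulcea_law_prob[OF Qx[OF that]] by (auto simp: space_prob_algebra)
  have C: "(\<lambda>x. Ionescu_Tulcea.C (Q x) (\<lambda>_. E) 0 n (\<lambda>_. undefined)) \<in> L \<rightarrow>\<^sub>M prob_algebra (\<Pi>\<^sub>M j\<in>{0..<n}. E)" for n
  proof (induction n)
    case 0
    have "(\<lambda>x. Ionescu_Tulcea.C (Q x) (\<lambda>_. E) 0 0 (\<lambda>_. undefined)) \<in> L \<rightarrow>\<^sub>M prob_algebra (\<Pi>\<^sub>M j\<in>{0..<0::nat}. E)
      \<longleftrightarrow> (\<lambda>x. return (\<Pi>\<^sub>M j\<in>{0..<0::nat}. E) (\<lambda>_. undefined)) \<in> L \<rightarrow>\<^sub>M prob_algebra (\<Pi>\<^sub>M j\<in>{0..<0::nat}. E)"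
      by (rule measurable_cong, subst Ionescu_Tulcea.C.simps(1)[OF ionescu_tulceaI[OF Qx]]) auto
    then show ?case
      by (auto simp: space_prob_algebra space_PiM intro!: prob_space_return)
  next
    case (Suc n)
    have *: "(\<lambda>x. Ionescu_Tulcea.C (Q x) (\<lambda>_. E) 0 n (\<lambda>_. undefined) \<bind> 
        (\<lambda>\<omega>. distr (Q x n \<omega>) (\<Pi>\<^sub>M j\<in>{0..<Suc n}. E) (fun_upd \<omega> n)))
        \<in> L \<rightarrow>\<^sub>M prob_algebra (\<Pi>\<^sub>M j\<in>{0..<Suc n}. E)"
    proof (intro measurable_bind_prob_space2[OF Suc.IH])
      show "(\<lambda>(x, \<omega>). distr (Q x n \<omega>) (\<Pi>\<^sub>M j\<in>{0..<Suc n}. E) (fun_upd \<omega> n))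
        \<in> L \<Otimes>\<^sub>M (\<Pi>\<^sub>M j\<in>{0..<n}. E) \<rightarrow>\<^sub>M prob_algebra (\<Pi>\<^sub>M j\<in>{0..<Suc n}. E)"
        unfolding split_beta' using Q[of n]
        by (intro measurable_distr_prob_space2[where M=E])
           (auto simp: split_beta' intro!: measurable_fun_upd[where J="{0..<n}"])
    qed
    show ?case
      proof (rule measurable_cong[THEN iffD1, OF _ *])
      fix x assume "x \<in> space L"
      interpret Ionescu_Tulcea "Q x" "\<lambda>_. E" by (rule ionescu_tulceaI[OF Qx[OF \<open>x \<in> space L\<close>]])
      show "C 0 n (\<lambda>_. undefined) \<bind> (\<lambda>\<omega>. distr (Q x n \<omega>) (\<Pi>\<^sub>M j\<in>{0..<Suc n}. E) (fun_upd \<omega> n)) =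
        C 0 (Suc n) (\<lambda>_. undefined)"
        by (simp add: eP_def[abs_def])
    qed
  qed
  fix A assume "A \<in> prod_algebra (UNIV::nat set) (\<lambda>_. E)"
  then obtain J X where J: "finite J" "X \<in> (\<Pi> j\<in>J. sets E)" and A: "A = prod_emb UNIV (\<lambda>_. E) J (Pi\<^sub>E J X)"
    by (auto simp: prod_algebra_def)
  define n where "n = Suc (Max (insert 0 J))"
  have Jn: "J \<subseteq> {0..<n}" using J by (auto simp: n_def less_Suc_eq_le)
  have "(\<lambda>x. emeasure (Ionescu_Tulcea.C (Q x) (\<lambda>_. E) 0 n (\<lambda>_. undefined)) (prod_emb {0..<n} (\<lambda>_. E) J (Pi\<^sub>E J X)))
     \<in> borel_measurable L"
    using Jn J by (intro measurable_compose[OF measurable_prob_algebraD[OF C] measurable_emeasure_subprob_algebra] sets_PiM_I) auto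
  then show "(\<lambda>x. emeasure (ionescu_tulcea_law E (Q x)) A) \<in> borel_measurable L"
  proof (rule measurable_cong[THEN iffD1, rotated])
    fix x assume "x \<in> space L"
    interpret Ionescu_Tulcea "Q x" "\<lambda>_. E" by (rule ionescu_tulceaI[OF Qx[OF \<open>x \<in> space L\<close>]])
    show "emeasure (C 0 n (\<lambda>_. undefined)) (prod_emb {0..<n} (\<lambda>_. E) J (Pi\<^sub>E J X)) = emeasure (ionescu_tulcea_law E (Q x)) A"
      proof -
      have X: "Pi\<^sub>E J X \<in> sets (\<Pi>\<^sub>M j\<in>J. E)" using J by (auto intro!: sets_PiM_I_finite)
      show ?thesis
        unfolding A ionescu_tulcea_law_def lim[OF J(1) X] by (rule emeasure_CI[OF Jn X, symmetric])
    qed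
  qed
qed

lemma measurable_chain_law:
  assumes P[measurable]: "P \<in> Om \<rightarrow>\<^sub>M prob_algebra Om"
  shows "chain_law Om P \<in> prob_algebra Om \<rightarrow>\<^sub>M prob_algebra (\<Pi>\<^sub>M j\<in>(UNIV::nat set). Om)"
  unfolding chain_law_def[abs_def]
proof (rule measurable_ionescu_tulcea_law)
  fix i show "(\<lambda>(x, \<omega>). case i of 0 \<Rightarrow> x | Suc n \<Rightarrow> P (\<omega> n))
    \<in> prob_algebra Om \<Otimes>\<^sub>M Pi\<^sub>M {0..<i} (\<lambda>j. Om) \<rightarrow>\<^sub>M prob_algebra Om"
    by (cases i) (auto simp: split_beta')
qed


lemma ionescu_tulcea_law_restrict:
  assumes Q: "\<And>i. Q i \<in> (\<Pi>\<^sub>M j\<in>{0..<i}. E) \<rightarrow>\<^sub>M prob_algebra E"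
  shows "distr (ionescu_tulcea_law E Q) (\<Pi>\<^sub>M j\<in>{0..<Suc n}. E) (\<lambda>\<omega>. restrict \<omega> {0..<Suc n}) =
     distr (ionescu_tulcea_law E Q) (\<Pi>\<^sub>M j\<in>{0..<n}. E) (\<lambda>\<omega>. restrict \<omega> {0..<n}) \<bind>
       (\<lambda>\<omega>. distr (Q n \<omega>) (\<Pi>\<^sub>M j\<in>{0..<Suc n}. E) (fun_upd \<omega> n))"
proof -
  interpret Ionescu_Tulcea Q "\<lambda>_. E" by (rule ionescu_tulceaI[OF Q])
  have C: "distr (ionescu_tulcea_law E Q) (\<Pi>\<^sub>M j\<in>{0..<m}. E) (\<lambda>\<omega>. restrict \<omega> {0..<m}) = C 0 m (\<lambda>_. undefined)" for m
  proof -
    have "up_to {0..<m} = m"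
      using up_to[of "{0..<m}"] by (intro antisym) (auto simp: up_to_iff_Ico ivl_subset)
    moreover have "distr (C 0 m (\<lambda>x. undefined)) (\<Pi>\<^sub>M j\<in>{0..<m}. E) (\<lambda>f. restrict f {0..<m}) = C 0 m (\<lambda>_. undefined)"
      using sets_C[of "\<lambda>_. undefined" 0 m] by (intro distr_cong[THEN trans, OF _ _ _ distr_id2]) (auto simp: space_C space_PiM PiE_iff extensional_restrict)
    ultimately show ?thesis
      unfolding ionescu_tulcea_law_def by (simp add: distr_lim CI_def)
  qed
  show ?thesis unfolding C by (simp add: eP_def[abs_def])
qed

lemma sets_prob_kernel: "K \<in> L \<rightarrow>\<^sub>M prob_algebra E \<Longrightarrow> x \<in> space L \<Longrightarrow> sets (K x) = sets E \<and> prob_space (K x)"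
  using measurable_space[of K L "prob_algebra E" x] by (auto simp: space_prob_algebra)

lemma measurable_PiM_prob:
  assumes I: "finite I" and K: "\<And>i. i \<in> I \<Longrightarrow> K i \<in> L \<rightarrow>\<^sub>M prob_algebra (E i)"
  shows "(\<lambda>x. \<Pi>\<^sub>M i\<in>I. K i x) \<in> L \<rightarrow>\<^sub>M prob_algebra (\<Pi>\<^sub>M i\<in>I. E i)"
proof (rule measurable_prob_algebra_generated[OF sets_PiM Int_stable_prod_algebra prod_algebra_sets_into_space])
  note K' = sets_prob_kernel[OF K]
  show "sets (\<Pi>\<^sub>M i\<in>I. K i x) = sets (\<Pi>\<^sub>M i\<in>I. E i)" if "x \<in> space L" for x
    using K' that by (intro sets_PiM_cong) auto
  show "prob_space (\<Pi>\<^sub>M i\<in>I. K i x)" if "x \<in> space L" for x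
    using K' that by (intro prob_space_PiM) auto
  fix A assume "A \<in> prod_algebra I E"
  then obtain X where A: "A = Pi\<^sub>E I X" "\<And>i. i \<in> I \<Longrightarrow> X i \<in> sets (E i)"
    by (auto simp: prod_algebra_eq_finite[OF I])
  have "(\<lambda>x. \<Prod>i\<in>I. emeasure (K i x) (X i)) \<in> borel_measurable L"
    using A K by (intro borel_measurable_prod_ennreal measurable_compose[OF measurable_prob_algebraD[OF K] measurable_emeasure_subprob_algebra]) auto
  then show "(\<lambda>x. emeasure (\<Pi>\<^sub>M i\<in>I. K i x) A) \<in> borel_measurable L"
  proof (rule measurable_cong[THEN iffD1, rotated])
    fix x assume x: "x \<in> space L"
    define K0 where "K0 i = (if i \<in> I then K i x else return (count_space UNIV) undefined)" for i
    interpret product_prob_space K0 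
      using K' x by (intro product_prob_spaceI) (auto simp: K0_def prob_space_return)
    have "emeasure (Pi\<^sub>M I K0) (Pi\<^sub>E I X) = (\<Prod>i\<in>I. emeasure (K0 i) (X i))"
      using A x K' by (intro emeasure_PiM[OF I]) (auto simp: K0_def)
    moreover have "Pi\<^sub>M I K0 = (\<Pi>\<^sub>M i\<in>I. K i x)" by (intro PiM_cong) (auto simp: K0_def)
    ultimately show "(\<Prod>i\<in>I. emeasure (K i x) (X i)) = emeasure (\<Pi>\<^sub>M i\<in>I. K i x) A"
      by (simp add: A K0_def)
  qed
qed

lemma measurable_replica_law:
  assumes P[measurable]: "P \<in> Om \<rightarrow>\<^sub>M prob_algebra Om"
    and D: "D \<in> space (prob_algebra (\<Pi>\<^sub>M i\<in>{1..N}. Om))"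
  shows "replica_law Om P N D \<in> space (prob_algebra (\<Pi>\<^sub>M i\<in>{1..N}. \<Pi>\<^sub>M j\<in>(UNIV::nat set). Om))"
proof -
  have "(\<lambda>x. \<Pi>\<^sub>M i\<in>{1..N}. chain_law Om P (return Om (x i))) 
     \<in> (\<Pi>\<^sub>M i\<in>{1..N}. Om) \<rightarrow>\<^sub>M prob_algebra (\<Pi>\<^sub>M i\<in>{1..N}. \<Pi>\<^sub>M j\<in>(UNIV::nat set). Om)"
    by (intro measurable_PiM_prob measurable_compose[OF _ measurable_chain_law[OF P]] 
       measurable_compose[OF _ measurable_return_prob_space] measurable_component_singleton) auto
  from prob_space_bind'[OF D this] sets_bind'[OF D this] show ?thesis
    by (simp add: replica_law_def space_prob_algebra)
qed

lemma measurable_state[measurable]: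
  "running \<in> pr_space Om \<rightarrow>\<^sub>M count_space UNIV"
  "X_cur \<in> pr_space Om \<rightarrow>\<^sub>M Om"
  "f_sim \<in> pr_space Om \<rightarrow>\<^sub>M borel"
  "T_sim \<in> pr_space Om \<rightarrow>\<^sub>M count_space UNIV"
  "stuck \<in> pr_space Om \<rightarrow>\<^sub>M pr_space Om"
  unfolding running_def[abs_def] X_cur_def[abs_def] f_sim_def[abs_def] T_sim_def[abs_def] stuck_def[abs_def] pr_space_def
  by measurable

lemma measurable_decorrelation_update:
  assumes \<S>[measurable]: "finite \<S>" "\<S> \<subseteq> sets Om" and f[measurable]: "f \<in> borel_measurable Om"
  shows "(\<lambda>(s, \<omega>). decorrelation_update \<S> T_corr f s \<omega>) \<in> pr_space Om \<Otimes>\<^sub>M (\<Pi>\<^sub>M j\<in>(UNIV::nat set). Om) \<rightarrow>\<^sub>M pr_space Om"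
proof -
  let ?M = "pr_space Om \<Otimes>\<^sub>M (\<Pi>\<^sub>M j\<in>(UNIV::nat set). Om)"
  have d1: "Measurable.pred ?M (\<lambda>x. \<exists>S\<in>\<S>. \<forall>j<T_corr. snd x (n - j) \<in> S)" for n
  proof (rule pred_intros_finite(4)[OF \<S>(1)])
    fix S assume "S \<in> \<S>"
    then have [measurable]: "S \<in> sets Om" using \<S>(2) by auto
    show "Measurable.pred ?M (\<lambda>x. \<forall>j<T_corr. snd x (n - j) \<in> S)" by measurable
  qed
  then have d[measurable]: "Measurable.pred ?M (\<lambda>x. decorrelated \<S> T_corr (snd x) n)" for n
    unfolding decorrelated_def by measurable
  have upd: "(\<lambda>x. (True, snd x n, f_sim (fst x) + (\<Sum>i=1..n. f (snd x i)), T_sim (fst x) + n)) \<in> ?M \<rightarrow>\<^sub>M pr_space Om" for n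
  proof -
    have "(\<lambda>x. (True, snd x n, f_sim (fst x) + (\<Sum>i=1..n. f (snd x i)), T_sim (fst x) + n)) \<in> ?M \<rightarrow>\<^sub>M 
      count_space UNIV \<Otimes>\<^sub>M (Om \<Otimes>\<^sub>M (borel \<Otimes>\<^sub>M count_space UNIV))" by measurable
    then show ?thesis by (simp add: pr_space_def)
  qed
  have "(\<lambda>x. LEAST n. decorrelated \<S> T_corr (snd x) n) \<in> ?M \<rightarrow>\<^sub>M count_space UNIV" by measurable
  from measurable_compose_countable[OF upd this]
  show ?thesis unfolding decorrelation_update_def split_beta' Let_def by measurable
qed

lemma measurable_parallel_update:
  assumes S[measurable]: "S \<in> sets Om" and f[measurable]: "f \<in> borel_measurable Om"
  shows "(\<lambda>(s, Y). parallel_update N T_poll f S s Y) \<in> pr_space Om \<Otimes>\<^sub>M (\<Pi>\<^sub>M i\<in>{1..N}. \<Pi>\<^sub>M j\<in>(UNIV::nat set). Om) \<rightarrow>\<^sub>M pr_space Om"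
proof -
  let ?M = "pr_space Om \<Otimes>\<^sub>M (\<Pi>\<^sub>M i\<in>{1..N}. \<Pi>\<^sub>M j\<in>(UNIV::nat set). Om)"
  have Y[measurable]: "(\<lambda>x. snd x i j) \<in> ?M \<rightarrow>\<^sub>M Om" if "i \<in> {1..N}" for i j
  proof -
    have "(\<lambda>x. snd x i) \<in> ?M \<rightarrow>\<^sub>M (\<Pi>\<^sub>M j\<in>(UNIV::nat set). Om)"
      by (rule measurable_compose[OF measurable_snd measurable_component_singleton[OF that]])
    then show ?thesis by (rule measurable_compose) measurable
  qed
  have Yf[measurable]: "(\<lambda>x. f (snd x i j)) \<in> ?M \<rightarrow>\<^sub>M borel" if "i \<in> {1..N}" for i j
    using Y[OF that] by measurable
  have YS[measurable]: "Measurable.pred ?M (\<lambda>x. snd x i j \<notin> S)" if "i \<in> {1..N}" for i j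
    using Y[OF that] by measurable
  have l: "Measurable.pred ?M (\<lambda>x. leaves S T_poll (snd x) M i)" if "i \<in> {1..N}" for M i
    unfolding leaves_def by (intro pred_intros_finite YS[OF that]) (auto simp: poll_window_def)
  have l1[measurable]: "Measurable.pred ?M (\<lambda>x. \<exists>i\<in>{1..N}. leaves S T_poll (snd x) M i)" for M
    using l by (intro pred_intros_finite) auto
  have l2[measurable]: "Measurable.pred ?M (\<lambda>x. i \<in> {1..N} \<and> leaves S T_poll (snd x) M i)" for M i
    using l by (cases "i \<in> {1..N}") auto
  define u where "u M K \<tau> x = (True, snd x K \<tau>,
               f_sim (fst x)
                 + (\<Sum>m=1..<M. \<Sum>i=1..N. \<Sum>j\<in>poll_window T_poll m. f (snd x i j))
                 + (\<Sum>i=1..<K. \<Sum>j\<in>poll_window T_poll M. f (snd x i j))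
                 + (\<Sum>j=(M - 1) * T_poll + 1..\<tau>. f (snd x K j)),
               T_sim (fst x) + ((M - 1) * (N * T_poll) + (K - 1) * T_poll + (\<tau> - (M - 1) * T_poll)))"
    for M K \<tau> and x :: "'a pr_state \<times> (nat \<Rightarrow> nat \<Rightarrow> 'a)"
  have u: "u M K \<tau> \<in> ?M \<rightarrow>\<^sub>M pr_space Om" if K: "K \<in> {1..N}" for M K \<tau>
  proof -
    have [measurable]: "(\<lambda>x. \<Sum>i=1..<K. \<Sum>j\<in>poll_window T_poll M. f (snd x i j)) \<in> ?M \<rightarrow>\<^sub>M borel"
      using K by (intro borel_measurable_sum Yf) auto
    have [measurable]: "(\<lambda>x. \<Sum>m=1..<M. \<Sum>i=1..N. \<Sum>j\<in>poll_window T_poll m. f (snd x i j)) \<in> ?M \<rightarrow>\<^sub>M borel"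
      by (intro borel_measurable_sum Yf) auto
    have [measurable]: "(\<lambda>x. (\<Sum>j=(M - 1) * T_poll + 1..\<tau>. f (snd x K j))) \<in> ?M \<rightarrow>\<^sub>M borel"
      using K by (intro borel_measurable_sum Yf) auto
    note Y[OF K, measurable]
    have "u M K \<tau> \<in> ?M \<rightarrow>\<^sub>M count_space UNIV \<Otimes>\<^sub>M (Om \<Otimes>\<^sub>M (borel \<Otimes>\<^sub>M count_space UNIV))"
      unfolding u_def[abs_def] by measurable
    then show ?thesis by (simp add: pr_space_def)
  qed
  define Mf where "Mf x = (LEAST M. M \<ge> 1 \<and> (\<exists>i\<in>{1..N}. leaves S T_poll (snd x) M i))" for x :: "'a pr_state \<times> (nat \<Rightarrow> nat \<Rightarrow> 'a)"
  define Kf where "Kf M x = (LEAST i. i \<in> {1..N} \<and> leaves S T_poll (snd x) M i)" for M and x :: "'a pr_state \<times> (nat \<Rightarrow> nat \<Rightarrow> 'a)"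
  define tf where "tf M K x = (LEAST j. j \<in> poll_window T_poll M \<and> snd x K j \<notin> S)" for M K and x :: "'a pr_state \<times> (nat \<Rightarrow> nat \<Rightarrow> 'a)"
  define v where "v M K x = (if K \<in> {1..N} then u M K (tf M K x) x else stuck (fst x))" for M K x
  have Mf: "Mf \<in> ?M \<rightarrow>\<^sub>M count_space UNIV" unfolding Mf_def[abs_def] by measurable
  have Kf: "Kf M \<in> ?M \<rightarrow>\<^sub>M count_space UNIV" for M unfolding Kf_def[abs_def] by measurable
  have v: "v M K \<in> ?M \<rightarrow>\<^sub>M pr_space Om" for M K
  proof (cases "K \<in> {1..N}")
    case True
    have "tf M K \<in> ?M \<rightarrow>\<^sub>M count_space UNIV" unfolding tf_def[abs_def] using YS[OF True] by measurable
    from measurable_compose_countable[OF u[OF True] this] show ?thesis using True by (simp add: v_def[abs_def])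
  qed (auto simp: v_def[abs_def])
  have w: "(\<lambda>x. v (Mf x) (Kf (Mf x) x) x) \<in> ?M \<rightarrow>\<^sub>M pr_space Om"
    by (rule measurable_compose_countable[OF measurable_compose_countable[OF v Kf] Mf])
  have eq: "(\<lambda>(s, Y). parallel_update N T_poll f S s Y) = 
     (\<lambda>x. if \<exists>M\<ge>1. \<exists>i\<in>{1..N}. leaves S T_poll (snd x) M i then v (Mf x) (Kf (Mf x) x) x else stuck (fst x))"
  proof (rule ext)
    fix x :: "'a pr_state \<times> (nat \<Rightarrow> nat \<Rightarrow> 'a)"
    show "(case x of (s, Y) \<Rightarrow> parallel_update N T_poll f S s Y) =
        (if \<exists>M\<ge>1. \<exists>i\<in>{1..N}. leaves S T_poll (snd x) M i then v (Mf x) (Kf (Mf x) x) x else stuck (fst x))"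
    proof (cases "\<exists>M\<ge>1. \<exists>i\<in>{1..N}. leaves S T_poll (snd x) M i")
      case True
      then have "1 \<le> Mf x \<and> (\<exists>i\<in>{1..N}. leaves S T_poll (snd x) (Mf x) i)"
        unfolding Mf_def by (rule LeastI_ex)
      then have "\<exists>i. i \<in> {1..N} \<and> leaves S T_poll (snd x) (Mf x) i" by auto
      then have "Kf (Mf x) x \<in> {1..N} \<and> leaves S T_poll (snd x) (Mf x) (Kf (Mf x) x)"
        unfolding Kf_def by (rule LeastI_ex)
      then have "v (Mf x) (Kf (Mf x) x) x = u (Mf x) (Kf (Mf x) x) (tf (Mf x) (Kf (Mf x) x) x) x"
        by (simp add: v_def)
      with True show ?thesis
        unfolding split_beta' parallel_update_def Let_def u_def Mf_def Kf_def tf_def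
        by (simp only: if_True)
    next
      case False
      then show ?thesis unfolding split_beta' parallel_update_def by (simp only: if_False)
    qed
  qed
  show ?thesis unfolding eq using w by measurable
qed

lemma parrep_law_prob:
  assumes P[measurable]: "P \<in> Om \<rightarrow>\<^sub>M prob_algebra Om"
    and \<S>: "finite \<S>" "\<S> \<subseteq> sets Om" "disjoint \<S>"
    and \<nu>: "\<And>S. S \<in> \<S> \<Longrightarrow> \<nu> S \<in> space (prob_algebra Om)"
    and deph: "exact_dephasing Om \<S> N \<nu> deph"
    and f: "f \<in> borel_measurable Om" and \<xi>: "\<xi> \<in> space (prob_algebra Om)"
  shows "parrep_law Om P \<S> N T_corr T_poll deph f \<xi> \<in> space (prob_algebra (\<Pi>\<^sub>M j\<in>(UNIV::nat set). pr_space Om))"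
  unfolding parrep_law_def
proof (rule ionescu_tulcea_law_prob)
  fix i :: nat
  let ?H = "\<Pi>\<^sub>M j\<in>{0..<i}. pr_space Om"
  show "parrep_kernel Om P \<S> N T_corr T_poll deph f \<xi> i \<in> ?H \<rightarrow>\<^sub>M prob_algebra (pr_space Om)"
  proof (cases i)
    case 0
    have "(\<lambda>x. (True, x, 0, 0)) \<in> Om \<rightarrow>\<^sub>M pr_space Om" unfolding pr_space_def by measurable
    from measurable_space[OF measurable_distr_prob_space[OF this] \<xi>]
    have "distr \<xi> (pr_space Om) (\<lambda>x. (True, x, 0, 0)) \<in> space (prob_algebra (pr_space Om))" .
    then show ?thesis unfolding parrep_kernel_def 0 by simp
  next
    case (Suc k)
    have h[measurable]: "(\<lambda>h. h k) \<in> ?H \<rightarrow>\<^sub>M pr_space Om" using Suc by (intro measurable_component_singleton) auto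
    have st: "(\<lambda>s. return (pr_space Om) (stuck s)) \<in> pr_space Om \<rightarrow>\<^sub>M prob_algebra (pr_space Om)" by measurable
    have ds: "decorrelation_step Om P \<S> T_corr f \<in> pr_space Om \<rightarrow>\<^sub>M prob_algebra (pr_space Om)"
    proof -
      have "(\<lambda>s. distr (chain_law Om P (return Om (X_cur s))) (pr_space Om)
             (decorrelation_update \<S> T_corr f s)) \<in> pr_space Om \<rightarrow>\<^sub>M prob_algebra (pr_space Om)"
        by (intro measurable_distr_prob_space2[OF _ measurable_decorrelation_update] \<S> f measurable_compose[OF _ measurable_chain_law[OF P]])
           measurable
      with st show ?thesis unfolding decorrelation_step_def[abs_def] by measurable
    qed
    have ps: "(\<lambda>h. dephasing_parallel_step Om P \<S> N T_poll f (deph k h) (h k)) \<in> ?H \<rightarrow>\<^sub>M prob_algebra (pr_space Om)"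
    proof -
      define g where "g S s = distr (replica_law Om P N (\<Pi>\<^sub>M i\<in>{1..N}. \<nu> S)) (pr_space Om) (parallel_update N T_poll f S s)" for S s
      have g: "g S \<in> pr_space Om \<rightarrow>\<^sub>M prob_algebra (pr_space Om)" if "S \<in> \<S>" for S
      proof -
        have "(\<Pi>\<^sub>M i\<in>{1..N}. \<nu> S) \<in> space (prob_algebra (\<Pi>\<^sub>M i\<in>{1..N}. Om))"
          using \<nu>[OF that] by (auto simp: space_prob_algebra intro!: sets_PiM_cong prob_space_PiM)
        from measurable_replica_law[OF P this] that \<S> f show ?thesis
          unfolding g_def[abs_def]
          by (intro measurable_distr_prob_space2[OF _ measurable_parallel_update] measurable_const) auto
      qed
      have [measurable]: "Measurable.pred (pr_space Om) (\<lambda>s. X_cur s \<in> S)" if "S \<in> \<S>" for S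
        using that \<S> by (intro pred_sets2[OF _ measurable_state(2)]) auto
      define G where "G T s = (if running s \<and> (\<exists>S\<in>T. X_cur s \<in> S) then g (THE S. S \<in> \<S> \<and> X_cur s \<in> S) s else return (pr_space Om) (stuck s))" for T s
      have the: "(THE S. S \<in> \<S> \<and> X_cur s \<in> S) = S" if "S \<in> \<S>" "X_cur s \<in> S" for S s
        using that \<S>(3) by (intro the_equality) (auto simp: pairwise_def disjnt_def)
      have "finite T \<Longrightarrow> T \<subseteq> \<S> \<Longrightarrow> G T \<in> pr_space Om \<rightarrow>\<^sub>M prob_algebra (pr_space Om)" for T
      proof (induction T rule: finite_induct)
        case empty then show ?case using st by (simp add: G_def[abs_def])
      next
        case (insert S T)
        have eq: "G (insert S T) = (\<lambda>s. if running s \<and> X_cur s \<in> S then g S s else G T s)"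
          using the insert by (auto simp: G_def fun_eq_iff)
        from insert have [measurable]: "S \<in> \<S>" "G T \<in> pr_space Om \<rightarrow>\<^sub>M prob_algebra (pr_space Om)" by auto
        note g[of S, measurable]
        show ?case unfolding eq by measurable
      qed
      then have G: "G \<S> \<in> pr_space Om \<rightarrow>\<^sub>M prob_algebra (pr_space Om)" using \<S> by auto
      have "dephasing_parallel_step Om P \<S> N T_poll f (deph k h) (h k) = G \<S> (h k)" if "h \<in> space ?H" for h
      proof -
        have "h \<in> space (\<Pi>\<^sub>M i\<in>{0..k}. pr_space Om)" using that Suc by (simp add: atLeastLessThanSuc_atLeastAtMost)
        then have "deph k h S = (\<Pi>\<^sub>M i\<in>{1..N}. \<nu> S)" if "S \<in> \<S>" for S
          using deph that by (auto simp: exact_dephasing_def)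
        then have "deph k h (THE S. S \<in> \<S> \<and> X_cur (h k) \<in> S) = (\<Pi>\<^sub>M i\<in>{1..N}. \<nu> (THE S. S \<in> \<S> \<and> X_cur (h k) \<in> S))"
          if "\<exists>S\<in>\<S>. X_cur (h k) \<in> S"
        proof -
          from that obtain S where "S \<in> \<S>" "X_cur (h k) \<in> S" by blast
          with \<open>\<And>S. S \<in> \<S> \<Longrightarrow> deph k h S = (\<Pi>\<^sub>M i\<in>{1..N}. \<nu> S)\<close>[of S] the[of S "h k"] show ?thesis by metis
        qed
        then show ?thesis
          unfolding dephasing_parallel_step_def G_def g_def Let_def
          by (cases "\<exists>S\<in>\<S>. X_cur (h k) \<in> S") (simp_all only: simp_thms if_True if_False if_cancel split: if_split)
      qed
      then show ?thesis
        by (rule measurable_cong[THEN iffD2]) (auto intro: measurable_compose[OF h G])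
    qed
    show ?thesis
      unfolding parrep_kernel_def Suc using ps measurable_compose[OF h ds] Suc by (cases "even k") auto
  qed
qed

end

theory Submission
  imports Defs "HOL-Library.Discrete_Functions"
begin

text \<open>
  Let \<open>P\<close> also denote the transition operator and put \<open>\<phi> = f - \<mu>(f)\<close>. The \<^emph>\<open>excess\<close> of a step is the
  amount by which it changes \<open>f_sim - \<mu>(f) T_sim\<close>; it has to be shown that the excess accumulated in
  \<open>k\<close> steps is almost surely \<open>o(k)\<close>, because \<open>T_sim\<close> grows at least like \<open>k / 2\<close>: each parallel step
  advances it. Uniform ergodicity makes \<open>P\<^sup>n \<phi>\<close> decay geometrically, uniformly in the starting point, so
  \<open>h = (\<Sum>n\<ge>1. P\<^sup>n \<phi>)\<close> is a bounded solution of the Poisson equation \<open>h - P h = P \<phi>\<close>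
  (\<open>poisson_equation\<close>), and this \<open>h\<close> turns mean excesses into differences of a potential.

  A decorrelation step from \<open>x\<close> that ends in \<open>X\<^sub>\<sigma>\<close> has mean excess \<open>h(x) - E h(X\<^sub>\<sigma>)\<close>, by telescoping.
  For a parallel step in \<open>S\<close>, read the positions of the replicas in the order (round, replica, time)
  in which the algorithm accounts for them. By quasistationarity and independence the \<open>n\<close>-th position
  (from \<open>0\<close>) is reached with probability \<open>q\<^sup>n\<close>, where \<open>q\<close> is the probability that a step from \<open>\<nu>\<^sub>S\<close> stays in \<open>S\<close>, and
  is then distributed as \<open>X\<^sub>1\<close> under \<open>\<nu>\<^sub>S\<close> (\<open>integral_poll\<close>). Hence, whatever the number of replicas, the
  mean excess is \<open>\<nu>\<^sub>S(P \<phi>) / (1 - q) = \<nu>\<^sub>S(h) - E h(Y)\<close> for the exit point \<open>Y\<close>.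

  These differences do not quite telescope along the algorithm, since dephasing replaces \<open>X\<^sub>\<sigma>\<close> by fresh
  samples and the potential jumps from \<open>h(X\<^sub>\<sigma>)\<close> to \<open>\<nu>\<^sub>S(h)\<close>. Exact decorrelation says that this jump has
  mean zero if the decorrelation step starts from the exit point of a parallel step
  (\<open>exit_mismatch\<close>): the exit step itself then counts as the first of the \<open>T_corr\<close> steps into the new
  set. So let the potential be \<open>\<nu>\<^sub>S(h)\<close> after a decorrelation step that ended in \<open>S\<close>, and after a parallel step
  that ended in \<open>x\<close> let it be \<open>h(x)\<close> plus the mean jump of a decorrelation step from \<open>x\<close>. Then
  \<open>f_sim - \<mu>(f) T_sim + potential\<close> is a martingale (\<open>decorrelation_increment\<close>,
  \<open>parallel_increment\<close>).

  Its increments have uniformly bounded second moments: by the Doeblin condition and ergodicity the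
  length of a decorrelation step has a geometric tail that does not depend on the starting point
  (\<open>decorrelation_tail\<close>), and the escape rates do the same for parallel steps. A martingale with such
  increments is \<open>o(k)\<close> by the elementary law of large numbers \<open>AE_average_tendsto_0\<close>.
\<close>

section \<open>Averages and total variation\<close>

text \<open>
  Contraction by a factor \<open>r\<close> once in every \<open>L\<close> steps is turned into a genuine geometric bound, the
  form in which series over the steps can be summed.
\<close>

lemma power_div_le_geometric:
  fixes r :: real
  assumes "0 < r" "r < 1" "0 < L"
  shows "\<exists>C \<rho>. 0 \<le> C \<and> 0 \<le> \<rho> \<and> \<rho> < 1 \<and> (\<forall>n. r ^ (n div L) \<le> C * \<rho> ^ n)"
proof (intro exI conjI allI)
  define \<rho> where "\<rho> = root L r"
  have \<rho>: "0 < \<rho>" "\<rho> < 1" "\<rho> ^ L = r"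
    using assms by (auto simp: \<rho>_def real_root_gt_zero real_root_lt_1_iff)
  show "0 \<le> 1 / \<rho> ^ L" "0 \<le> \<rho>" "\<rho> < 1" using \<rho> by auto
  fix n
  have "r ^ (n div L) * \<rho> ^ L \<le> r ^ (n div L) * \<rho> ^ (n mod L)"
    using \<rho> assms by (intro mult_left_mono power_decreasing) (auto simp: less_imp_le)
  also have "\<dots> = \<rho> ^ n"
    unfolding \<rho>(3)[symmetric] power_mult[symmetric] power_add[symmetric] by simp
  finally show "r ^ (n div L) \<le> 1 / \<rho> ^ L * \<rho> ^ n"
    using \<rho> assms(1) by (simp add: field_simps)
qed

text \<open>
  The expected sum of the squares is finite, so almost surely the squares are summable.
\<close>

lemma AE_tendsto_0_if_summable_second_moments:
  fixes X :: "nat \<Rightarrow> 'a \<Rightarrow> real"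
  assumes [measurable]: "\<And>n. X n \<in> borel_measurable M"
    and bound: "\<And>n. (\<integral>\<^sup>+x. ennreal ((X n x)\<^sup>2) \<partial>M) \<le> ennreal (b n)"
    and b: "summable b" "\<And>n. 0 \<le> b n"
  shows "AE x in M. (\<lambda>n. X n x) \<longlonglongrightarrow> 0"
proof -
  have "(\<integral>\<^sup>+x. (\<Sum>n. ennreal ((X n x)\<^sup>2)) \<partial>M) = (\<Sum>n. \<integral>\<^sup>+x. ennreal ((X n x)\<^sup>2) \<partial>M)"
    by (rule nn_integral_suminf) measurable
  also have "\<dots> \<le> (\<Sum>n. ennreal (b n))"
    by (intro suminf_le bound) auto
  also have "\<dots> < \<infinity>"
    using suminf_ennreal2[of b] b by (simp add: ennreal_suminf_neq_top[OF b] less_top)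
  finally have "AE x in M. (\<Sum>n. ennreal ((X n x)\<^sup>2)) \<noteq> \<infinity>"
    by (intro nn_integral_PInf_AE) auto
  then show ?thesis
  proof eventually_elim
    case (elim x)
    have "summable (\<lambda>n. (X n x)\<^sup>2)"
      using elim by (intro summable_suminf_not_top) auto
    then have "(\<lambda>n. (X n x)\<^sup>2) \<longlonglongrightarrow> 0" by (rule summable_LIMSEQ_zero)
    then have "(\<lambda>n. sqrt ((X n x)\<^sup>2)) \<longlonglongrightarrow> sqrt 0" by (rule tendsto_real_sqrt)
    then show ?case by (simp add: tendsto_rabs_zero_iff)
  qed
qed

lemma summable_inverse_squares_shift: "summable (\<lambda>k. c / (real k + 1)\<^sup>2)"
proof -
  have "summable (\<lambda>k. inverse ((real k + 1)\<^sup>2))"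
    using summable_Suc_iff[of "\<lambda>n. inverse (real n ^ 2)"] inverse_power_summable[of 2, where 'a=real]
    by (simp add: ac_simps)
  then show ?thesis
    using summable_mult[of "\<lambda>k. inverse ((real k + 1)\<^sup>2)" c] by (simp add: field_simps)
qed

text \<open>
  The second moments of \<open>S n / n\<close> are of order \<open>1 / n\<close>, hence summable along the squares
  \<open>n = (k + 1)\<^sup>2\<close>. Between two consecutive squares \<open>S\<close> moves by at most the sum of \<open>2 k + 3\<close> absolute
  increments, whose second moment is of order \<open>k\<^sup>2\<close> by the Cauchy-Schwarz inequality; divided by
  \<open>(k + 1)\<^sup>4\<close> this is summable as well.
\<close>

lemma AE_average_tendsto_0:
  fixes S :: "nat \<Rightarrow> 'a \<Rightarrow> real"
  assumes [measurable]: "\<And>n. S n \<in> borel_measurable M" and C: "0 \<le> C"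
    and S: "\<And>n. (\<integral>\<^sup>+x. ennreal ((S n x)\<^sup>2) \<partial>M) \<le> ennreal (C * (real n + 1))"
    and Y: "\<And>n. (\<integral>\<^sup>+x. ennreal ((S (Suc n) x - S n x)\<^sup>2) \<partial>M) \<le> ennreal C"
  shows "AE x in M. (\<lambda>n. S n x / real n) \<longlonglongrightarrow> 0"
proof -
  define X where "X k x = S ((Suc k)\<^sup>2) x / real ((Suc k)\<^sup>2)" for k x
  define I where "I k = {(Suc k)\<^sup>2..<(Suc (Suc k))\<^sup>2}" for k
  define Z where "Z k x = (\<Sum>n\<in>I k. \<bar>S (Suc n) x - S n x\<bar>) / real ((Suc k)\<^sup>2)" for k x
  have cI: "real (card (I k)) = 2 * real k + 3" for k
    by (simp add: I_def power2_eq_square algebra_simps)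
  have X: "AE x in M. (\<lambda>k. X k x) \<longlonglongrightarrow> 0"
  proof (rule AE_tendsto_0_if_summable_second_moments)
    show "X k \<in> borel_measurable M" for k unfolding X_def[abs_def] by measurable
    show "summable (\<lambda>k. 2 * C / (real k + 1)\<^sup>2)" by (rule summable_inverse_squares_shift)
    show "0 \<le> 2 * C / (real k + 1)\<^sup>2" for k using C by simp
    fix k
    let ?c = "1 / (real ((Suc k)\<^sup>2))\<^sup>2"
    have "(\<integral>\<^sup>+x. ennreal ((X k x)\<^sup>2) \<partial>M) = (\<integral>\<^sup>+x. ennreal ?c * ennreal ((S ((Suc k)\<^sup>2) x)\<^sup>2) \<partial>M)"
      by (intro nn_integral_cong) (simp add: X_def power_divide flip: ennreal_mult)
    also have "\<dots> = ennreal ?c * (\<integral>\<^sup>+x. ennreal ((S ((Suc k)\<^sup>2) x)\<^sup>2) \<partial>M)"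
      by (rule nn_integral_cmult) measurable
    also have "\<dots> \<le> ennreal ?c * ennreal (C * (real ((Suc k)\<^sup>2) + 1))"
      by (intro mult_left_mono S) auto
    also have "\<dots> = ennreal (?c * (C * (real ((Suc k)\<^sup>2) + 1)))"
      using C by (simp flip: ennreal_mult)
    also have "?c * (C * (real ((Suc k)\<^sup>2) + 1)) \<le> ?c * (C * (2 * real ((Suc k)\<^sup>2)))"
      using C by (intro mult_left_mono) auto
    also have "?c * (C * (2 * real ((Suc k)\<^sup>2))) = 2 * C / (real k + 1)\<^sup>2"
    proof -
      have "1 / a\<^sup>2 * (C * (2 * a)) = 2 * C / a" if "a \<noteq> 0" for a :: real
        using that by (simp add: power2_eq_square)
      from this[of "(real k + 1)\<^sup>2"] show ?thesis by (simp add: add.commute)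
    qed
    finally show "(\<integral>\<^sup>+x. ennreal ((X k x)\<^sup>2) \<partial>M) \<le> ennreal (2 * C / (real k + 1)\<^sup>2)"
      by (simp add: ennreal_leI)
  qed
  have Z: "AE x in M. (\<lambda>k. Z k x) \<longlonglongrightarrow> 0"
  proof (rule AE_tendsto_0_if_summable_second_moments)
    show "Z k \<in> borel_measurable M" for k unfolding Z_def[abs_def] by measurable
    show "summable (\<lambda>k. 9 * C / (real k + 1)\<^sup>2)" by (rule summable_inverse_squares_shift)
    show "0 \<le> 9 * C / (real k + 1)\<^sup>2" for k using C by simp
    fix k
    let ?c = "(2 * real k + 3) / (real ((Suc k)\<^sup>2))\<^sup>2"
    have "(Z k x)\<^sup>2 \<le> ?c * (\<Sum>n\<in>I k. (S (Suc n) x - S n x)\<^sup>2)" for x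
    proof -
      have "(\<Sum>n\<in>I k. \<bar>S (Suc n) x - S n x\<bar>)\<^sup>2 \<le> (2 * real k + 3) * (\<Sum>n\<in>I k. (S (Suc n) x - S n x)\<^sup>2)"
        using Cauchy_Schwarz_ineq_sum[of "\<lambda>_. 1" "\<lambda>n. \<bar>S (Suc n) x - S n x\<bar>" "I k"] by (simp add: cI)
      then show ?thesis by (simp add: Z_def power_divide divide_right_mono)
    qed
    then have "(\<integral>\<^sup>+x. ennreal ((Z k x)\<^sup>2) \<partial>M) \<le> (\<integral>\<^sup>+x. ennreal ?c * (\<Sum>n\<in>I k. ennreal ((S (Suc n) x - S n x)\<^sup>2)) \<partial>M)"
      by (intro nn_integral_mono) (simp add: sum_ennreal sum_nonneg ennreal_leI flip: ennreal_mult)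
    also have "\<dots> = ennreal ?c * (\<Sum>n\<in>I k. \<integral>\<^sup>+x. ennreal ((S (Suc n) x - S n x)\<^sup>2) \<partial>M)"
      by (subst nn_integral_cmult, measurable) (subst nn_integral_sum, auto)
    also have "\<dots> \<le> ennreal ?c * (\<Sum>n\<in>I k. ennreal C)"
      by (intro mult_left_mono sum_mono Y) auto
    also have "(\<Sum>n\<in>I k. ennreal C) = ennreal ((2 * real k + 3) * C)"
      using C by (subst sum_ennreal) (auto simp: cI)
    also have "ennreal ?c * \<dots> = ennreal (?c * ((2 * real k + 3) * C))"
      using C by (simp flip: ennreal_mult)
    also have "?c * ((2 * real k + 3) * C) = ((2 * real k + 3) / real ((Suc k)\<^sup>2))\<^sup>2 * C"
      by (simp add: power2_eq_square)
    also have "\<dots> \<le> (3 / (real k + 1))\<^sup>2 * C"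
    proof (intro mult_right_mono power_mono C)
      have "(2 * real k + 3) / (real k + 1)\<^sup>2 \<le> (3 * (real k + 1)) / (real k + 1)\<^sup>2"
        by (intro divide_right_mono) auto
      also have "\<dots> = 3 / (real k + 1)"
        by (simp only: power2_eq_square) (simp add: divide_simps del: distrib_left_numeral)
      finally show "(2 * real k + 3) / real ((Suc k)\<^sup>2) \<le> 3 / (real k + 1)"
        by (simp add: add.commute)
    qed auto
    also have "(3 / (real k + 1))\<^sup>2 * C = 9 * C / (real k + 1)\<^sup>2"
      by (simp add: power_divide)
    finally show "(\<integral>\<^sup>+x. ennreal ((Z k x)\<^sup>2) \<partial>M) \<le> ennreal (9 * C / (real k + 1)\<^sup>2)"
      by (simp add: ennreal_leI)
  qed
  from X Z show ?thesis
  proof eventually_elim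
    case (elim x)
    have "(\<lambda>k. \<bar>X k x\<bar> + Z k x) \<longlonglongrightarrow> 0"
      using tendsto_add[OF tendsto_rabs_zero[OF elim(1)] elim(2)] by simp
    moreover have "filterlim (\<lambda>n. floor_sqrt n - 1) at_top sequentially"
      unfolding filterlim_at_top
    proof
      fix Z :: nat
      show "\<forall>\<^sub>F n in sequentially. Z \<le> floor_sqrt n - 1"
        using eventually_ge_at_top[of "(Suc Z)\<^sup>2"]
      proof eventually_elim
        case (elim n)
        then have "Suc Z \<le> floor_sqrt n" by (simp add: le_floor_sqrt_iff)
        then show ?case by simp
      qed
    qed
    ultimately have lim: "(\<lambda>n. \<bar>X (floor_sqrt n - 1) x\<bar> + Z (floor_sqrt n - 1) x) \<longlonglongrightarrow> 0"
      by (rule filterlim_compose)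
    show ?case
    proof (rule Lim_null_comparison[OF _ lim])
      show "\<forall>\<^sub>F n in sequentially. norm (S n x / real n) \<le> \<bar>X (floor_sqrt n - 1) x\<bar> + Z (floor_sqrt n - 1) x"
        using eventually_ge_at_top[of 1]
      proof eventually_elim
        case (elim n)
        define k where "k = floor_sqrt n - 1"
        have k: "Suc k = floor_sqrt n"
          using elim by (simp add: k_def Suc_leI)
        then have k1: "(Suc k)\<^sup>2 \<le> n" "n < (Suc (Suc k))\<^sup>2"
          by (simp, metis Suc_floor_sqrt_power2_gt)
        have "S n x - S ((Suc k)\<^sup>2) x = (\<Sum>i\<in>{(Suc k)\<^sup>2..<n}. S (Suc i) x - S i x)"
          by (rule sum_Suc_diff'[OF k1(1), of "\<lambda>i. S i x", symmetric])
        also have "\<bar>\<dots>\<bar> \<le> (\<Sum>i\<in>{(Suc k)\<^sup>2..<n}. \<bar>S (Suc i) x - S i x\<bar>)" by (rule sum_abs)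
        also have "\<dots> \<le> (\<Sum>i\<in>I k. \<bar>S (Suc i) x - S i x\<bar>)"
          using k1 by (intro sum_mono2) (auto simp: I_def)
        finally have "\<bar>S n x\<bar> \<le> \<bar>S ((Suc k)\<^sup>2) x\<bar> + (\<Sum>i\<in>I k. \<bar>S (Suc i) x - S i x\<bar>)" by linarith
        then have "\<bar>S n x\<bar> / real n \<le> (\<bar>S ((Suc k)\<^sup>2) x\<bar> + (\<Sum>i\<in>I k. \<bar>S (Suc i) x - S i x\<bar>)) / real ((Suc k)\<^sup>2)"
          using k1(1) by (intro frac_le) (auto intro!: sum_nonneg add_nonneg_nonneg simp flip: of_nat_power simp del: power_Suc of_nat_Suc)
        then show ?case
          unfolding k_def[symmetric] X_def Z_def by (simp add: add_divide_distrib abs_divide)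
      qed
    qed
  qed
qed

lemma integral_diff_le_tv:
  fixes \<phi> :: "'a \<Rightarrow> real"
  assumes "prob_space M" "prob_space N" and sets: "sets N = sets M"
    and \<phi>[measurable]: "\<phi> \<in> borel_measurable M"
    and c: "\<And>x. x \<in> space M \<Longrightarrow> \<bar>\<phi> x\<bar> \<le> c" "0 < c"
    and d: "\<And>A. A \<in> sets M \<Longrightarrow> \<bar>measure M A - measure N A\<bar> \<le> d"
  shows "\<bar>(\<integral>x. \<phi> x \<partial>M) - (\<integral>x. \<phi> x \<partial>N)\<bar> \<le> 2 * c * d"
proof -
  interpret M: prob_space M by fact
  interpret N: prob_space N by fact
  have sp: "space N = space M" using sets by (rule sets_eq_imp_space_eq)
  have mN[measurable_cong]: "sets N = sets M" by fact
  \<comment> \<open>\<open>\<phi>\<close> is within \<open>2 * c / K\<close> of a step function with \<open>K\<close> steps of height \<open>2 * c / K\<close>\<close>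
  define A where "A K k = {x\<in>space M. real k \<le> real K * ((\<phi> x + c) / (2 * c))}" for K k :: nat
  define \<psi> where "\<psi> K x = (2 * c / real K) * (\<Sum>k\<in>{1..K}. indicator (A K k) x) - c" for K x
  have [measurable]: "A K k \<in> sets M" for K k unfolding A_def by measurable
  have close: "\<bar>\<phi> x - \<psi> K x\<bar> \<le> 2 * c / real K" if x: "x \<in> space M" and K: "0 < K" for x K
  proof -
    define t where "t = (\<phi> x + c) / (2 * c)"
    have t: "0 \<le> t" "t \<le> 1" using c(1)[OF x] c(2) by (auto simp: t_def)
    have "{1..K} \<inter> {k. x \<in> A K k} = {1..nat \<lfloor>real K * t\<rfloor>}"
    proof (intro set_eqI iffI)
      fix k assume k: "k \<in> {1..nat \<lfloor>real K * t\<rfloor>}"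
      then have *: "real k \<le> real K * t" "1 \<le> k" using t by (auto simp: le_nat_iff le_floor_iff)
      moreover have "real K * t \<le> real K * 1" using t by (intro mult_left_mono) auto
      ultimately show "k \<in> {1..K} \<inter> {k. x \<in> A K k}" using x by (auto simp: A_def t_def)
    next
      fix k assume "k \<in> {1..K} \<inter> {k. x \<in> A K k}"
      then show "k \<in> {1..nat \<lfloor>real K * t\<rfloor>}" using t by (auto simp: A_def t_def le_nat_iff le_floor_iff)
    qed
    then have "(\<Sum>k\<in>{1..K}. indicator (A K k) x) = real (nat \<lfloor>real K * t\<rfloor>)"
      by (simp add: indicator_def sum.If_cases of_bool_def)
    also have "\<dots> = of_int \<lfloor>real K * t\<rfloor>" using t by simp
    finally have eq: "\<psi> K x = (2 * c / real K) * of_int \<lfloor>real K * t\<rfloor> - c" by (simp add: \<psi>_def)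
    have "\<phi> x = (2 * c / real K) * (real K * t) - c" using c K by (simp add: t_def)
    then have "\<phi> x - \<psi> K x = (2 * c / real K) * (real K * t - of_int \<lfloor>real K * t\<rfloor>)"
      by (simp add: eq algebra_simps)
    moreover have "0 \<le> real K * t - of_int \<lfloor>real K * t\<rfloor>" "real K * t - of_int \<lfloor>real K * t\<rfloor> \<le> 1"
      by linarith+
    ultimately show ?thesis using c(2) K
      by (simp add: abs_mult) (metis abs_of_nonneg divide_right_mono mult_left_le of_nat_0_le_iff mult_nonneg_nonneg zero_le_numeral less_imp_le)
  qed
  have int\<psi>: "(\<integral>x. \<psi> K x \<partial>M) = (2 * c / real K) * (\<Sum>k\<in>{1..K}. measure M (A K k)) - c"
    "(\<integral>x. \<psi> K x \<partial>N) = (2 * c / real K) * (\<Sum>k\<in>{1..K}. measure N (A K k)) - c"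
    "integrable M (\<psi> K)" "integrable N (\<psi> K)" for K
    by (auto simp: \<psi>_def[abs_def] M.prob_space N.prob_space mN M.emeasure_eq_measure N.emeasure_eq_measure)
  have int\<phi>: "integrable M \<phi>" "integrable N \<phi>"
    using c by (auto intro!: M.integrable_const_bound[of _ c] N.integrable_const_bound[of _ c] AE_I2 simp: sp)
  have main: "\<bar>(\<integral>x. \<phi> x \<partial>M) - (\<integral>x. \<phi> x \<partial>N)\<bar> \<le> 2 * c * d + 4 * c / real K" if K: "0 < K" for K
  proof -
    have "\<bar>(\<integral>x. \<phi> x \<partial>M) - (\<integral>x. \<psi> K x \<partial>M)\<bar> \<le> 2 * c / real K"
    proof -
      have "\<bar>(\<integral>x. \<phi> x \<partial>M) - (\<integral>x. \<psi> K x \<partial>M)\<bar> = \<bar>\<integral>x. \<phi> x - \<psi> K x \<partial>M\<bar>" using int\<psi> int\<phi> by simp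
      also have "\<dots> \<le> (\<integral>x. \<bar>\<phi> x - \<psi> K x\<bar> \<partial>M)" by (rule integral_abs_bound)
      also have "\<dots> \<le> (\<integral>x. 2 * c / real K \<partial>M)"
        using int\<psi> int\<phi> close K by (intro integral_mono_AE) auto
      finally show ?thesis by (simp add: M.prob_space)
    qed
    moreover have "\<bar>(\<integral>x. \<phi> x \<partial>N) - (\<integral>x. \<psi> K x \<partial>N)\<bar> \<le> 2 * c / real K"
    proof -
      have "\<bar>(\<integral>x. \<phi> x \<partial>N) - (\<integral>x. \<psi> K x \<partial>N)\<bar> = \<bar>\<integral>x. \<phi> x - \<psi> K x \<partial>N\<bar>" using int\<psi> int\<phi> by simp
      also have "\<dots> \<le> (\<integral>x. \<bar>\<phi> x - \<psi> K x\<bar> \<partial>N)" by (rule integral_abs_bound)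
      also have "\<dots> \<le> (\<integral>x. 2 * c / real K \<partial>N)"
        using int\<psi> int\<phi> close K by (intro integral_mono_AE) (auto simp: sp)
      finally show ?thesis by (simp add: N.prob_space)
    qed
    moreover have "\<bar>(\<integral>x. \<psi> K x \<partial>M) - (\<integral>x. \<psi> K x \<partial>N)\<bar> \<le> 2 * c * d"
    proof -
      have "(\<integral>x. \<psi> K x \<partial>M) - (\<integral>x. \<psi> K x \<partial>N) =
          (2 * c / real K) * (\<Sum>k\<in>{1..K}. measure M (A K k) - measure N (A K k))"
        by (simp add: int\<psi> sum_subtractf algebra_simps)
      also have "\<bar>\<dots>\<bar> \<le> (2 * c / real K) * (\<Sum>k\<in>{1..K}. d)"
        unfolding abs_mult using c(2)
        by (intro mult_mono order_trans[OF sum_abs] sum_mono d) auto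
      also have "\<dots> = 2 * c * d" using K by simp
      finally show ?thesis .
    qed
    ultimately show ?thesis by linarith
  qed
  have "(\<lambda>K. 2 * c * d + 4 * c / real K) \<longlonglongrightarrow> 2 * c * d + 0"
    by (intro tendsto_intros lim_const_over_n)
  then show ?thesis
    using main by (intro LIMSEQ_le_const[of "\<lambda>K. 2 * c * d + 4 * c / real K"]) (auto intro!: exI[of _ 1])
qed

section \<open>Stopping at a geometrically tailed time\<close>

text \<open>
  Below, a process is observed until the first time \<open>n\<close> with \<open>D n\<close>, and the probability that this has
  not happened before time \<open>n\<close> is at most \<open>C * \<rho> ^ n\<close>. The first time itself is \<open>LEAST n. D n\<close>, which
  has an arbitrary value on the null event that \<open>D\<close> never happens.
\<close>

lemma (in prob_space) geometric_stopping_AE: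
  fixes D :: "nat \<Rightarrow> 'a \<Rightarrow> bool"
  assumes [measurable]: "\<And>n. Measurable.pred M (D n)"
    and tail: "\<And>n. prob {x\<in>space M. \<forall>i<n. \<not> D i x} \<le> C * \<rho> ^ n" and \<rho>: "0 \<le> \<rho>" "\<rho> < 1"
  shows "AE x in M. \<exists>n. D n x"
proof -
  have "prob {x\<in>space M. \<forall>i. \<not> D i x} \<le> C * \<rho> ^ n" for n
    using tail[of n] by (rule order_trans[OF finite_measure_mono, rotated -1]) auto
  moreover have "(\<lambda>n. C * \<rho> ^ n) \<longlonglongrightarrow> C * 0"
    using \<rho> by (intro tendsto_intros LIMSEQ_realpow_zero)
  ultimately have "prob {x\<in>space M. \<forall>i. \<not> D i x} \<le> 0"
    by (intro LIMSEQ_le_const[of "\<lambda>n. C * \<rho> ^ n"]) auto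
  then have "prob {x\<in>space M. \<not> (\<exists>i. D i x)} = 0" by (simp add: measure_le_0_iff)
  then show ?thesis
    by (subst AE_iff_measurable[OF _ refl]) (auto simp: emeasure_eq_measure)
qed

lemma ennreal_square_eq_sum_odd: "ennreal ((real k)\<^sup>2) = (\<Sum>n<k. ennreal (2 * real n + 1))"
proof -
  have "(real k)\<^sup>2 = (\<Sum>n<k. 2 * real n + 1)"
    by (induction k) (auto simp: power2_eq_square algebra_simps)
  then show ?thesis by (subst sum_ennreal) auto
qed

text \<open>
  A square is a sum of consecutive odd numbers, so the second moment of the stopping time is a sum
  of tail probabilities.
\<close>

lemma (in prob_space) geometric_stopping_square:
  fixes D :: "nat \<Rightarrow> 'a \<Rightarrow> bool"
  assumes [measurable]: "\<And>n. Measurable.pred M (D n)"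
    and tail: "\<And>n. prob {x\<in>space M. \<forall>i<n. \<not> D i x} \<le> C * \<rho> ^ n" and \<rho>: "0 \<le> \<rho>" "\<rho> < 1" and C: "0 \<le> C"
  shows "(\<integral>\<^sup>+x. ennreal ((real (LEAST n. D n x))\<^sup>2) \<partial>M) \<le> ennreal (2 * C / (1 - \<rho>)\<^sup>2)"
proof -
  let ?E = "\<lambda>n. {x\<in>space M. \<forall>i<n. \<not> D i x}"
  have "AE x in M. ennreal ((real (LEAST n. D n x))\<^sup>2) \<le> (\<Sum>n. ennreal (2 * real n + 1) * indicator (?E n) x)"
    using geometric_stopping_AE[OF assms(1) tail \<rho>] AE_space
  proof eventually_elim
    case (elim x)
    define \<sigma> where "\<sigma> = (LEAST n. D n x)"
    have "ennreal ((real \<sigma>)\<^sup>2) = (\<Sum>n<\<sigma>. ennreal (2 * real n + 1))"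
      by (rule ennreal_square_eq_sum_odd)
    also have "\<dots> = (\<Sum>n<\<sigma>. ennreal (2 * real n + 1) * indicator (?E n) x)"
    proof (intro sum.cong refl)
      fix n assume "n \<in> {..<\<sigma>}"
      then have "\<not> D i x" if "i < n" for i
        using that not_less_Least[of i "\<lambda>n. D n x"] by (simp add: \<sigma>_def)
      then have "x \<in> ?E n" using elim by simp
      then show "ennreal (2 * real n + 1) = ennreal (2 * real n + 1) * indicator (?E n) x" by simp
    qed
    also have "\<dots> \<le> (\<Sum>n. ennreal (2 * real n + 1) * indicator (?E n) x)"
      by (rule sum_le_suminf) auto
    finally show ?case by (simp add: \<sigma>_def)
  qed
  then have "(\<integral>\<^sup>+x. ennreal ((real (LEAST n. D n x))\<^sup>2) \<partial>M)
      \<le> (\<integral>\<^sup>+x. (\<Sum>n. ennreal (2 * real n + 1) * indicator (?E n) x) \<partial>M)"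
    by (rule nn_integral_mono_AE)
  also have "\<dots> = (\<Sum>n. ennreal (2 * real n + 1) * emeasure M (?E n))"
    by (subst nn_integral_suminf) (auto simp: nn_integral_cmult_indicator)
  also have "\<dots> \<le> (\<Sum>n. ennreal (2 * C * (real (Suc n) * \<rho> ^ n)))"
  proof (intro suminf_le)
    fix n
    have "ennreal (2 * real n + 1) * emeasure M (?E n) = ennreal ((2 * real n + 1) * prob (?E n))"
      by (simp add: emeasure_eq_measure ennreal_mult)
    also have "(2 * real n + 1) * prob (?E n) \<le> (2 * real (Suc n)) * (C * \<rho> ^ n)"
      using \<rho> C by (intro mult_mono tail) auto
    finally show "ennreal (2 * real n + 1) * emeasure M (?E n) \<le> ennreal (2 * C * (real (Suc n) * \<rho> ^ n))"
      by (simp add: ennreal_leI ac_simps)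
  qed auto
  also have "\<dots> = ennreal (2 * C / (1 - \<rho>)\<^sup>2)"
  proof (rule suminf_ennreal_eq)
    show "(\<lambda>n. 2 * C * (real (Suc n) * \<rho> ^ n)) sums (2 * C / (1 - \<rho>)\<^sup>2)"
      using sums_mult[OF geometric_deriv_sums[of \<rho>], of "2 * C"] \<rho> by simp
  qed (use \<rho> C in auto)
  finally show ?thesis .
qed

lemma (in prob_space) second_moment_le_affine:
  fixes \<sigma> :: "'a \<Rightarrow> nat" and Z :: "'a \<Rightarrow> real"
  assumes [measurable]: "\<sigma> \<in> M \<rightarrow>\<^sub>M count_space UNIV"
    and \<sigma>: "(\<integral>\<^sup>+x. ennreal ((real (\<sigma> x))\<^sup>2) \<partial>M) \<le> ennreal K" and K: "0 \<le> K"
    and Z: "\<And>x. x \<in> space M \<Longrightarrow> \<bar>Z x\<bar> \<le> b * real (\<sigma> x) + b'"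
  shows "(\<integral>\<^sup>+x. ennreal ((Z x)\<^sup>2) \<partial>M) \<le> ennreal (2 * b\<^sup>2 * K + 2 * b'\<^sup>2)"
proof -
  have le: "(Z x)\<^sup>2 \<le> 2 * b\<^sup>2 * (real (\<sigma> x))\<^sup>2 + 2 * b'\<^sup>2" if "x \<in> space M" for x
  proof -
    have "(Z x)\<^sup>2 \<le> (b * real (\<sigma> x) + b')\<^sup>2"
      using Z[OF that] by (metis abs_ge_zero power2_abs power_mono)
    also have "\<dots> \<le> 2 * (b * real (\<sigma> x))\<^sup>2 + 2 * b'\<^sup>2"
      using sum_squares_ge_zero[of "b * real (\<sigma> x) - b'" 0] by (simp add: power2_eq_square algebra_simps)
    finally show ?thesis by (simp add: power_mult_distrib)
  qed
  have "(\<integral>\<^sup>+x. ennreal ((Z x)\<^sup>2) \<partial>M) \<le> (\<integral>\<^sup>+x. ennreal (2 * b\<^sup>2) * ennreal ((real (\<sigma> x))\<^sup>2) + ennreal (2 * b'\<^sup>2) \<partial>M)"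
    by (intro nn_integral_mono) (simp add: le ennreal_leI flip: ennreal_mult ennreal_plus)
  also have "\<dots> = ennreal (2 * b\<^sup>2) * (\<integral>\<^sup>+x. ennreal ((real (\<sigma> x))\<^sup>2) \<partial>M) + ennreal (2 * b'\<^sup>2)"
    by (subst nn_integral_add) (auto simp: nn_integral_cmult emeasure_space_1)
  also have "\<dots> \<le> ennreal (2 * b\<^sup>2) * ennreal K + ennreal (2 * b'\<^sup>2)"
    by (intro add_mono mult_left_mono \<sigma>) auto
  also have "\<dots> = ennreal (2 * b\<^sup>2 * K + 2 * b'\<^sup>2)"
    using K by (simp flip: ennreal_mult ennreal_plus)
  finally show ?thesis .
qed

text \<open>
  Expectations of stopped quantities are computed term by term. The geometric tail makes the double
  sum absolutely convergent, and each term only refers to the event of not having stopped yet, which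
  depends on the past; this is where conditional expectations given the past come in later.
\<close>

lemma (in prob_space) geometric_stopping_sums:
  fixes D :: "nat \<Rightarrow> 'a \<Rightarrow> bool" and b :: "nat \<Rightarrow> 'a \<Rightarrow> real"
  assumes [measurable]: "\<And>n. Measurable.pred M (D n)"
    and tail: "\<And>n. prob {x\<in>space M. \<forall>i<n. \<not> D i x} \<le> C * \<rho> ^ n" and \<rho>: "0 \<le> \<rho>" "\<rho> < 1"
    and b[measurable]: "\<And>n. b n \<in> borel_measurable M"
    and bound: "\<And>n x. x \<in> space M \<Longrightarrow> \<bar>b n x\<bar> \<le> B"
    and zero: "\<And>n i x. x \<in> space M \<Longrightarrow> i < n \<Longrightarrow> D i x \<Longrightarrow> b n x = 0"
  shows "integrable M (\<lambda>x. \<Sum>l\<le>(LEAST n. D n x). b l x)"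
    and "(\<lambda>l. \<integral>x. b l x \<partial>M) sums (\<integral>x. (\<Sum>l\<le>(LEAST n. D n x). b l x) \<partial>M)"
proof -
  have AE: "AE x in M. (\<lambda>l. b l x) sums (\<Sum>l\<le>(LEAST n. D n x). b l x)"
    using geometric_stopping_AE[OF assms(1) tail \<rho>] AE_space
  proof eventually_elim
    case (elim x)
    then have "D (LEAST n. D n x) x" by (auto intro: LeastI_ex)
    then have "b l x = 0" if "l \<notin> {..LEAST n. D n x}" for l
      using zero[of x "LEAST n. D n x" l] elim that by auto
    then show ?case by (intro sums_finite) auto
  qed
  have int: "integrable M (b l)" for l
    using bound by (intro integrable_const_bound[of _ B] AE_I2) auto
  have [measurable]: "(\<lambda>x. \<Sum>l\<le>(LEAST n. D n x). b l x) \<in> borel_measurable M"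
    by (rule measurable_compose_countable[where g="\<lambda>x. LEAST n. D n x"]) measurable
  have summ: "AE x in M. summable (\<lambda>l. norm (b l x))"
    using geometric_stopping_AE[OF assms(1) tail \<rho>] AE_space
  proof eventually_elim
    case (elim x)
    then have "D (LEAST n. D n x) x" by (auto intro: LeastI_ex)
    then have "b l x = 0" if "l \<notin> {..LEAST n. D n x}" for l
      using zero[of x "LEAST n. D n x" l] elim that by auto
    then show ?case by (intro summable_finite[of "{..LEAST n. D n x}"]) auto
  qed
  have B: "0 \<le> B" using bound not_empty by force
  have le: "(\<integral>x. norm (b l x) \<partial>M) \<le> B * (C * \<rho> ^ l)" for l
  proof -
    have "(\<integral>x. norm (b l x) \<partial>M) \<le> (\<integral>x. B * indicator {x\<in>space M. \<forall>i<l. \<not> D i x} x \<partial>M)"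
    proof (rule integral_mono_AE)
      show "AE x in M. norm (b l x) \<le> B * indicator {x\<in>space M. \<forall>i<l. \<not> D i x} x"
        using bound zero by (intro AE_I2) (auto simp: indicator_def)
    qed (use int in \<open>auto simp: emeasure_eq_measure\<close>)
    also have "\<dots> = B * prob {x\<in>space M. \<forall>i<l. \<not> D i x}" by simp
    also have "\<dots> \<le> B * (C * \<rho> ^ l)" by (intro mult_left_mono tail B)
    finally show ?thesis .
  qed
  have "summable (\<lambda>l. B * (C * \<rho> ^ l))"
    using \<rho> by (intro summable_mult summable_geometric) auto
  then have s: "summable (\<lambda>l. \<integral>x. norm (b l x) \<partial>M)"
  proof (rule summable_comparison_test')
    fix l :: nat
    have "0 \<le> (\<integral>x. norm (b l x) \<partial>M)" by simp
    then show "norm (\<integral>x. norm (b l x) \<partial>M) \<le> B * (C * \<rho> ^ l)" using le[of l] by simp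
  qed
  have eq: "AE x in M. (\<Sum>l. b l x) = (\<Sum>l\<le>(LEAST n. D n x). b l x)"
    using AE by eventually_elim (auto simp: sums_iff)
  have meas: "(\<lambda>x. \<Sum>l. b l x) \<in> borel_measurable M" by measurable
  show "integrable M (\<lambda>x. \<Sum>l\<le>(LEAST n. D n x). b l x)"
    by (rule integrable_cong_AE_imp[OF integrable_suminf[OF int summ s] _ eq]) measurable
  have "(\<integral>x. (\<Sum>l. b l x) \<partial>M) = (\<integral>x. (\<Sum>l\<le>(LEAST n. D n x). b l x) \<partial>M)"
    by (rule integral_cong_AE[OF meas _ eq]) measurable
  then show "(\<lambda>l. \<integral>x. b l x \<partial>M) sums (\<integral>x. (\<Sum>l\<le>(LEAST n. D n x). b l x) \<partial>M)"
    using sums_integral[OF int summ s] by (simp only:)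
qed

lemma (in prob_space) geometric_stopping_sum_upto:
  fixes D :: "nat \<Rightarrow> 'a \<Rightarrow> bool" and a :: "nat \<Rightarrow> 'a \<Rightarrow> real"
  assumes D[measurable]: "\<And>n. Measurable.pred M (D n)"
    and tail: "\<And>n. prob {x\<in>space M. \<forall>i<n. \<not> D i x} \<le> C * \<rho> ^ n" and \<rho>: "0 \<le> \<rho>" "\<rho> < 1"
    and a[measurable]: "\<And>n. a n \<in> borel_measurable M"
    and bound: "\<And>n x. x \<in> space M \<Longrightarrow> \<bar>a n x\<bar> \<le> B"
  shows "integrable M (\<lambda>x. \<Sum>l<(LEAST n. D n x). a l x)"
    and "(\<lambda>l. \<integral>x. of_bool (\<forall>i\<le>l. \<not> D i x) * a l x \<partial>M) sums (\<integral>x. (\<Sum>l<(LEAST n. D n x). a l x) \<partial>M)"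
proof -
  define b where "b l x = of_bool (\<forall>i\<le>l. \<not> D i x) * a l x" for l x
  have [measurable]: "b l \<in> borel_measurable M" for l unfolding b_def[abs_def] by measurable
  have bb: "\<bar>b l x\<bar> \<le> B" if "x \<in> space M" for l x
    using bound[OF that, of l] by (auto simp: b_def)
  note * = geometric_stopping_sums[where b=b, OF D tail \<rho> _ bb]
  have i: "integrable M (\<lambda>x. \<Sum>l\<le>(LEAST n. D n x). b l x)" by (rule *) (auto simp: b_def intro: less_imp_le)
  have s: "(\<lambda>l. \<integral>x. b l x \<partial>M) sums (\<integral>x. (\<Sum>l\<le>(LEAST n. D n x). b l x) \<partial>M)"
    by (rule *) (auto simp: b_def intro: less_imp_le)
  have eq: "AE x in M. (\<Sum>l\<le>(LEAST n. D n x). b l x) = (\<Sum>l<(LEAST n. D n x). a l x)"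
    using geometric_stopping_AE[OF D tail \<rho>]
  proof eventually_elim
    case (elim x)
    define \<sigma> where "\<sigma> = (LEAST n. D n x)"
    have "D \<sigma> x" unfolding \<sigma>_def using elim by (rule LeastI_ex)
    moreover have "\<forall>i<\<sigma>. \<not> D i x" unfolding \<sigma>_def using not_less_Least by blast
    ultimately have "(\<Sum>l\<le>\<sigma>. b l x) = (\<Sum>l<\<sigma>. a l x)"
      by (simp add: b_def lessThan_Suc_atMost[symmetric]) (auto intro!: sum.cong)
    then show ?case by (simp add: \<sigma>_def)
  qed
  have m1: "(\<lambda>x. \<Sum>l<(LEAST n. D n x). a l x) \<in> borel_measurable M"
    by (rule measurable_compose_countable[where g="\<lambda>x. LEAST n. D n x"]) measurable
  have m2: "(\<lambda>x. \<Sum>l\<le>(LEAST n. D n x). b l x) \<in> borel_measurable M"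
    by (rule measurable_compose_countable[where g="\<lambda>x. LEAST n. D n x"]) measurable
  show "integrable M (\<lambda>x. \<Sum>l<(LEAST n. D n x). a l x)"
    by (rule integrable_cong_AE_imp[OF i m1 eq])
  show "(\<lambda>l. \<integral>x. of_bool (\<forall>i\<le>l. \<not> D i x) * a l x \<partial>M) sums (\<integral>x. (\<Sum>l<(LEAST n. D n x). a l x) \<partial>M)"
    using s unfolding integral_cong_AE[OF m2 m1 eq] by (simp only: b_def)
qed

lemma (in prob_space) geometric_stopping_value:
  fixes D :: "nat \<Rightarrow> 'a \<Rightarrow> bool" and w :: "nat \<Rightarrow> 'a \<Rightarrow> real"
  assumes D[measurable]: "\<And>n. Measurable.pred M (D n)"
    and tail: "\<And>n. prob {x\<in>space M. \<forall>i<n. \<not> D i x} \<le> C * \<rho> ^ n" and \<rho>: "0 \<le> \<rho>" "\<rho> < 1"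
    and w[measurable]: "\<And>n. w n \<in> borel_measurable M"
    and bound: "\<And>n x. x \<in> space M \<Longrightarrow> \<bar>w n x\<bar> \<le> B"
  shows "(\<lambda>l. \<integral>x. of_bool (\<forall>i<l. \<not> D i x) * (of_bool (D l x) * w l x) \<partial>M) sums (\<integral>x. w (LEAST n. D n x) x \<partial>M)"
proof -
  define b where "b l x = of_bool (\<forall>i<l. \<not> D i x) * (of_bool (D l x) * w l x)" for l x
  have [measurable]: "b l \<in> borel_measurable M" for l unfolding b_def[abs_def] by measurable
  have bb: "\<bar>b l x\<bar> \<le> B" if "x \<in> space M" for l x
    using bound[OF that, of l] by (auto simp: b_def)
  have s: "(\<lambda>l. \<integral>x. b l x \<partial>M) sums (\<integral>x. (\<Sum>l\<le>(LEAST n. D n x). b l x) \<partial>M)"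
    by (rule geometric_stopping_sums[where b=b, OF D tail \<rho> _ bb]) (auto simp: b_def)
  have "AE x in M. (\<Sum>l\<le>(LEAST n. D n x). b l x) = w (LEAST n. D n x) x"
    using geometric_stopping_AE[OF D tail \<rho>]
  proof eventually_elim
    case (elim x)
    define \<sigma> where "\<sigma> = (LEAST n. D n x)"
    have "D \<sigma> x" unfolding \<sigma>_def using elim by (rule LeastI_ex)
    moreover have "\<forall>i<\<sigma>. \<not> D i x" unfolding \<sigma>_def using not_less_Least by blast
    ultimately have "(\<Sum>l\<le>\<sigma>. b l x) = w \<sigma> x"
      by (simp add: b_def lessThan_Suc_atMost[symmetric])
    then show ?case by (simp add: \<sigma>_def)
  qed
  moreover have [measurable]: "(\<lambda>x. w (LEAST n. D n x) x) \<in> borel_measurable M"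
    by (rule measurable_compose_countable[where g="\<lambda>x. LEAST n. D n x"]) measurable
  moreover have [measurable]: "(\<lambda>x. \<Sum>l\<le>(LEAST n. D n x). b l x) \<in> borel_measurable M"
    by (rule measurable_compose_countable[where g="\<lambda>x. LEAST n. D n x"]) measurable
  ultimately have "(\<integral>x. (\<Sum>l\<le>(LEAST n. D n x). b l x) \<partial>M) = (\<integral>x. w (LEAST n. D n x) x \<partial>M)"
    by (intro integral_cong_AE) auto
  with s show ?thesis by (simp add: b_def)
qed

text \<open>
  A functional of the coordinates \<open>0, ..., n\<close> may be integrated over the last coordinate first.
  This is the recursion for the finite-dimensional distributions, moved to the infinite product, so
  that no projections appear in the applications.
\<close>

lemma ionescu_tulcea_law_step:
  assumes Q: "\<And>i. Q i \<in> (\<Pi>\<^sub>M j\<in>{0..<i}. E) \<rightarrow>\<^sub>M prob_algebra E"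
    and ne: "space E \<noteq> {}"
  defines "L \<equiv> ionescu_tulcea_law E Q" and "paths \<equiv> (\<Pi>\<^sub>M j\<in>(UNIV::nat set). E)"
  shows nn_integral_ionescu_tulcea_step:
    "H \<in> borel_measurable paths \<Longrightarrow> (\<And>\<omega> \<omega>'. (\<forall>i\<le>n. \<omega> i = \<omega>' i) \<Longrightarrow> H \<omega> = H \<omega>') \<Longrightarrow>
      (\<integral>\<^sup>+\<omega>. H \<omega> \<partial>L) = (\<integral>\<^sup>+\<omega>. \<integral>\<^sup>+y. H (fun_upd \<omega> n y) \<partial>(Q n (restrict \<omega> {0..<n})) \<partial>L)"
    and integral_ionescu_tulcea_step:
    "h \<in> borel_measurable paths \<Longrightarrow> (\<And>\<omega> \<omega>'. (\<forall>i\<le>n. \<omega> i = \<omega>' i) \<Longrightarrow> h \<omega> = h \<omega>') \<Longrightarrow>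
      (\<And>\<omega>. \<omega> \<in> space paths \<Longrightarrow> \<bar>h \<omega>\<bar> \<le> (B::real)) \<Longrightarrow>
      (\<integral>\<omega>. h \<omega> \<partial>L) = (\<integral>\<omega>. \<integral>y. h (fun_upd \<omega> n y) \<partial>(Q n (restrict \<omega> {0..<n})) \<partial>L)"
proof -
  obtain x0 where x0: "x0 \<in> space E" using ne by auto
  \<comment> \<open>a finite history is completed by an arbitrary constant future, which the functional ignores\<close>
  define ext where "ext \<eta> = (\<lambda>i. if i < Suc n then \<eta> i else x0)" for \<eta> :: "nat \<Rightarrow> 'a"
  have ext[measurable]: "ext \<in> (\<Pi>\<^sub>M j\<in>{0..<Suc n}. E) \<rightarrow>\<^sub>M paths"
    unfolding ext_def[abs_def] paths_def
  proof (rule measurable_PiM_single')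
    fix i :: nat
    show "(\<lambda>\<eta>. if i < Suc n then \<eta> i else x0) \<in> (\<Pi>\<^sub>M j\<in>{0..<Suc n}. E) \<rightarrow>\<^sub>M E"
      using x0 by (cases "i < Suc n") auto
  qed (use x0 in \<open>auto simp: space_PiM\<close>)
  have Lp: "L \<in> space (prob_algebra paths)"
    unfolding L_def paths_def by (rule ionescu_tulcea_law_prob[OF Q])
  then interpret L: prob_space L by (simp add: space_prob_algebra)
  have sL[measurable_cong]: "sets L = sets paths" using Lp by (simp add: space_prob_algebra)
  have spL: "space L = space paths" by (rule sets_eq_imp_space_eq[OF sL])
  have [measurable]: "(\<lambda>\<omega>. restrict \<omega> {0..<m}) \<in> L \<rightarrow>\<^sub>M (\<Pi>\<^sub>M j\<in>{0..<m}. E)" for m :: nat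
    unfolding measurable_cong_sets[OF sL refl] paths_def by (rule measurable_restrict_subset) auto
  let ?d = "\<lambda>m. distr L (\<Pi>\<^sub>M j\<in>{0..<m}. E) (\<lambda>\<omega>. restrict \<omega> {0..<m})"
  let ?K = "\<lambda>\<omega>. distr (Q n \<omega>) (\<Pi>\<^sub>M j\<in>{0..<Suc n}. E) (fun_upd \<omega> n)"
  have R: "?d (Suc n) = ?d n \<bind> ?K"
    unfolding L_def by (rule ionescu_tulcea_law_restrict[OF Q])
  have K: "?K \<in> (\<Pi>\<^sub>M j\<in>{0..<n}. E) \<rightarrow>\<^sub>M subprob_algebra (\<Pi>\<^sub>M j\<in>{0..<Suc n}. E)"
    using Q[of n] by (intro measurable_prob_algebraD measurable_distr_prob_space2[where M=E])
       (auto simp: split_beta' intro!: measurable_fun_upd[where J="{0..<n}"])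
  have Kd: "?K \<in> ?d n \<rightarrow>\<^sub>M subprob_algebra (\<Pi>\<^sub>M j\<in>{0..<Suc n}. E)" using K by simp
  have Qs: "prob_space (Q n \<eta>)" "sets (Q n \<eta>) = sets E" if "\<eta> \<in> space (\<Pi>\<^sub>M j\<in>{0..<n}. E)" for \<eta>
    using measurable_space[OF Q that] by (auto simp: space_prob_algebra)
  have upd: "fun_upd \<eta> n \<in> Q n \<eta> \<rightarrow>\<^sub>M (\<Pi>\<^sub>M j\<in>{0..<Suc n}. E)" if "\<eta> \<in> space (\<Pi>\<^sub>M j\<in>{0..<n}. E)" for \<eta>
    unfolding measurable_cong_sets[OF Qs(2)[OF that] refl] using that
    by (intro measurable_fun_upd[where J="{0..<n}"]) auto
  {
    assume [measurable]: "H \<in> borel_measurable paths" and dep: "\<And>\<omega> \<omega>'. (\<forall>i\<le>n. \<omega> i = \<omega>' i) \<Longrightarrow> H \<omega> = H \<omega>'"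
    have "(\<integral>\<^sup>+\<omega>. H \<omega> \<partial>L) = (\<integral>\<^sup>+\<omega>. H (ext (restrict \<omega> {0..<Suc n})) \<partial>L)"
      by (intro nn_integral_cong dep) (auto simp: ext_def)
    also have "\<dots> = (\<integral>\<^sup>+\<eta>. H (ext \<eta>) \<partial>(?d (Suc n)))" by (subst nn_integral_distr) auto
    also have "\<dots> = (\<integral>\<^sup>+\<eta>. \<integral>\<^sup>+\<eta>'. H (ext \<eta>') \<partial>(?K \<eta>) \<partial>(?d n))"
      unfolding R by (rule nn_integral_bind[OF _ Kd]) measurable
    also have "\<dots> = (\<integral>\<^sup>+\<eta>. \<integral>\<^sup>+y. H (ext (fun_upd \<eta> n y)) \<partial>(Q n \<eta>) \<partial>(?d n))"
      by (intro nn_integral_cong nn_integral_distr) (auto intro: upd)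
    also have "\<dots> = (\<integral>\<^sup>+\<omega>. \<integral>\<^sup>+y. H (ext (fun_upd (restrict \<omega> {0..<n}) n y)) \<partial>(Q n (restrict \<omega> {0..<n})) \<partial>L)"
    proof -
      have "(\<lambda>\<eta>. \<integral>\<^sup>+\<eta>'. H (ext \<eta>') \<partial>(?K \<eta>)) \<in> borel_measurable (\<Pi>\<^sub>M j\<in>{0..<n}. E)"
        by (rule measurable_compose[OF K nn_integral_measurable_subprob_algebra]) measurable
      also have "?this \<longleftrightarrow> (\<lambda>\<eta>. \<integral>\<^sup>+y. H (ext (fun_upd \<eta> n y)) \<partial>(Q n \<eta>)) \<in> borel_measurable (\<Pi>\<^sub>M j\<in>{0..<n}. E)"
        by (intro measurable_cong nn_integral_distr) (auto intro: upd)
      finally have m: "(\<lambda>\<eta>. \<integral>\<^sup>+y. H (ext (fun_upd \<eta> n y)) \<partial>(Q n \<eta>)) \<in> borel_measurable (\<Pi>\<^sub>M j\<in>{0..<n}. E)" .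
      show ?thesis by (rule nn_integral_distr) (use m in auto)
    qed
    also have "\<dots> = (\<integral>\<^sup>+\<omega>. \<integral>\<^sup>+y. H (fun_upd \<omega> n y) \<partial>(Q n (restrict \<omega> {0..<n})) \<partial>L)"
      by (intro nn_integral_cong dep) (auto simp: ext_def)
    finally show "(\<integral>\<^sup>+\<omega>. H \<omega> \<partial>L) = (\<integral>\<^sup>+\<omega>. \<integral>\<^sup>+y. H (fun_upd \<omega> n y) \<partial>(Q n (restrict \<omega> {0..<n})) \<partial>L)" .
  }
  {
    assume [measurable]: "h \<in> borel_measurable paths" and dep: "\<And>\<omega> \<omega>'. (\<forall>i\<le>n. \<omega> i = \<omega>' i) \<Longrightarrow> h \<omega> = h \<omega>'"
      and B: "\<And>\<omega>. \<omega> \<in> space paths \<Longrightarrow> \<bar>h \<omega>\<bar> \<le> B"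
    have "(\<integral>\<omega>. h \<omega> \<partial>L) = (\<integral>\<omega>. h (ext (restrict \<omega> {0..<Suc n})) \<partial>L)"
      by (intro Bochner_Integration.integral_cong refl dep) (auto simp: ext_def)
    also have "\<dots> = (\<integral>\<eta>. h (ext \<eta>) \<partial>(?d (Suc n)))" by (subst integral_distr) auto
    also have "\<dots> = (\<integral>\<eta>. \<integral>\<eta>'. h (ext \<eta>') \<partial>(?K \<eta>) \<partial>(?d n))"
      unfolding R
    proof (rule integral_bind[OF _ _ Kd])
      show "finite_measure (?d n)"
        by (rule prob_space.finite_measure[OF L.prob_space_distr]) measurable
      show "\<bar>h (ext x)\<bar> \<le> B" if "x \<in> space (\<Pi>\<^sub>M j\<in>{0..<Suc n}. E)" for x
        using measurable_space[OF ext that] by (rule B)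
      show "AE x in ?d n. emeasure (?K x) (space (?K x)) \<le> ennreal 1"
      proof (rule AE_I2)
        fix x assume "x \<in> space (?d n)"
        then have "?K x \<in> space (subprob_algebra (\<Pi>\<^sub>M j\<in>{0..<Suc n}. E))" by (intro measurable_space[OF Kd])
        then show "emeasure (?K x) (space (?K x)) \<le> ennreal 1"
          by (auto simp: space_subprob_algebra dest: subprob_space.emeasure_space_le_1)
      qed
    qed measurable
    also have "\<dots> = (\<integral>\<eta>. \<integral>y. h (ext (fun_upd \<eta> n y)) \<partial>(Q n \<eta>) \<partial>(?d n))"
      by (intro Bochner_Integration.integral_cong refl integral_distr) (auto intro: upd)
    also have "\<dots> = (\<integral>\<omega>. \<integral>y. h (ext (fun_upd (restrict \<omega> {0..<n}) n y)) \<partial>(Q n (restrict \<omega> {0..<n})) \<partial>L)"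
    proof -
      have "(\<lambda>\<eta>. \<integral>\<eta>'. h (ext \<eta>') \<partial>(?K \<eta>)) \<in> borel_measurable (\<Pi>\<^sub>M j\<in>{0..<n}. E)"
        by (rule measurable_compose[OF K integral_measurable_subprob_algebra]) measurable
      also have "?this \<longleftrightarrow> (\<lambda>\<eta>. \<integral>y. h (ext (fun_upd \<eta> n y)) \<partial>(Q n \<eta>)) \<in> borel_measurable (\<Pi>\<^sub>M j\<in>{0..<n}. E)"
        by (intro measurable_cong integral_distr) (auto intro: upd)
      finally have m: "(\<lambda>\<eta>. \<integral>y. h (ext (fun_upd \<eta> n y)) \<partial>(Q n \<eta>)) \<in> borel_measurable (\<Pi>\<^sub>M j\<in>{0..<n}. E)" .
      show ?thesis by (rule integral_distr) (use m in auto)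
    qed
    also have "\<dots> = (\<integral>\<omega>. \<integral>y. h (fun_upd \<omega> n y) \<partial>(Q n (restrict \<omega> {0..<n})) \<partial>L)"
      by (intro Bochner_Integration.integral_cong refl dep) (auto simp: ext_def)
    finally show "(\<integral>\<omega>. h \<omega> \<partial>L) = (\<integral>\<omega>. \<integral>y. h (fun_upd \<omega> n y) \<partial>(Q n (restrict \<omega> {0..<n})) \<partial>L)" .
  }
qed

section \<open>Transition operators of a Markov chain\<close>

locale markov_kernel =
  fixes Om :: "'a measure" and P :: "'a \<Rightarrow> 'a measure"
  assumes kernel[measurable]: "P \<in> Om \<rightarrow>\<^sub>M prob_algebra Om"
begin

definition bfun :: "('a \<Rightarrow> real) \<Rightarrow> bool" where
  "bfun \<phi> \<longleftrightarrow> \<phi> \<in> borel_measurable Om \<and> (\<exists>B. \<forall>x\<in>space Om. \<bar>\<phi> x\<bar> \<le> B)"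

definition transition :: "('a \<Rightarrow> real) \<Rightarrow> 'a \<Rightarrow> real" where
  "transition \<phi> x = (\<integral>y. \<phi> y \<partial>P x)"

text \<open>
  The operator of the chain killed on leaving \<open>S\<close>: its \<open>n\<close>-th power maps \<open>\<phi>\<close> to
  \<open>x \<mapsto> E\<^sub>x (\<phi>(X\<^sub>n); X\<^sub>1 \<in> S, ..., X\<^sub>n \<in> S)\<close>.
\<close>

definition transition_within :: "'a set \<Rightarrow> ('a \<Rightarrow> real) \<Rightarrow> 'a \<Rightarrow> real" where
  "transition_within S \<phi> = transition (\<lambda>y. indicator S y * \<phi> y)"

abbreviation paths :: "(nat \<Rightarrow> 'a) measure" where
  "paths \<equiv> \<Pi>\<^sub>M j\<in>(UNIV::nat set). Om"

text \<open>
  A bounded random variable that depends on \<open>X\<^sub>0, ..., X\<^sub>n\<close> only. Dependence is expressed by invariance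
  under changes of later coordinates, the condition under which the last coordinate can be integrated
  out.
\<close>

definition adapted :: "nat \<Rightarrow> ((nat \<Rightarrow> 'a) \<Rightarrow> real) \<Rightarrow> bool" where
  "adapted n G \<longleftrightarrow> G \<in> borel_measurable paths \<and> (\<exists>B. \<forall>\<omega>\<in>space paths. \<bar>G \<omega>\<bar> \<le> B) \<and>
     (\<forall>\<omega> \<omega>'. (\<forall>i\<le>n. \<omega> i = \<omega>' i) \<longrightarrow> G \<omega> = G \<omega>')"

lemma bfun_measurable[measurable_dest]: "bfun \<phi> \<Longrightarrow> \<phi> \<in> borel_measurable Om"
  by (simp add: bfun_def)

lemma bfun_bound: "bfun \<phi> \<Longrightarrow> \<exists>B. 0 < B \<and> (\<forall>x\<in>space Om. \<bar>\<phi> x\<bar> \<le> B)"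
  unfolding bfun_def by (meson less_add_one max.strict_coboundedI2 max.cobounded1 order_trans zero_less_one)

lemma bfunI: "\<phi> \<in> borel_measurable Om \<Longrightarrow> (\<And>x. x \<in> space Om \<Longrightarrow> \<bar>\<phi> x\<bar> \<le> B) \<Longrightarrow> bfun \<phi>"
  unfolding bfun_def by blast

lemma bfun_const[simp]: "bfun (\<lambda>x. c)"
  by (rule bfunI[of _ "\<bar>c\<bar>"]) auto

lemma bfun_indicator: "S \<in> sets Om \<Longrightarrow> bfun (indicator S)"
  by (rule bfunI[of _ 1]) (auto simp: indicator_def)

lemma bfun_mult:
  assumes "bfun \<phi>" "bfun \<psi>" shows "bfun (\<lambda>x. \<phi> x * \<psi> x)"
proof -
  from bfun_bound[OF assms(1)] bfun_bound[OF assms(2)] obtain B C where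
    "0 < B" "\<forall>x\<in>space Om. \<bar>\<phi> x\<bar> \<le> B" "0 < C" "\<forall>x\<in>space Om. \<bar>\<psi> x\<bar> \<le> C" by auto
  then show ?thesis using assms
    by (intro bfunI[of _ "B * C"]) (auto simp: abs_mult intro!: mult_mono)
qed

lemma bfun_add:
  assumes "bfun \<phi>" "bfun \<psi>" shows "bfun (\<lambda>x. \<phi> x + \<psi> x)"
proof -
  from bfun_bound[OF assms(1)] bfun_bound[OF assms(2)] obtain B C where
    "0 < B" "\<forall>x\<in>space Om. \<bar>\<phi> x\<bar> \<le> B" "0 < C" "\<forall>x\<in>space Om. \<bar>\<psi> x\<bar> \<le> C" by auto
  then show ?thesis using assms
    by (intro bfunI[of _ "B + C"]) (auto intro!: order_trans[OF abs_triangle_ineq] add_mono)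
qed

lemma bfun_uminus: "bfun \<phi> \<Longrightarrow> bfun (\<lambda>x. - \<phi> x)"
  using bfun_mult[of "\<lambda>x. -1" \<phi>] by simp

lemma bfun_diff: "bfun \<phi> \<Longrightarrow> bfun \<psi> \<Longrightarrow> bfun (\<lambda>x. \<phi> x - \<psi> x)"
  using bfun_add[of \<phi> "\<lambda>x. - \<psi> x"] bfun_uminus by simp

lemma bfun_sum: "(\<And>i. i \<in> I \<Longrightarrow> bfun (\<phi> i)) \<Longrightarrow> bfun (\<lambda>x. \<Sum>i\<in>I. \<phi> i x)"
  by (induction I rule: infinite_finite_induct) (auto intro: bfun_add)

lemma kernel_prob: "x \<in> space Om \<Longrightarrow> prob_space (P x)"
  and space_kernel_P: "x \<in> space Om \<Longrightarrow> space (P x) = space Om"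
  using measurable_space[OF kernel, of x] by (auto simp: space_prob_algebra dest: sets_eq_imp_space_eq)

lemma law_prob:
  assumes "\<zeta> \<in> space (prob_algebra Om)"
  shows "prob_space \<zeta>" "sets \<zeta> = sets Om" "space \<zeta> = space Om"
  using assms by (auto simp: space_prob_algebra dest: sets_eq_imp_space_eq)

lemma kernel_in_prob_algebra: "x \<in> space Om \<Longrightarrow> P x \<in> space (prob_algebra Om)"
  by (rule measurable_space[OF kernel])

lemma integrable_bfun:
  assumes "\<zeta> \<in> space (prob_algebra Om)" "bfun \<phi>"
  shows "integrable \<zeta> \<phi>"
proof -
  interpret prob_space \<zeta> by (rule law_prob[OF assms(1)])
  from bfun_bound[OF assms(2)] obtain B where B: "\<forall>x\<in>space Om. \<bar>\<phi> x\<bar> \<le> B" by auto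
  show ?thesis
    using B assms(2) law_prob[OF assms(1)] measurable_cong_sets[of \<zeta> Om borel borel]
    by (intro integrable_const_bound[of _ B] AE_I2) (auto simp: bfun_def)
qed

lemma integral_bfun_bound:
  assumes \<zeta>: "\<zeta> \<in> space (prob_algebra Om)" and \<phi>: "bfun \<phi>" and B: "\<And>x. x \<in> space Om \<Longrightarrow> \<bar>\<phi> x\<bar> \<le> B"
  shows "\<bar>\<integral>x. \<phi> x \<partial>\<zeta>\<bar> \<le> B"
proof -
  interpret prob_space \<zeta> by (rule law_prob[OF \<zeta>])
  have "\<bar>\<integral>x. \<phi> x \<partial>\<zeta>\<bar> \<le> (\<integral>x. \<bar>\<phi> x\<bar> \<partial>\<zeta>)" by (rule integral_abs_bound)
  also have "\<dots> \<le> (\<integral>x. B \<partial>\<zeta>)"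
    using integrable_bfun[OF \<zeta> \<phi>] B by (intro integral_mono) (auto simp: law_prob[OF \<zeta>])
  finally show ?thesis by (simp add: prob_space)
qed

lemma bfun_transition: assumes "bfun \<phi>" shows "bfun (transition \<phi>)"
proof -
  from bfun_bound[OF assms] obtain B where B: "\<forall>x\<in>space Om. \<bar>\<phi> x\<bar> \<le> B" by auto
  show ?thesis
  proof (rule bfunI)
    show "transition \<phi> \<in> borel_measurable Om"
      unfolding transition_def[abs_def] using assms
      by (intro measurable_compose[OF measurable_prob_algebraD[OF kernel] integral_measurable_subprob_algebra]) (auto simp: bfun_def)
    show "\<bar>transition \<phi> x\<bar> \<le> B" if "x \<in> space Om" for x
      unfolding transition_def using B by (intro integral_bfun_bound kernel_in_prob_algebra that assms) auto
  qed
qed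

lemma bfun_within: "S \<in> sets Om \<Longrightarrow> bfun \<phi> \<Longrightarrow> bfun (transition_within S \<phi>)"
  unfolding transition_within_def by (intro bfun_transition bfun_mult bfun_indicator)

lemma bfun_transition_power: "bfun \<phi> \<Longrightarrow> bfun ((transition ^^ n) \<phi>)"
  by (induction n) (auto intro: bfun_transition)

lemma bfun_within_power: "S \<in> sets Om \<Longrightarrow> bfun \<phi> \<Longrightarrow> bfun ((transition_within S ^^ n) \<phi>)"
  by (induction n) (auto intro: bfun_within)

lemma transition_bound:
  "bfun \<phi> \<Longrightarrow> (\<And>y. y \<in> space Om \<Longrightarrow> \<bar>\<phi> y\<bar> \<le> B) \<Longrightarrow> x \<in> space Om \<Longrightarrow> \<bar>transition \<phi> x\<bar> \<le> B"
  unfolding transition_def by (intro integral_bfun_bound kernel_in_prob_algebra) auto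

lemma transition_const: "x \<in> space Om \<Longrightarrow> transition (\<lambda>_. c) x = c"
  using prob_space.prob_space[OF kernel_prob] by (simp add: transition_def)

lemma transition_add: "bfun \<phi> \<Longrightarrow> bfun \<psi> \<Longrightarrow> x \<in> space Om \<Longrightarrow>
    transition (\<lambda>y. \<phi> y + \<psi> y) x = transition \<phi> x + transition \<psi> x"
  unfolding transition_def by (intro Bochner_Integration.integral_add integrable_bfun kernel_in_prob_algebra)

lemma transition_sum: "(\<And>i. i \<in> I \<Longrightarrow> bfun (\<phi> i)) \<Longrightarrow> x \<in> space Om \<Longrightarrow>
    transition (\<lambda>y. \<Sum>i\<in>I. \<phi> i y) x = (\<Sum>i\<in>I. transition (\<phi> i) x)"
  unfolding transition_def by (intro Bochner_Integration.integral_sum integrable_bfun kernel_in_prob_algebra)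

lemma transition_cong: "(\<And>y. y \<in> space Om \<Longrightarrow> \<phi> y = \<psi> y) \<Longrightarrow> x \<in> space Om \<Longrightarrow> transition \<phi> x = transition \<psi> x"
  unfolding transition_def by (intro Bochner_Integration.integral_cong) (auto simp: space_kernel_P)

lemma chain_kernel_measurable:
  assumes "\<zeta> \<in> space (prob_algebra Om)"
  shows "(\<lambda>\<omega>. case i of 0 \<Rightarrow> \<zeta> | Suc n \<Rightarrow> P (\<omega> n)) \<in> (\<Pi>\<^sub>M j\<in>{0..<i}. Om) \<rightarrow>\<^sub>M prob_algebra Om"
  using assms by (cases i) auto

lemma chain_law_prob_algebra:
  "\<zeta> \<in> space (prob_algebra Om) \<Longrightarrow> chain_law Om P \<zeta> \<in> space (prob_algebra paths)"
  unfolding chain_law_def by (rule ionescu_tulcea_law_prob[OF chain_kernel_measurable])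

lemma chain_law_facts:
  assumes "\<zeta> \<in> space (prob_algebra Om)"
  shows prob_space_chain: "prob_space (chain_law Om P \<zeta>)"
    and sets_chain: "sets (chain_law Om P \<zeta>) = sets paths"
    and space_chain: "space (chain_law Om P \<zeta>) = space paths"
  using chain_law_prob_algebra[OF assms] by (auto simp: space_prob_algebra dest: sets_eq_imp_space_eq)

lemma measurable_chain_iff:
  "\<zeta> \<in> space (prob_algebra Om) \<Longrightarrow> G \<in> chain_law Om P \<zeta> \<rightarrow>\<^sub>M N \<longleftrightarrow> G \<in> paths \<rightarrow>\<^sub>M N"
  using measurable_cong_sets[OF sets_chain refl, of \<zeta> N] by simp

lemma space_not_empty: "\<zeta> \<in> space (prob_algebra Om) \<Longrightarrow> space Om \<noteq> {}"
  using law_prob prob_space.not_empty by metis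

lemma return_in_prob_algebra: "x \<in> space Om \<Longrightarrow> return Om x \<in> space (prob_algebra Om)"
  by (simp add: space_prob_algebra prob_space_return)

lemma adapted_measurable: "adapted n G \<Longrightarrow> G \<in> borel_measurable paths"
  by (simp add: adapted_def)

lemma integrable_adapted:
  assumes "\<zeta> \<in> space (prob_algebra Om)" "adapted n G"
  shows "integrable (chain_law Om P \<zeta>) G"
proof -
  interpret prob_space "chain_law Om P \<zeta>" by (rule prob_space_chain[OF assms(1)])
  from assms(2) obtain B where B: "\<forall>x\<in>space paths. \<bar>G x\<bar> \<le> B" by (auto simp: adapted_def)
  show ?thesis
    using B assms(2) space_chain[OF assms(1)] measurable_chain_iff[OF assms(1)]
    by (intro integrable_const_bound[of _ B] AE_I2) (auto simp: adapted_def)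
qed

lemma adapted_const: "adapted n (\<lambda>\<omega>. c)"
  unfolding adapted_def by auto

lemma adapted_coordinate: assumes \<phi>: "bfun \<phi>" and i: "i \<le> n" shows "adapted n (\<lambda>\<omega>. \<phi> (\<omega> i))"
proof -
  from bfun_bound[OF \<phi>] obtain B where B: "\<forall>x\<in>space Om. \<bar>\<phi> x\<bar> \<le> B" by auto
  have "(\<lambda>\<omega>. \<phi> (\<omega> i)) \<in> borel_measurable paths"
    by (rule measurable_compose[OF _ bfun_measurable[OF \<phi>]]) measurable
  moreover have "\<forall>\<omega>\<in>space paths. \<bar>\<phi> (\<omega> i)\<bar> \<le> B" using B by (auto simp: space_PiM)
  ultimately show ?thesis using i by (auto simp: adapted_def)
qed

lemma adapted_mult: assumes "adapted n G" "adapted n H" shows "adapted n (\<lambda>\<omega>. G \<omega> * H \<omega>)"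
proof -
  from assms obtain B C where B: "\<forall>\<omega>\<in>space paths. \<bar>G \<omega>\<bar> \<le> B" "\<forall>\<omega>\<in>space paths. \<bar>H \<omega>\<bar> \<le> C"
    by (auto simp: adapted_def)
  have "\<bar>G \<omega> * H \<omega>\<bar> \<le> \<bar>B\<bar> * \<bar>C\<bar>" if "\<omega> \<in> space paths" for \<omega>
  proof -
    have "\<bar>G \<omega>\<bar> \<le> B" "\<bar>H \<omega>\<bar> \<le> C" using B that by blast+
    then show ?thesis unfolding abs_mult by (intro mult_mono) linarith+
  qed
  moreover have "G \<omega> * H \<omega> = G \<omega>' * H \<omega>'" if "\<forall>i\<le>n. \<omega> i = \<omega>' i" for \<omega> \<omega>'
  proof -
    have "G \<omega> = G \<omega>'" "H \<omega> = H \<omega>'" using assms that unfolding adapted_def by blast+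
    then show ?thesis by simp
  qed
  moreover have "(\<lambda>\<omega>. G \<omega> * H \<omega>) \<in> borel_measurable paths"
    using assms by (intro borel_measurable_times) (auto dest: adapted_measurable)
  ultimately show ?thesis unfolding adapted_def by blast
qed

lemma adapted_mono: "adapted n G \<Longrightarrow> n \<le> m \<Longrightarrow> adapted m G"
  unfolding adapted_def by auto

lemma adapted_of_bool:
  assumes "Measurable.pred paths Q" "\<And>\<omega> \<omega>'. (\<forall>i\<le>n. \<omega> i = \<omega>' i) \<Longrightarrow> Q \<omega> \<Longrightarrow> Q \<omega>'"
  shows "adapted n (\<lambda>\<omega>. of_bool (Q \<omega>))"
proof -
  have "(\<lambda>\<omega>. of_bool (Q \<omega>) :: real) \<in> borel_measurable paths" using assms(1) by measurable
  moreover have "of_bool (Q \<omega>) = (of_bool (Q \<omega>') :: real)" if "\<forall>i\<le>n. \<omega> i = \<omega>' i" for \<omega> \<omega>'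
  proof -
    have "Q \<omega> = Q \<omega>'" using assms(2)[of \<omega> \<omega>'] assms(2)[of \<omega>' \<omega>] that by (metis (full_types))
    then show ?thesis by simp
  qed
  moreover have "\<bar>of_bool (Q \<omega>) :: real\<bar> \<le> 1" for \<omega> by simp
  ultimately show ?thesis unfolding adapted_def by blast
qed

lemma integral_chain_start:
  assumes \<zeta>: "\<zeta> \<in> space (prob_algebra Om)" and \<phi>: "bfun \<phi>"
  shows "(\<integral>\<omega>. \<phi> (\<omega> 0) \<partial>chain_law Om P \<zeta>) = (\<integral>x. \<phi> x \<partial>\<zeta>)"
proof -
  interpret prob_space "chain_law Om P \<zeta>" by (rule prob_space_chain[OF \<zeta>])
  have ad: "adapted 0 (\<lambda>\<omega>. \<phi> (\<omega> 0))" by (rule adapted_coordinate[OF \<phi>]) simp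
  then obtain B where B: "\<forall>\<omega>\<in>space paths. \<bar>\<phi> (\<omega> 0)\<bar> \<le> B"
    unfolding adapted_def by blast
  let ?Q = "\<lambda>i \<omega>. case i of 0 \<Rightarrow> \<zeta> | Suc n \<Rightarrow> P (\<omega> n)"
  have "(\<integral>\<omega>. \<phi> (\<omega> 0) \<partial>chain_law Om P \<zeta>) =
      (\<integral>\<omega>. \<integral>y. \<phi> (fun_upd \<omega> 0 y 0) \<partial>(?Q 0 (restrict \<omega> {0..<0})) \<partial>chain_law Om P \<zeta>)"
    unfolding chain_law_def
  proof (rule integral_ionescu_tulcea_step)
    show "?Q i \<in> (\<Pi>\<^sub>M j\<in>{0..<i}. Om) \<rightarrow>\<^sub>M prob_algebra Om" for i by (rule chain_kernel_measurable[OF \<zeta>])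
    show "space Om \<noteq> {}" by (rule space_not_empty[OF \<zeta>])
    show "(\<lambda>\<omega>. \<phi> (\<omega> 0)) \<in> borel_measurable paths" by (rule adapted_measurable[OF ad])
    show "\<bar>\<phi> (\<omega> 0)\<bar> \<le> B" if "\<omega> \<in> space paths" for \<omega> using B that by blast
    show "\<phi> (\<omega> 0) = \<phi> (\<omega>' 0)" if "\<forall>i\<le>0. \<omega> i = \<omega>' i" for \<omega> \<omega>' :: "nat \<Rightarrow> 'a" using that by simp
  qed
  also have "\<dots> = (\<integral>x. \<phi> x \<partial>\<zeta>)" by (simp add: prob_space)
  finally show ?thesis .
qed

lemma integral_chain_step:
  assumes \<zeta>: "\<zeta> \<in> space (prob_algebra Om)" and G: "adapted n G" and \<phi>: "bfun \<phi>"
  shows "(\<integral>\<omega>. G \<omega> * \<phi> (\<omega> (Suc n)) \<partial>chain_law Om P \<zeta>) = (\<integral>\<omega>. G \<omega> * transition \<phi> (\<omega> n) \<partial>chain_law Om P \<zeta>)"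
proof -
  let ?h = "\<lambda>\<omega>. G \<omega> * \<phi> (\<omega> (Suc n))"
  have "adapted (Suc n) ?h"
    by (intro adapted_mult adapted_mono[OF G] adapted_coordinate \<phi>) auto
  then obtain B where B: "\<forall>\<omega>\<in>space paths. \<bar>?h \<omega>\<bar> \<le> B"
    and m: "?h \<in> borel_measurable paths"
    and dep: "\<And>\<omega> \<omega>'. \<forall>i\<le>Suc n. \<omega> i = \<omega>' i \<Longrightarrow> ?h \<omega> = ?h \<omega>'"
    unfolding adapted_def by blast
  let ?Q = "\<lambda>i \<omega>. case i of 0 \<Rightarrow> \<zeta> | Suc n \<Rightarrow> P (\<omega> n)"
  have "(\<integral>\<omega>. ?h \<omega> \<partial>chain_law Om P \<zeta>) =
      (\<integral>\<omega>. \<integral>y. ?h (fun_upd \<omega> (Suc n) y) \<partial>(?Q (Suc n) (restrict \<omega> {0..<Suc n})) \<partial>chain_law Om P \<zeta>)"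
    unfolding chain_law_def
  proof (rule integral_ionescu_tulcea_step)
    show "?Q i \<in> (\<Pi>\<^sub>M j\<in>{0..<i}. Om) \<rightarrow>\<^sub>M prob_algebra Om" for i by (rule chain_kernel_measurable[OF \<zeta>])
    show "space Om \<noteq> {}" by (rule space_not_empty[OF \<zeta>])
    show "?h \<in> borel_measurable paths" by (rule m)
    show "\<bar>?h \<omega>\<bar> \<le> B" if "\<omega> \<in> space paths" for \<omega> using B that by blast
    show "?h \<omega> = ?h \<omega>'" if "\<forall>i\<le>Suc n. \<omega> i = \<omega>' i" for \<omega> \<omega>' using that by (rule dep)
  qed
  also have "\<dots> = (\<integral>\<omega>. G \<omega> * transition \<phi> (\<omega> n) \<partial>chain_law Om P \<zeta>)"
  proof (intro Bochner_Integration.integral_cong refl)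
    fix \<omega> assume "\<omega> \<in> space (chain_law Om P \<zeta>)"
    have "G (fun_upd \<omega> (Suc n) y) = G \<omega>" for y
    proof -
      have "\<forall>i\<le>n. fun_upd \<omega> (Suc n) y i = \<omega> i" by auto
      then show ?thesis using G unfolding adapted_def by blast
    qed
    then show "(\<integral>y. ?h (fun_upd \<omega> (Suc n) y) \<partial>(?Q (Suc n) (restrict \<omega> {0..<Suc n}))) = G \<omega> * transition \<phi> (\<omega> n)"
      by (simp add: transition_def)
  qed
  finally show ?thesis .
qed

lemma integral_chain_power:
  assumes \<zeta>: "\<zeta> \<in> space (prob_algebra Om)" and G: "adapted n G" and \<phi>: "bfun \<phi>"
  shows "(\<integral>\<omega>. G \<omega> * \<phi> (\<omega> (n + k)) \<partial>chain_law Om P \<zeta>) = (\<integral>\<omega>. G \<omega> * (transition ^^ k) \<phi> (\<omega> n) \<partial>chain_law Om P \<zeta>)"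
  using \<phi>
proof (induction k arbitrary: \<phi>)
  case (Suc k)
  have "(\<integral>\<omega>. G \<omega> * \<phi> (\<omega> (Suc (n + k))) \<partial>chain_law Om P \<zeta>) = (\<integral>\<omega>. G \<omega> * transition \<phi> (\<omega> (n + k)) \<partial>chain_law Om P \<zeta>)"
    by (intro integral_chain_step \<zeta> adapted_mono[OF G] Suc.prems) auto
  also have "\<dots> = (\<integral>\<omega>. G \<omega> * (transition ^^ k) (transition \<phi>) (\<omega> n) \<partial>chain_law Om P \<zeta>)"
    by (intro Suc.IH bfun_transition Suc.prems)
  finally show ?case by (simp add: funpow_swap1)
qed simp

text \<open>
  The Markov property at time \<open>n\<close>, for the next \<open>k\<close> steps confined to \<open>S\<close>.
\<close>

lemma integral_chain_within_power:
  assumes \<zeta>: "\<zeta> \<in> space (prob_algebra Om)" and G: "adapted n G" and \<phi>: "bfun \<phi>" and S: "S \<in> sets Om"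
  shows "(\<integral>\<omega>. G \<omega> * (of_bool (\<forall>i\<in>{1..k}. \<omega> (n + i) \<in> S) * \<phi> (\<omega> (n + k))) \<partial>chain_law Om P \<zeta>) =
    (\<integral>\<omega>. G \<omega> * (transition_within S ^^ k) \<phi> (\<omega> n) \<partial>chain_law Om P \<zeta>)"
  using \<phi>
proof (induction k arbitrary: \<phi>)
  case (Suc k)
  define H where "H \<omega> = G \<omega> * of_bool (\<forall>i\<in>{1..k}. \<omega> (n + i) \<in> S)" for \<omega>
  have [measurable]: "S \<in> sets Om" by fact
  have "adapted (n + k) (\<lambda>\<omega>. of_bool (\<forall>i\<in>{1..k}. \<omega> (n + i) \<in> S))"
    by (rule adapted_of_bool) auto
  then have H: "adapted (n + k) H"
    unfolding H_def by (intro adapted_mult adapted_mono[OF G]) auto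
  have "(\<integral>\<omega>. G \<omega> * (of_bool (\<forall>i\<in>{1..Suc k}. \<omega> (n + i) \<in> S) * \<phi> (\<omega> (n + Suc k))) \<partial>chain_law Om P \<zeta>) =
     (\<integral>\<omega>. H \<omega> * (indicator S (\<omega> (Suc (n + k))) * \<phi> (\<omega> (Suc (n + k)))) \<partial>chain_law Om P \<zeta>)"
  proof (intro Bochner_Integration.integral_cong refl)
    fix \<omega>
    have "(\<forall>i\<in>{1..Suc k}. \<omega> (n + i) \<in> S) \<longleftrightarrow> (\<forall>i\<in>{1..k}. \<omega> (n + i) \<in> S) \<and> \<omega> (Suc (n + k)) \<in> S"
      by (auto simp: atLeastAtMostSuc_conv)
    then show "G \<omega> * (of_bool (\<forall>i\<in>{1..Suc k}. \<omega> (n + i) \<in> S) * \<phi> (\<omega> (n + Suc k))) =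
      H \<omega> * (indicator S (\<omega> (Suc (n + k))) * \<phi> (\<omega> (Suc (n + k))))"
      by (simp add: H_def indicator_def)
  qed
  also have "\<dots> = (\<integral>\<omega>. H \<omega> * transition_within S \<phi> (\<omega> (n + k)) \<partial>chain_law Om P \<zeta>)"
    unfolding transition_within_def
    by (rule integral_chain_step[OF \<zeta> H]) (intro bfun_mult bfun_indicator S Suc.prems)
  also have "\<dots> = (\<integral>\<omega>. G \<omega> * (transition_within S ^^ k) (transition_within S \<phi>) (\<omega> n) \<partial>chain_law Om P \<zeta>)"
    using Suc.IH[OF bfun_within[OF S Suc.prems]] by (simp add: H_def mult.assoc)
  finally show ?case by (simp add: funpow_swap1)
qed simp

lemma integral_chain_at:
  assumes \<zeta>: "\<zeta> \<in> space (prob_algebra Om)" and \<phi>: "bfun \<phi>"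
  shows "(\<integral>\<omega>. \<phi> (\<omega> n) \<partial>chain_law Om P \<zeta>) = (\<integral>x. (transition ^^ n) \<phi> x \<partial>\<zeta>)"
  using integral_chain_power[OF \<zeta> adapted_const[of 0 1] \<phi>, of n]
    integral_chain_start[OF \<zeta> bfun_transition_power[OF \<phi>]] by simp

lemma integral_chain_within:
  assumes \<zeta>: "\<zeta> \<in> space (prob_algebra Om)" and \<phi>: "bfun \<phi>" and S: "S \<in> sets Om"
  shows "(\<integral>\<omega>. of_bool (\<forall>i\<in>{1..n}. \<omega> i \<in> S) * \<phi> (\<omega> n) \<partial>chain_law Om P \<zeta>) =
    (\<integral>x. (transition_within S ^^ n) \<phi> x \<partial>\<zeta>)"
  using integral_chain_within_power[OF \<zeta> adapted_const[of 0 1] \<phi> S, of n]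
    integral_chain_start[OF \<zeta> bfun_within_power[OF S \<phi>]] by simp

lemma prob_chain_at:
  assumes \<zeta>: "\<zeta> \<in> space (prob_algebra Om)" and A[measurable]: "A \<in> sets Om"
  shows "\<P>(\<omega> in chain_law Om P \<zeta>. \<omega> n \<in> A) = (\<integral>x. (transition ^^ n) (indicator A) x \<partial>\<zeta>)"
proof -
  have [measurable_cong]: "sets (chain_law Om P \<zeta>) = sets paths" by (rule sets_chain[OF \<zeta>])
  interpret prob_space "chain_law Om P \<zeta>" by (rule prob_space_chain[OF \<zeta>])
  have "\<P>(\<omega> in chain_law Om P \<zeta>. \<omega> n \<in> A) = (\<integral>\<omega>. indicator {\<omega>\<in>space (chain_law Om P \<zeta>). \<omega> n \<in> A} \<omega> \<partial>chain_law Om P \<zeta>)"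
    by simp
  also have "\<dots> = (\<integral>\<omega>. indicator A (\<omega> n) \<partial>chain_law Om P \<zeta>)"
    by (intro Bochner_Integration.integral_cong) (auto simp: indicator_def)
  also have "\<dots> = (\<integral>x. (transition ^^ n) (indicator A) x \<partial>\<zeta>)"
    by (rule integral_chain_at[OF \<zeta> bfun_indicator[OF A]])
  finally show ?thesis .
qed

end

section \<open>The Poisson equation of a uniformly ergodic chain\<close>

locale ergodic_kernel = markov_kernel +
  fixes \<mu> :: "'a measure"
  assumes mu: "\<mu> \<in> space (prob_algebra Om)"
    and uniform_ergodicity:
      "(\<lambda>n. SUP \<zeta>\<in>space (prob_algebra Om).
         tv_dist (distr (chain_law Om P \<zeta>) Om (\<lambda>\<omega>. \<omega> n)) \<mu>) \<longlonglongrightarrow> 0"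
begin

definition mixing :: "nat \<Rightarrow> real" where
  "mixing n = (SUP \<zeta>\<in>space (prob_algebra Om).
         tv_dist (distr (chain_law Om P \<zeta>) Om (\<lambda>\<omega>. \<omega> n)) \<mu>)"

lemma prob_at_diff_le_mixing:
  assumes x: "x \<in> space Om" and A: "A \<in> sets Om"
  shows "\<bar>(transition ^^ n) (indicator A) x - measure \<mu> A\<bar> \<le> mixing n"
proof -
  interpret M: prob_space \<mu> by (rule law_prob[OF mu])
  let ?D = "\<lambda>\<zeta>. distr (chain_law Om P \<zeta>) Om (\<lambda>\<omega>. \<omega> n)"
  have D: "prob_space (?D \<zeta>)" if "\<zeta> \<in> space (prob_algebra Om)" for \<zeta>
    by (intro prob_space.prob_space_distr prob_space_chain that) (simp add: measurable_chain_iff[OF that])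
  have 1: "\<bar>measure (?D \<zeta>) B - measure \<mu> B\<bar> \<le> 1" if "\<zeta> \<in> space (prob_algebra Om)" for \<zeta> B
  proof -
    have "0 \<le> measure (?D \<zeta>) B" "measure (?D \<zeta>) B \<le> 1" "0 \<le> measure \<mu> B" "measure \<mu> B \<le> 1"
      using prob_space.prob_le_1[OF D[OF that]] by auto
    then show ?thesis by linarith
  qed
  let ?\<zeta> = "return Om x"
  have \<zeta>: "?\<zeta> \<in> space (prob_algebra Om)" by (rule return_in_prob_algebra[OF x])
  have "measure (?D ?\<zeta>) A = \<P>(\<omega> in chain_law Om P ?\<zeta>. \<omega> n \<in> A)"
    using A by (subst measure_distr) (auto simp: measurable_chain_iff[OF \<zeta>] intro!: arg_cong[where f="measure _"])
  also have "\<dots> = (transition ^^ n) (indicator A) x"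
    unfolding prob_chain_at[OF \<zeta> A] using x bfun_measurable[OF bfun_transition_power[OF bfun_indicator[OF A]]]
    by (intro integral_return) auto
  finally have "\<bar>(transition ^^ n) (indicator A) x - measure \<mu> A\<bar> = \<bar>measure (?D ?\<zeta>) A - measure \<mu> A\<bar>" by simp
  also have "\<dots> \<le> tv_dist (?D ?\<zeta>) \<mu>"
    unfolding tv_dist_def
  proof (rule cSUP_upper)
    show "bdd_above ((\<lambda>B. \<bar>measure (?D ?\<zeta>) B - measure \<mu> B\<bar>) ` sets (?D ?\<zeta>))"
      using 1[OF \<zeta>] by (intro bdd_aboveI[of _ 1]) blast
  qed (use A in simp)
  also have "\<dots> \<le> mixing n"
    unfolding mixing_def
  proof (rule cSUP_upper[OF \<zeta>])
    have "tv_dist (?D \<zeta>) \<mu> \<le> 1" if "\<zeta> \<in> space (prob_algebra Om)" for \<zeta>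
      unfolding tv_dist_def using sets.empty_sets[of "?D \<zeta>"] by (intro cSUP_least 1 that) blast
    then show "bdd_above ((\<lambda>\<zeta>. tv_dist (?D \<zeta>) \<mu>) ` space (prob_algebra Om))"
      by (intro bdd_aboveI[of _ 1]) blast
  qed
  finally show ?thesis .
qed

lemma mixing_tendsto: "mixing \<longlonglongrightarrow> 0"
  unfolding mixing_def[abs_def] by (rule uniform_ergodicity)

lemma transition_power_diff_le:
  assumes x: "x \<in> space Om" and \<phi>: "bfun \<phi>" and c: "\<And>y. y \<in> space Om \<Longrightarrow> \<bar>\<phi> y\<bar> \<le> c" "0 < c"
  shows "\<bar>(transition ^^ n) \<phi> x - (\<integral>y. \<phi> y \<partial>\<mu>)\<bar> \<le> 2 * c * mixing n"
proof -
  let ?\<zeta> = "return Om x"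
  let ?D = "distr (chain_law Om P ?\<zeta>) Om (\<lambda>\<omega>. \<omega> n)"
  have \<zeta>: "?\<zeta> \<in> space (prob_algebra Om)" by (rule return_in_prob_algebra[OF x])
  have m: "(\<lambda>\<omega>. \<omega> n) \<in> chain_law Om P ?\<zeta> \<rightarrow>\<^sub>M Om" by (simp add: measurable_chain_iff[OF \<zeta>])
  have [measurable]: "\<phi> \<in> borel_measurable Om" by (rule bfun_measurable[OF \<phi>])
  have int: "(\<integral>y. \<psi> y \<partial>?D) = (transition ^^ n) \<psi> x" if "bfun \<psi>" for \<psi>
  proof -
    have "(\<integral>y. \<psi> y \<partial>?D) = (\<integral>\<omega>. \<psi> (\<omega> n) \<partial>chain_law Om P ?\<zeta>)"
      by (rule integral_distr[OF m bfun_measurable[OF that]])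
    also have "\<dots> = (\<integral>y. (transition ^^ n) \<psi> y \<partial>?\<zeta>)"
      by (rule integral_chain_at[OF \<zeta> that])
    also have "\<dots> = (transition ^^ n) \<psi> x"
      using x bfun_measurable[OF bfun_transition_power[OF that]] by (intro integral_return) auto
    finally show ?thesis .
  qed
  have D: "prob_space ?D" by (intro prob_space.prob_space_distr prob_space_chain \<zeta> m)
  interpret D: prob_space ?D by (rule D)
  have "\<bar>(\<integral>y. \<phi> y \<partial>?D) - (\<integral>y. \<phi> y \<partial>\<mu>)\<bar> \<le> 2 * c * mixing n"
  proof (rule integral_diff_le_tv)
    show "prob_space ?D" by (rule D)
    show "prob_space \<mu>" by (rule law_prob[OF mu])
    show "sets \<mu> = sets ?D" using law_prob[OF mu] by simp
    show "\<phi> \<in> borel_measurable ?D" by simp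
    show "\<bar>\<phi> y\<bar> \<le> c" if "y \<in> space ?D" for y using c that by simp
    show "\<bar>measure ?D A - measure \<mu> A\<bar> \<le> mixing n" if "A \<in> sets ?D" for A
    proof -
      have A: "A \<in> sets Om" using that by simp
      have "measure ?D A = (\<integral>y. indicator A y \<partial>?D)" using A by simp
      also have "\<dots> = (transition ^^ n) (indicator A) x" by (rule int[OF bfun_indicator[OF A]])
      finally show ?thesis using prob_at_diff_le_mixing[OF x A] by simp
    qed
  qed (use c in simp)
  then show ?thesis by (simp add: int[OF \<phi>])
qed

text \<open>
  Both sides are the limit of \<open>P\<^sup>n \<phi>\<close> at a point, one shifted by a step against the other.
\<close>

lemma stationary:
  assumes \<phi>: "bfun \<phi>"
  shows "(\<integral>x. transition \<phi> x \<partial>\<mu>) = (\<integral>x. \<phi> x \<partial>\<mu>)"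
proof -
  obtain x where x: "x \<in> space Om" using space_not_empty[OF mu] by auto
  have lim: "(\<lambda>n. (transition ^^ n) \<psi> x) \<longlonglongrightarrow> (\<integral>y. \<psi> y \<partial>\<mu>)" if \<psi>: "bfun \<psi>" for \<psi>
  proof -
    from bfun_bound[OF \<psi>] obtain c where c: "0 < c" "\<And>y. y \<in> space Om \<Longrightarrow> \<bar>\<psi> y\<bar> \<le> c" by blast
    have "(\<lambda>n. 2 * c * mixing n) \<longlonglongrightarrow> 2 * c * 0" by (intro tendsto_intros mixing_tendsto)
    then have g: "(\<lambda>n. 2 * c * mixing n) \<longlonglongrightarrow> 0" by simp
    have "(\<lambda>n. (transition ^^ n) \<psi> x - (\<integral>y. \<psi> y \<partial>\<mu>)) \<longlonglongrightarrow> 0"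
    proof (rule Lim_null_comparison[OF _ g], rule always_eventually, rule allI)
      fix n show "norm ((transition ^^ n) \<psi> x - (\<integral>y. \<psi> y \<partial>\<mu>)) \<le> 2 * c * mixing n"
        unfolding real_norm_def by (rule transition_power_diff_le[OF x \<psi> c(2,1)])
    qed
    then show ?thesis by (simp add: LIM_zero_iff)
  qed
  have "(\<lambda>n. (transition ^^ Suc n) \<phi> x) \<longlonglongrightarrow> (\<integral>y. transition \<phi> y \<partial>\<mu>)"
    using lim[OF bfun_transition[OF \<phi>]] by (simp add: funpow_swap1)
  moreover have "(\<lambda>n. (transition ^^ Suc n) \<phi> x) \<longlonglongrightarrow> (\<integral>y. \<phi> y \<partial>\<mu>)"
    using lim[OF \<phi>] by (rule LIMSEQ_Suc)
  ultimately show ?thesis by (rule LIMSEQ_unique)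
qed

text \<open>
  If \<open>L\<close> is so large that the distance from stationarity is below \<open>1/4\<close>, then \<open>P\<^sup>L\<close> halves the
  supremum of every function with mean zero. By stationarity its image has mean zero again, so the
  halving can be iterated.
\<close>

lemma transition_power_geometric:
  assumes \<phi>: "bfun \<phi>" and mean: "(\<integral>y. \<phi> y \<partial>\<mu>) = 0"
  shows "\<exists>C \<rho>. 0 \<le> C \<and> 0 \<le> \<rho> \<and> \<rho> < 1 \<and> (\<forall>n. \<forall>x\<in>space Om. \<bar>(transition ^^ n) \<phi> x\<bar> \<le> C * \<rho> ^ n)"
proof -
  have "\<forall>\<^sub>F n in sequentially. mixing n < 1 / 4"
    using order_tendstoD(2)[OF mixing_tendsto, of "1/4"] by simp
  then have "\<forall>\<^sub>F n in sequentially. mixing n < 1 / 4 \<and> 1 \<le> n"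
    using eventually_ge_at_top[of 1] by eventually_elim auto
  then obtain L where L: "mixing L < 1 / 4" "0 < L" by (auto simp: eventually_sequentially)
  have halve: "\<bar>(transition ^^ L) \<psi> x\<bar> \<le> b / 2"
    if "bfun \<psi>" "(\<integral>y. \<psi> y \<partial>\<mu>) = 0" "\<And>y. y \<in> space Om \<Longrightarrow> \<bar>\<psi> y\<bar> \<le> b" "0 < b" "x \<in> space Om" for \<psi> b x
  proof -
    have "\<bar>(transition ^^ L) \<psi> x\<bar> \<le> 2 * b * mixing L"
      using transition_power_diff_le[OF that(5,1,3,4), of L] that(2) by simp
    also have "\<dots> \<le> 2 * b * (1 / 4)" using L that by (intro mult_left_mono) auto
    finally show ?thesis by simp
  qed
  have mean0: "(\<integral>y. (transition ^^ n) \<phi> y \<partial>\<mu>) = 0" for n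
    by (induction n) (simp_all add: mean stationary bfun_transition_power[OF \<phi>])
  from bfun_bound[OF \<phi>] obtain c where c: "0 < c" "\<And>y. y \<in> space Om \<Longrightarrow> \<bar>\<phi> y\<bar> \<le> c" by blast
  have small: "\<bar>(transition ^^ r) \<phi> x\<bar> \<le> c" if "x \<in> space Om" for r x
    using that
  proof (induction r arbitrary: x)
    case (Suc r)
    then show ?case using transition_bound[OF bfun_transition_power[OF \<phi>]] by simp
  qed (simp add: c)
  have bound: "\<bar>(transition ^^ (k * L + r)) \<phi> x\<bar> \<le> c * (1 / 2) ^ k" if "x \<in> space Om" for k r x
    using that
  proof (induction k arbitrary: x)
    case 0 then show ?case using small by simp
  next
    case (Suc k)
    have "\<bar>(transition ^^ L) ((transition ^^ (k * L + r)) \<phi>) x\<bar> \<le> (c * (1 / 2) ^ k) / 2"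
      by (rule halve[OF bfun_transition_power[OF \<phi>] mean0 Suc.IH _ Suc.prems]) (use c in auto)
    also have "(transition ^^ L) ((transition ^^ (k * L + r)) \<phi>) = (transition ^^ (Suc k * L + r)) \<phi>"
      by (simp add: funpow_add add.assoc)
    finally show ?case by simp
  qed
  obtain C \<rho> where C: "0 \<le> C" "0 \<le> \<rho>" "\<rho> < 1" "\<And>n. (1 / 2 :: real) ^ (n div L) \<le> C * \<rho> ^ n"
    using power_div_le_geometric[of "1/2" L] L by auto
  have "\<bar>(transition ^^ n) \<phi> x\<bar> \<le> (c * C) * \<rho> ^ n" if "x \<in> space Om" for n x
  proof -
    have "\<bar>(transition ^^ n) \<phi> x\<bar> \<le> c * (1 / 2) ^ (n div L)"
      using bound[OF that, of "n div L" "n mod L"] by simp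
    also have "\<dots> \<le> c * (C * \<rho> ^ n)" using c C by (intro mult_left_mono) auto
    finally show ?thesis by (simp add: mult.assoc)
  qed
  then show ?thesis using c C by (intro exI[of _ "c * C"] exI[of _ \<rho>]) auto
qed

text \<open>
  The series of the \<open>P\<^sup>n \<phi>\<close> with \<open>n \<ge> 1\<close> converges uniformly, and applying \<open>P\<close> removes its first term.
\<close>

lemma poisson_equation:
  assumes \<phi>: "bfun \<phi>" and mean: "(\<integral>y. \<phi> y \<partial>\<mu>) = 0"
  shows "\<exists>h. bfun h \<and> (\<forall>x\<in>space Om. h x - transition h x = transition \<phi> x)"
proof -
  obtain C \<rho> where C: "0 \<le> C" "0 \<le> \<rho>" "\<rho> < 1"
    and b: "\<And>n x. x \<in> space Om \<Longrightarrow> \<bar>(transition ^^ n) \<phi> x\<bar> \<le> C * \<rho> ^ n"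
    using transition_power_geometric[OF assms] by blast
  define t where "t n = (transition ^^ Suc n) \<phi>" for n
  have bt: "bfun (t n)" for n unfolding t_def by (rule bfun_transition_power[OF \<phi>])
  have tb: "\<bar>t n x\<bar> \<le> C * \<rho> ^ n" if "x \<in> space Om" for n x
  proof -
    have "\<bar>t n x\<bar> \<le> C * \<rho> ^ Suc n" unfolding t_def by (rule b[OF that])
    also have "\<dots> \<le> C * \<rho> ^ n" using C by (intro mult_left_mono power_decreasing) auto
    finally show ?thesis .
  qed
  have sg: "summable (\<lambda>n. C * \<rho> ^ n)" using C by (intro summable_mult summable_geometric) auto
  have st: "summable (\<lambda>n. \<bar>t n x\<bar>)" if "x \<in> space Om" for x
    by (rule summable_comparison_test'[OF sg, of 0]) (use tb that in simp)
  have st': "summable (\<lambda>n. t n x)" if "x \<in> space Om" for x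
    by (rule summable_rabs_cancel[OF st[OF that]])
  define h where "h x = (\<Sum>n. t n x)" for x
  have bh: "bfun h"
  proof (rule bfunI)
    have [measurable]: "t n \<in> borel_measurable Om" for n by (rule bfun_measurable[OF bt])
    show "h \<in> borel_measurable Om" unfolding h_def[abs_def] by measurable
    show "\<bar>h x\<bar> \<le> (\<Sum>n. C * \<rho> ^ n)" if "x \<in> space Om" for x
    proof -
      have "\<bar>h x\<bar> \<le> (\<Sum>n. \<bar>t n x\<bar>)" unfolding h_def by (rule summable_rabs[OF st[OF that]])
      also have "\<dots> \<le> (\<Sum>n. C * \<rho> ^ n)" using tb that by (intro suminf_le st sg) auto
      finally show ?thesis .
    qed
  qed
  have "h x - transition h x = transition \<phi> x" if x: "x \<in> space Om" for x
  proof -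
    have "transition h x = (\<Sum>n. \<integral>y. t n y \<partial>P x)"
      unfolding transition_def h_def
    proof (rule integral_suminf)
      show "integrable (P x) (t n)" for n by (rule integrable_bfun[OF kernel_in_prob_algebra[OF x] bt])
      show "AE y in P x. summable (\<lambda>n. norm (t n y))"
        using st by (intro AE_I2) (auto simp: space_kernel_P[OF x])
      show "summable (\<lambda>n. \<integral>y. norm (t n y) \<partial>P x)"
      proof (rule summable_comparison_test'[OF sg])
        fix n :: nat
        interpret prob_space "P x" by (rule kernel_prob[OF x])
        have "(\<integral>y. norm (t n y) \<partial>P x) \<le> (\<integral>y. C * \<rho> ^ n \<partial>P x)"
          using integrable_bfun[OF kernel_in_prob_algebra[OF x] bt] tb
          by (intro integral_mono) (auto simp: space_kernel_P[OF x])
        moreover have "0 \<le> (\<integral>y. norm (t n y) \<partial>P x)" by simp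
        ultimately show "norm (\<integral>y. norm (t n y) \<partial>P x) \<le> C * \<rho> ^ n" by (simp add: prob_space)
      qed
    qed
    also have "\<dots> = (\<Sum>n. t (Suc n) x)" by (simp add: t_def transition_def)
    also have "\<dots> = h x - t 0 x"
      unfolding h_def by (rule suminf_split_head[OF st'[OF x]])
    finally show ?thesis by (simp add: t_def)
  qed
  with bh show ?thesis by blast
qed

end

section \<open>Quasistationarity and the length of decorrelation\<close>

context markov_kernel
begin

text \<open>
  Both sides are integrals of \<open>\<phi>\<close> with respect to finite measures, so it suffices to compare these on
  sets, and even on subsets of \<open>S\<close>: both measures are carried by \<open>S\<close>. In this way quasistationarity and
  exact decorrelation, which speak about sets, become identities between operators.
\<close>

lemma integral_within_power_eqI:
  assumes \<zeta>: "\<zeta> \<in> space (prob_algebra Om)" and \<rho>: "\<rho> \<in> space (prob_algebra Om)"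
    and S[measurable]: "S \<in> sets Om" and \<rho>S: "measure \<rho> S = 1" and n: "1 \<le> n" and c: "0 \<le> c"
    and eq: "\<And>A. A \<in> sets Om \<Longrightarrow> A \<subseteq> S \<Longrightarrow>
      \<P>(\<omega> in chain_law Om P \<zeta>. \<omega> n \<in> A \<and> (\<forall>i\<in>{1..n}. \<omega> i \<in> S)) = c * measure \<rho> A"
    and \<phi>: "bfun \<phi>"
  shows "(\<integral>x. (transition_within S ^^ n) \<phi> x \<partial>\<zeta>) = c * (\<integral>x. \<phi> x \<partial>\<rho>)"
proof -
  let ?M = "chain_law Om P \<zeta>"
  interpret M: prob_space ?M by (rule prob_space_chain[OF \<zeta>])
  interpret R: prob_space \<rho> by (rule law_prob[OF \<rho>])
  have sM[measurable_cong]: "sets ?M = sets paths" by (rule sets_chain[OF \<zeta>])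
  have sR[measurable_cong]: "sets \<rho> = sets Om" by (rule law_prob[OF \<rho>])
  have [measurable]: "\<phi> \<in> borel_measurable Om" by (rule bfun_measurable[OF \<phi>])
  define B where "B = {\<omega>\<in>space ?M. \<forall>i\<in>{1..n}. \<omega> i \<in> S}"
  have [measurable]: "B \<in> sets ?M" unfolding B_def by measurable
  define K where "K = distr (density ?M (indicator B)) Om (\<lambda>\<omega>. \<omega> n)"
  have "K = density \<rho> (\<lambda>_. ennreal c)"
  proof (rule measure_eqI)
    show "sets K = sets (density \<rho> (\<lambda>_. ennreal c))" by (simp add: K_def sR)
    fix A assume "A \<in> sets K"
    then have A[measurable]: "A \<in> sets Om" by (simp add: K_def)
    have "emeasure K A = emeasure (density ?M (indicator B)) ((\<lambda>\<omega>. \<omega> n) -` A \<inter> space ?M)"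
      unfolding K_def by (subst emeasure_distr) auto
    also have "\<dots> = (\<integral>\<^sup>+\<omega>. indicator B \<omega> * indicator ((\<lambda>\<omega>. \<omega> n) -` A \<inter> space ?M) \<omega> \<partial>?M)"
      by (rule emeasure_density) measurable
    also have "\<dots> = (\<integral>\<^sup>+\<omega>. indicator {\<omega>\<in>space ?M. \<omega> n \<in> A \<inter> S \<and> (\<forall>i\<in>{1..n}. \<omega> i \<in> S)} \<omega> \<partial>?M)"
      using n by (intro nn_integral_cong) (auto simp: B_def indicator_def)
    also have "\<dots> = emeasure ?M {\<omega>\<in>space ?M. \<omega> n \<in> A \<inter> S \<and> (\<forall>i\<in>{1..n}. \<omega> i \<in> S)}"
      by (rule nn_integral_indicator) measurable
    also have "\<dots> = ennreal (c * measure \<rho> (A \<inter> S))"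
      using eq[of "A \<inter> S"] by (simp add: M.emeasure_eq_measure)
    also have "measure \<rho> (A \<inter> S) = measure \<rho> A"
    proof (rule R.finite_measure_eq_AE)
      have "AE x in \<rho>. x \<in> S" using \<rho>S by (subst R.AE_in_set_eq_1) auto
      then show "AE x in \<rho>. (x \<in> A \<inter> S) = (x \<in> A)" by eventually_elim auto
    qed auto
    also have "ennreal (c * measure \<rho> A) = emeasure (density \<rho> (\<lambda>_. ennreal c)) A"
      using c A by (subst emeasure_density_const) (auto simp: sR R.emeasure_eq_measure ennreal_mult)
    finally show "emeasure K A = emeasure (density \<rho> (\<lambda>_. ennreal c)) A" .
  qed
  then have "(\<integral>x. \<phi> x \<partial>K) = c * (\<integral>x. \<phi> x \<partial>\<rho>)"
    using c by (simp add: integral_density)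
  moreover have "(\<integral>x. \<phi> x \<partial>K) = (\<integral>x. (transition_within S ^^ n) \<phi> x \<partial>\<zeta>)"
  proof -
    have "(\<integral>x. \<phi> x \<partial>K) = (\<integral>\<omega>. \<phi> (\<omega> n) \<partial>density ?M (\<lambda>\<omega>. ennreal (indicator B \<omega>)))"
      unfolding K_def by (simp add: integral_distr ennreal_indicator)
    also have "\<dots> = (\<integral>\<omega>. indicator B \<omega> * \<phi> (\<omega> n) \<partial>?M)"
      by (subst integral_density) auto
    also have "\<dots> = (\<integral>\<omega>. of_bool (\<forall>i\<in>{1..n}. \<omega> i \<in> S) * \<phi> (\<omega> n) \<partial>?M)"
      by (intro Bochner_Integration.integral_cong) (auto simp: B_def indicator_def)
    also have "\<dots> = (\<integral>x. (transition_within S ^^ n) \<phi> x \<partial>\<zeta>)"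
      by (rule integral_chain_within[OF \<zeta> \<phi> S])
    finally show ?thesis .
  qed
  ultimately show ?thesis by simp
qed

lemma integral_return_bfun: "x \<in> space Om \<Longrightarrow> bfun \<phi> \<Longrightarrow> (\<integral>y. \<phi> y \<partial>return Om x) = \<phi> x"
  by (intro integral_return bfun_measurable)

lemma AE_in_carrier:
  assumes \<rho>: "\<rho> \<in> space (prob_algebra Om)" and S: "S \<in> sets Om" and 1: "measure \<rho> S = 1"
  shows "AE x in \<rho>. x \<in> S"
proof -
  interpret prob_space \<rho> by (rule law_prob[OF \<rho>])
  show ?thesis using 1 S by (subst AE_in_set_eq_1) (auto simp: law_prob[OF \<rho>])
qed

lemma within_power_le:
  assumes S: "S \<in> sets Om" and a: "0 \<le> a" and step: "\<And>x. x \<in> S \<Longrightarrow> a \<le> transition (indicator S) x"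
  shows "x \<in> S \<Longrightarrow> a ^ k \<le> (transition_within S ^^ k) (\<lambda>_. 1) x"
proof (induction k arbitrary: x)
  case (Suc k)
  let ?g = "(transition_within S ^^ k) (\<lambda>_. 1)"
  have x: "x \<in> space Om" using Suc.prems S sets.sets_into_space by blast
  have g: "bfun ?g" by (intro bfun_within_power S bfun_const)
  have "a ^ Suc k \<le> a ^ k * transition (indicator S) x"
    unfolding power_Suc2 by (intro mult_left_mono zero_le_power a step[OF Suc.prems])
  also have "\<dots> = (\<integral>y. a ^ k * indicator S y \<partial>P x)" by (simp add: transition_def)
  also have "\<dots> \<le> (\<integral>y. indicator S y * ?g y \<partial>P x)"
  proof (rule integral_mono)
    show "integrable (P x) (\<lambda>y. a ^ k * indicator S y)" "integrable (P x) (\<lambda>y. indicator S y * ?g y)"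
      by (intro integrable_bfun kernel_in_prob_algebra x bfun_mult bfun_const bfun_indicator S g)+
    show "a ^ k * indicator S y \<le> indicator S y * ?g y" if "y \<in> space (P x)" for y
      using Suc.IH by (auto simp: indicator_def)
  qed
  finally show ?case
    unfolding funpow.simps(2) comp_apply transition_within_def[of S ?g] transition_def .
qed simp

end

locale decorrelating_kernel = ergodic_kernel Om P \<mu> for Om :: "'a measure" and P \<mu> +
  fixes \<S> :: "'a set set" and \<nu> :: "'a set \<Rightarrow> 'a measure" and T_corr :: nat
  assumes sets_S: "finite \<S>" "\<S> \<subseteq> sets Om" "disjoint \<S>"
    and qsd: "\<forall>S\<in>\<S>. \<forall>\<rho>. quasistationary Om P S \<rho> \<longleftrightarrow> \<rho> = \<nu> S"
    and T_corr: "T_corr \<ge> 1"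
    and exact_decorrelation:
      "\<forall>S\<in>\<S>. \<forall>A\<in>sets Om. A \<subseteq> S \<longrightarrow> (\<forall>\<zeta>\<in>space (prob_algebra Om).
         \<P>(\<omega> in chain_law Om P \<zeta>. \<forall>i\<in>{1..T_corr}. \<omega> i \<in> S) > 0 \<longrightarrow>
         \<P>(\<omega> in chain_law Om P \<zeta>. \<omega> T_corr \<in> A \<bar> \<forall>i\<in>{1..T_corr}. \<omega> i \<in> S) = measure (\<nu> S) A)"
    and doeblin:
      "\<exists>\<alpha>::real. 0 < \<alpha> \<and> \<alpha> < 1 \<and>
         (\<exists>S\<in>\<S>. measure \<mu> S > 0 \<and>
           (\<exists>\<theta>\<in>space (prob_algebra Om). measure \<theta> S = 1 \<and>
             (\<forall>x\<in>S. \<forall>C\<in>sets Om. C \<subseteq> S \<longrightarrow>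
               \<P>(\<omega> in chain_law Om P (return Om x). \<omega> 1 \<in> C) \<ge> \<alpha> * measure \<theta> C)))"
    and escape_rates:
      "\<exists>\<delta>>0. \<forall>S\<in>\<S>. \<P>(\<omega> in chain_law Om P (\<nu> S). \<omega> 1 \<notin> S) \<ge> \<delta>"
begin

lemma S_sets: "S \<in> \<S> \<Longrightarrow> S \<in> sets Om" using sets_S by auto

lemma S_unique: "S \<in> \<S> \<Longrightarrow> S' \<in> \<S> \<Longrightarrow> x \<in> S \<Longrightarrow> x \<in> S' \<Longrightarrow> S = S'"
  using sets_S(3) by (auto simp: pairwise_def disjnt_def)

lemma nu_law: "S \<in> \<S> \<Longrightarrow> \<nu> S \<in> space (prob_algebra Om)"
  and nu_S: "S \<in> \<S> \<Longrightarrow> measure (\<nu> S) S = 1"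
  using qsd unfolding quasistationary_def by blast+

text \<open>
  Exact decorrelation for the Dirac mass at \<open>x\<close>; here \<open>c\<close> is the probability that \<open>T_corr\<close> steps from \<open>x\<close>
  stay in \<open>S\<close>, and may vanish. Integrating over \<open>x\<close> recovers every other initial law.
\<close>

lemma exact_decorrelation_pointwise:
  assumes S: "S \<in> \<S>" and x: "x \<in> space Om"
  shows "\<exists>c. \<forall>\<phi>. bfun \<phi> \<longrightarrow> (transition_within S ^^ T_corr) \<phi> x = c * (\<integral>y. \<phi> y \<partial>\<nu> S)"
proof -
  let ?\<zeta> = "return Om x"
  have \<zeta>: "?\<zeta> \<in> space (prob_algebra Om)" by (rule return_in_prob_algebra[OF x])
  interpret prob_space "chain_law Om P ?\<zeta>" by (rule prob_space_chain[OF \<zeta>])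
  have [measurable_cong]: "sets (chain_law Om P ?\<zeta>) = sets paths" by (rule sets_chain[OF \<zeta>])
  have [measurable]: "S \<in> sets Om" by (rule S_sets[OF S])
  define c where "c = \<P>(\<omega> in chain_law Om P ?\<zeta>. \<forall>i\<in>{1..T_corr}. \<omega> i \<in> S)"
  have eq: "\<P>(\<omega> in chain_law Om P ?\<zeta>. \<omega> T_corr \<in> A \<and> (\<forall>i\<in>{1..T_corr}. \<omega> i \<in> S)) = c * measure (\<nu> S) A"
    if A: "A \<in> sets Om" "A \<subseteq> S" for A
  proof (cases "c > 0")
    case True
    define p where "p = \<P>(\<omega> in chain_law Om P ?\<zeta>. \<omega> T_corr \<in> A \<and> (\<forall>i\<in>{1..T_corr}. \<omega> i \<in> S))"
    have "\<P>(\<omega> in chain_law Om P ?\<zeta>. \<omega> T_corr \<in> A \<bar> \<forall>i\<in>{1..T_corr}. \<omega> i \<in> S) = measure (\<nu> S) A"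
      using exact_decorrelation S A \<zeta> True unfolding c_def by blast
    then have "p / c = measure (\<nu> S) A" unfolding cond_prob_def c_def p_def .
    then show ?thesis unfolding p_def[symmetric] using True by (simp add: field_simps)
  next
    case False
    then have "c = 0" unfolding c_def by (simp add: measure_le_0_iff not_less)
    have "prob {\<omega>\<in>space (chain_law Om P ?\<zeta>). \<omega> T_corr \<in> A \<and> (\<forall>i\<in>{1..T_corr}. \<omega> i \<in> S)} \<le> c"
      unfolding c_def by (rule finite_measure_mono) auto
    then show ?thesis using \<open>c = 0\<close> by (simp add: measure_le_0_iff)
  qed
  have "(transition_within S ^^ T_corr) \<phi> x = c * (\<integral>y. \<phi> y \<partial>\<nu> S)" if \<phi>: "bfun \<phi>" for \<phi>
  proof -
    have "0 \<le> c" by (simp add: c_def)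
    from integral_within_power_eqI[OF \<zeta> nu_law[OF S] S_sets[OF S] nu_S[OF S] T_corr this eq \<phi>]
    show ?thesis by (simp add: integral_return_bfun[OF x bfun_within_power[OF S_sets[OF S] \<phi>]])
  qed
  then show ?thesis by blast
qed

definition stay :: "'a set \<Rightarrow> real" where
  "stay S = \<P>(\<omega> in chain_law Om P (\<nu> S). \<omega> 1 \<in> S)"

lemma stay_nonneg: "0 \<le> stay S" by (simp add: stay_def)

lemma stay_less_1: assumes S: "S \<in> \<S>" shows "stay S < 1"
proof -
  interpret prob_space "chain_law Om P (\<nu> S)" by (rule prob_space_chain[OF nu_law[OF S]])
  have [measurable_cong]: "sets (chain_law Om P (\<nu> S)) = sets paths" by (rule sets_chain[OF nu_law[OF S]])
  have [measurable]: "S \<in> sets Om" by (rule S_sets[OF S])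
  obtain \<delta> where "\<delta> > 0" "\<P>(\<omega> in chain_law Om P (\<nu> S). \<omega> 1 \<notin> S) \<ge> \<delta>"
    using escape_rates S by blast
  moreover have "\<P>(\<omega> in chain_law Om P (\<nu> S). \<omega> 1 \<notin> S) = 1 - stay S"
    unfolding stay_def by (rule prob_neg) measurable
  ultimately show ?thesis by simp
qed

text \<open>
  The case \<open>n = 1\<close> of quasistationarity, which already determines all later times.
\<close>

lemma qsd_within:
  assumes S: "S \<in> \<S>" and \<phi>: "bfun \<phi>"
  shows "(\<integral>x. transition_within S \<phi> x \<partial>\<nu> S) = stay S * (\<integral>x. \<phi> x \<partial>\<nu> S)"
proof -
  let ?M = "chain_law Om P (\<nu> S)"
  have \<zeta>: "\<nu> S \<in> space (prob_algebra Om)" by (rule nu_law[OF S])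
  interpret prob_space ?M by (rule prob_space_chain[OF \<zeta>])
  have [measurable_cong]: "sets ?M = sets paths" by (rule sets_chain[OF \<zeta>])
  have [measurable]: "S \<in> sets Om" by (rule S_sets[OF S])
  have q: "measure (\<nu> S) A = \<P>(\<omega> in ?M. \<omega> 1 \<in> A \<and> (\<forall>i\<in>{1..1}. \<omega> i \<in> S)) / stay S"
    if "A \<in> sets Om" "A \<subseteq> S" for A
  proof -
    have "measure (\<nu> S) A = \<P>(\<omega> in ?M. \<omega> 1 \<in> A \<bar> \<forall>i\<in>{1..1}. \<omega> i \<in> S)"
      using qsd S that unfolding quasistationary_def by blast
    then show ?thesis by (simp add: cond_prob_def stay_def)
  qed
  have "stay S \<noteq> 0" using q[OF S_sets[OF S] subset_refl] nu_S[OF S] by auto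
  then have eq: "\<P>(\<omega> in ?M. \<omega> 1 \<in> A \<and> (\<forall>i\<in>{1..1}. \<omega> i \<in> S)) = stay S * measure (\<nu> S) A"
    if "A \<in> sets Om" "A \<subseteq> S" for A
    using q[OF that] by simp
  show ?thesis
    using integral_within_power_eqI[OF \<zeta> \<zeta> S_sets[OF S] nu_S[OF S] le_refl stay_nonneg eq \<phi>] by simp
qed

lemma qsd_within_power:
  assumes S: "S \<in> \<S>" and \<phi>: "bfun \<phi>"
  shows "(\<integral>x. (transition_within S ^^ n) \<phi> x \<partial>\<nu> S) = stay S ^ n * (\<integral>x. \<phi> x \<partial>\<nu> S)"
  by (induction n) (simp_all add: qsd_within[OF S bfun_within_power[OF S_sets[OF S] \<phi>]])

definition decorrelation_time :: "(nat \<Rightarrow> 'a) \<Rightarrow> nat" where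
  "decorrelation_time \<omega> = (LEAST n. decorrelated \<S> T_corr \<omega> n)"

lemma measurable_decorrelated[measurable]: "Measurable.pred paths (\<lambda>\<omega>. decorrelated \<S> T_corr \<omega> n)"
proof -
  have "Measurable.pred paths (\<lambda>\<omega>. \<exists>S\<in>\<S>. \<forall>j<T_corr. \<omega> (n - j) \<in> S)"
  proof (rule pred_intros_finite(4)[OF sets_S(1)])
    fix S assume "S \<in> \<S>"
    then have [measurable]: "S \<in> sets Om" by (rule S_sets)
    show "Measurable.pred paths (\<lambda>\<omega>. \<forall>j<T_corr. \<omega> (n - j) \<in> S)" by measurable
  qed
  then show ?thesis unfolding decorrelated_def by measurable
qed

lemma decorrelated_cong:
  assumes "\<forall>i\<le>n. \<omega> i = \<omega>' i" shows "decorrelated \<S> T_corr \<omega> n \<longleftrightarrow> decorrelated \<S> T_corr \<omega>' n"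
proof -
  have "\<omega> (n - j) = \<omega>' (n - j)" for j using assms by simp
  then show ?thesis unfolding decorrelated_def by simp
qed

lemma adapted_not_decorrelated:
  assumes J: "\<And>i. J i \<Longrightarrow> i \<le> n"
  shows "adapted n (\<lambda>\<omega>. of_bool (\<forall>i. J i \<longrightarrow> \<not> decorrelated \<S> T_corr \<omega> i))"
proof (rule adapted_of_bool)
  show "Measurable.pred paths (\<lambda>\<omega>. \<forall>i. J i \<longrightarrow> \<not> decorrelated \<S> T_corr \<omega> i)" by measurable
  fix \<omega> \<omega>' assume *: "\<forall>i\<le>n. \<omega> i = \<omega>' i" "\<forall>i. J i \<longrightarrow> \<not> decorrelated \<S> T_corr \<omega> i"
  show "\<forall>i. J i \<longrightarrow> \<not> decorrelated \<S> T_corr \<omega>' i"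
  proof (intro allI impI)
    fix i assume "J i"
    then show "\<not> decorrelated \<S> T_corr \<omega>' i" using *(2) decorrelated_cong[of i \<omega> \<omega>'] *(1) J[of i] by simp
  qed
qed

text \<open>
  Let \<open>S\<close> be the set of the Doeblin condition. From any state, the chain is in \<open>S\<close> after \<open>k\<close> steps with
  probability at least \<open>\<mu>(S) / 2\<close>, for a fixed large \<open>k\<close>; it then stays in \<open>S\<close> during \<open>T_corr - 1\<close> further steps
  with probability at least \<open>\<alpha> ^ (T_corr - 1)\<close>. Together these are \<open>T_corr\<close> consecutive positions in \<open>S\<close>,
  so that decorrelation has occurred, in \<open>S\<close> or elsewhere, during \<open>L = k + T_corr\<close> steps.
\<close>

lemma decorrelation_tail_step:
  "\<exists>L \<epsilon>. 0 < L \<and> 0 < \<epsilon> \<and> \<epsilon> < 1 \<and> (\<forall>\<zeta>\<in>space (prob_algebra Om). \<forall>n.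
     \<P>(\<omega> in chain_law Om P \<zeta>. \<forall>i<n + L. \<not> decorrelated \<S> T_corr \<omega> i) \<le>
     (1 - \<epsilon>) * \<P>(\<omega> in chain_law Om P \<zeta>. \<forall>i<n. \<not> decorrelated \<S> T_corr \<omega> i))"
proof -
  obtain \<alpha> S \<theta> where \<alpha>: "0 < \<alpha>" "\<alpha> < 1" and S: "S \<in> \<S>" and \<mu>S: "measure \<mu> S > 0"
    and \<theta>: "\<theta> \<in> space (prob_algebra Om)" "measure \<theta> S = 1"
    and D: "\<And>x C. x \<in> S \<Longrightarrow> C \<in> sets Om \<Longrightarrow> C \<subseteq> S \<Longrightarrow>
       \<P>(\<omega> in chain_law Om P (return Om x). \<omega> 1 \<in> C) \<ge> \<alpha> * measure \<theta> C"
    using doeblin by blast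
  have Sm[measurable]: "S \<in> sets Om" by (rule S_sets[OF S])
  have step: "\<alpha> \<le> transition (indicator S) x" if "x \<in> S" for x
  proof -
    have x: "x \<in> space Om" using that Sm sets.sets_into_space by blast
    have "\<alpha> \<le> \<P>(\<omega> in chain_law Om P (return Om x). \<omega> 1 \<in> S)" using D[OF that Sm subset_refl] \<theta> by simp
    also have "\<dots> = transition (indicator S) x"
      using prob_chain_at[OF return_in_prob_algebra[OF x] Sm, of 1]
        integral_return_bfun[OF x bfun_transition[OF bfun_indicator[OF Sm]]] by simp
    finally show ?thesis .
  qed
  have "\<forall>\<^sub>F n in sequentially. mixing n < measure \<mu> S / 2"
    using order_tendstoD(2)[OF mixing_tendsto, of "measure \<mu> S / 2"] \<mu>S by simp
  then obtain k where k: "mixing k < measure \<mu> S / 2" by (auto simp: eventually_sequentially)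
  have hit: "measure \<mu> S / 2 \<le> (transition ^^ k) (indicator S) x" if "x \<in> space Om" for x
    using prob_at_diff_le_mixing[OF that Sm, of k] k by linarith
  define \<epsilon> where "\<epsilon> = measure \<mu> S / 2 * \<alpha> ^ (T_corr - 1)"
  have \<epsilon>: "0 < \<epsilon>" "\<epsilon> < 1"
  proof -
    interpret M: prob_space \<mu> by (rule law_prob[OF mu])
    show "0 < \<epsilon>" using \<alpha> \<mu>S by (simp add: \<epsilon>_def)
    have "\<epsilon> \<le> 1 / 2 * 1" unfolding \<epsilon>_def
      using M.prob_le_1[of S] \<alpha> \<mu>S by (intro mult_mono power_le_one) auto
    then show "\<epsilon> < 1" by simp
  qed
  define L where "L = k + T_corr"
  have "\<P>(\<omega> in chain_law Om P \<zeta>. \<forall>i<n + L. \<not> decorrelated \<S> T_corr \<omega> i) \<le>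
     (1 - \<epsilon>) * \<P>(\<omega> in chain_law Om P \<zeta>. \<forall>i<n. \<not> decorrelated \<S> T_corr \<omega> i)"
    if \<zeta>: "\<zeta> \<in> space (prob_algebra Om)" for \<zeta> n
  proof -
    let ?M = "chain_law Om P \<zeta>"
    interpret prob_space ?M by (rule prob_space_chain[OF \<zeta>])
    have [measurable_cong]: "sets ?M = sets paths" by (rule sets_chain[OF \<zeta>])
    define g where "g \<omega> = (of_bool (\<forall>i<n. \<not> decorrelated \<S> T_corr \<omega> i) :: real)" for \<omega>
    define A where "A = {\<omega>\<in>space ?M. \<forall>i<n. \<not> decorrelated \<S> T_corr \<omega> i}"
    define B where "B = {\<omega>\<in>space ?M. \<forall>i<n + L. \<not> decorrelated \<S> T_corr \<omega> i}"
    define H where "H = {\<omega>\<in>space ?M. (\<forall>i<n. \<not> decorrelated \<S> T_corr \<omega> i) \<and>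
      \<omega> (n + k) \<in> S \<and> (\<forall>i\<in>{1..T_corr - 1}. \<omega> (n + k + i) \<in> S)}"
    have [measurable]: "A \<in> sets ?M" "B \<in> sets ?M" "H \<in> sets ?M" unfolding A_def B_def H_def by measurable
    have gA: "adapted n g"
      unfolding g_def by (rule adapted_not_decorrelated) simp
    have "\<epsilon> * prob A = (\<integral>\<omega>. \<epsilon> * g \<omega> \<partial>?M)"
    proof -
      have "prob A = (\<integral>\<omega>. indicator A \<omega> \<partial>?M)" by simp
      also have "\<dots> = (\<integral>\<omega>. g \<omega> \<partial>?M)"
        by (intro Bochner_Integration.integral_cong) (auto simp: A_def g_def indicator_def)
      finally show ?thesis by simp
    qed
    also have "\<dots> \<le> (\<integral>\<omega>. \<alpha> ^ (T_corr - 1) * (g \<omega> * (transition ^^ k) (indicator S) (\<omega> n)) \<partial>?M)"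
    proof (rule integral_mono)
      show "integrable ?M (\<lambda>\<omega>. \<epsilon> * g \<omega>)"
        by (rule integrable_adapted[OF \<zeta> adapted_mult[OF adapted_const gA]])
      show "integrable ?M (\<lambda>\<omega>. \<alpha> ^ (T_corr - 1) * (g \<omega> * (transition ^^ k) (indicator S) (\<omega> n)))"
        by (intro integrable_adapted[OF \<zeta>, where n=n] adapted_mult[OF adapted_const] adapted_mult[OF gA]
          adapted_coordinate bfun_transition_power bfun_indicator Sm) simp
      fix \<omega> assume "\<omega> \<in> space ?M"
      then have "\<omega> n \<in> space Om" by (simp add: space_chain[OF \<zeta>] space_PiM PiE_iff)
      from hit[OF this] have "\<epsilon> \<le> \<alpha> ^ (T_corr - 1) * (transition ^^ k) (indicator S) (\<omega> n)"
        unfolding \<epsilon>_def using \<alpha> by (subst mult.commute) (intro mult_left_mono, auto)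
      then show "\<epsilon> * g \<omega> \<le> \<alpha> ^ (T_corr - 1) * (g \<omega> * (transition ^^ k) (indicator S) (\<omega> n))"
        by (simp add: g_def)
    qed
    also have "\<dots> = \<alpha> ^ (T_corr - 1) * (\<integral>\<omega>. g \<omega> * indicator S (\<omega> (n + k)) \<partial>?M)"
      using integral_chain_power[OF \<zeta> gA bfun_indicator[OF Sm], of k] by simp
    also have "\<dots> = (\<integral>\<omega>. \<alpha> ^ (T_corr - 1) * (g \<omega> * indicator S (\<omega> (n + k))) \<partial>?M)"
      by simp
    also have "\<dots> \<le> (\<integral>\<omega>. (g \<omega> * indicator S (\<omega> (n + k))) * (transition_within S ^^ (T_corr - 1)) (\<lambda>_. 1) (\<omega> (n + k)) \<partial>?M)"
    proof (rule integral_mono)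
      have gk: "adapted (n + k) (\<lambda>\<omega>. g \<omega> * indicator S (\<omega> (n + k)))"
        by (intro adapted_mult adapted_mono[OF gA] adapted_coordinate bfun_indicator Sm) auto
      show "integrable ?M (\<lambda>\<omega>. \<alpha> ^ (T_corr - 1) * (g \<omega> * indicator S (\<omega> (n + k))))"
        by (rule integrable_adapted[OF \<zeta> adapted_mult[OF adapted_const gk]])
      show "integrable ?M (\<lambda>\<omega>. (g \<omega> * indicator S (\<omega> (n + k))) * (transition_within S ^^ (T_corr - 1)) (\<lambda>_. 1) (\<omega> (n + k)))"
        by (intro integrable_adapted[OF \<zeta>, where n="n + k"] adapted_mult[OF gk] adapted_coordinate bfun_within_power Sm bfun_const) simp
      fix \<omega>
      show "\<alpha> ^ (T_corr - 1) * (g \<omega> * indicator S (\<omega> (n + k))) \<le>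
         (g \<omega> * indicator S (\<omega> (n + k))) * (transition_within S ^^ (T_corr - 1)) (\<lambda>_. 1) (\<omega> (n + k))"
        using within_power_le[OF Sm less_imp_le[OF \<alpha>(1)] step, of "\<omega> (n + k)" "T_corr - 1"]
        by (auto simp: g_def indicator_def)
    qed
    also have "\<dots> = (\<integral>\<omega>. (g \<omega> * indicator S (\<omega> (n + k))) * (of_bool (\<forall>i\<in>{1..T_corr - 1}. \<omega> (n + k + i) \<in> S) * 1) \<partial>?M)"
      by (rule integral_chain_within_power[symmetric, OF \<zeta> _ bfun_const Sm])
         (intro adapted_mult adapted_mono[OF gA] adapted_coordinate bfun_indicator Sm, auto)
    also have "\<dots> = (\<integral>\<omega>. indicator H \<omega> \<partial>?M)"
      by (intro Bochner_Integration.integral_cong) (auto simp: H_def g_def indicator_def)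
    also have "\<dots> = prob H" by simp
    finally have *: "\<epsilon> * prob A \<le> prob H" .
    have "H \<inter> B = {}"
    proof -
      have False if "\<omega> \<in> H" "\<omega> \<in> B" for \<omega>
      proof -
        have "decorrelated \<S> T_corr \<omega> (n + k + (T_corr - 1))"
          unfolding decorrelated_def
        proof (intro conjI bexI[of _ S] allI impI S)
          fix j assume "j < T_corr"
          then have e: "n + k + (T_corr - 1) - j = n + k + (T_corr - 1 - j)" by simp
          show "\<omega> (n + k + (T_corr - 1) - j) \<in> S"
          proof (cases "T_corr - 1 - j = 0")
            case True then show ?thesis using that(1) e by (simp add: H_def)
          next
            case False
            then have "T_corr - 1 - j \<in> {1..T_corr - 1}" by auto
            then show ?thesis using that(1) unfolding e H_def by blast
          qed
        qed simp
        moreover have "n + k + (T_corr - 1) < n + L" using T_corr by (simp add: L_def)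
        ultimately show False using that(2) unfolding B_def by blast
      qed
      then show ?thesis by blast
    qed
    moreover have "H \<subseteq> A" "B \<subseteq> A" by (auto simp: A_def B_def H_def)
    ultimately have "prob H + prob B \<le> prob A"
      by (subst finite_measure_Union[symmetric]) (auto intro: finite_measure_mono)
    with * have "prob B \<le> (1 - \<epsilon>) * prob A" by (simp add: algebra_simps)
    then show ?thesis by (simp add: A_def B_def)
  qed
  moreover have "0 < L" using T_corr by (simp add: L_def)
  ultimately show ?thesis using \<epsilon> by blast
qed

lemma decorrelation_tail:
  "\<exists>C \<rho>. 0 \<le> C \<and> 0 \<le> \<rho> \<and> \<rho> < 1 \<and> (\<forall>\<zeta>\<in>space (prob_algebra Om). \<forall>n.
     \<P>(\<omega> in chain_law Om P \<zeta>. \<forall>i<n. \<not> decorrelated \<S> T_corr \<omega> i) \<le> C * \<rho> ^ n)"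
proof -
  obtain L \<epsilon> where L: "0 < L" "0 < \<epsilon>" "\<epsilon> < 1" and step: "\<And>\<zeta> n. \<zeta> \<in> space (prob_algebra Om) \<Longrightarrow>
     \<P>(\<omega> in chain_law Om P \<zeta>. \<forall>i<n + L. \<not> decorrelated \<S> T_corr \<omega> i) \<le>
     (1 - \<epsilon>) * \<P>(\<omega> in chain_law Om P \<zeta>. \<forall>i<n. \<not> decorrelated \<S> T_corr \<omega> i)"
    using decorrelation_tail_step by blast
  obtain C \<rho> where C: "0 \<le> C" "0 \<le> \<rho>" "\<rho> < 1" "\<And>n. (1 - \<epsilon>) ^ (n div L) \<le> C * \<rho> ^ n"
    using power_div_le_geometric[of "1 - \<epsilon>" L] L by auto
  have "\<P>(\<omega> in chain_law Om P \<zeta>. \<forall>i<n. \<not> decorrelated \<S> T_corr \<omega> i) \<le> C * \<rho> ^ n"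
    if \<zeta>: "\<zeta> \<in> space (prob_algebra Om)" for \<zeta> n
  proof -
    let ?p = "\<lambda>n. \<P>(\<omega> in chain_law Om P \<zeta>. \<forall>i<n. \<not> decorrelated \<S> T_corr \<omega> i)"
    interpret prob_space "chain_law Om P \<zeta>" by (rule prob_space_chain[OF \<zeta>])
    have "?p (r + k * L) \<le> (1 - \<epsilon>) ^ k" for k r
    proof (induction k)
      case (Suc k)
      have "?p ((r + k * L) + L) \<le> (1 - \<epsilon>) * ?p (r + k * L)" by (rule step[OF \<zeta>])
      also have "\<dots> \<le> (1 - \<epsilon>) * (1 - \<epsilon>) ^ k" using L Suc by (intro mult_left_mono) auto
      also have "(r + k * L) + L = r + Suc k * L" by simp
      finally show ?case by simp
    qed simp
    from this[of "n mod L" "n div L"] have "?p n \<le> (1 - \<epsilon>) ^ (n div L)" by simp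
    then show ?thesis using C(4)[of n] by simp
  qed
  then show ?thesis using C by blast
qed

end

section \<open>Mean excess of a decorrelation step\<close>

context decorrelating_kernel
begin

text \<open>
  For a state in \<open>S\<close>, the mean \<open>\<nu>\<^sub>S(h)\<close> of the potential after dephasing.
\<close>

definition qsd_mean :: "('a \<Rightarrow> real) \<Rightarrow> 'a \<Rightarrow> real" where
  "qsd_mean h x = (\<Sum>S\<in>\<S>. indicator S x * (\<integral>y. h y \<partial>\<nu> S))"

text \<open>
  The jump of the potential when a state is replaced by a dephased sample.
\<close>

definition defect :: "('a \<Rightarrow> real) \<Rightarrow> 'a \<Rightarrow> real" where
  "defect h x = qsd_mean h x - h x"

text \<open>
  The mean jump at the end of a decorrelation step started in a given state (see
  \<open>integral_defect_at_decorrelation\<close>). Only paths that decorrelate at the earliest possible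
  time contribute, which makes it an explicit function of the state.
\<close>

definition mismatch :: "('a \<Rightarrow> real) \<Rightarrow> 'a \<Rightarrow> real" where
  "mismatch h x = (\<Sum>S\<in>\<S>. indicator S x * (transition_within S ^^ (T_corr - 1)) (defect h) x)"

lemma bfun_qsd_mean: "bfun (qsd_mean h)"
  unfolding qsd_mean_def[abs_def] by (intro bfun_sum bfun_mult bfun_indicator bfun_const S_sets)

lemma bfun_defect: "bfun h \<Longrightarrow> bfun (defect h)"
  unfolding defect_def[abs_def] by (intro bfun_diff bfun_qsd_mean)

lemma bfun_mismatch: "bfun h \<Longrightarrow> bfun (mismatch h)"
  unfolding mismatch_def[abs_def]
  by (intro bfun_sum bfun_mult bfun_indicator bfun_within_power bfun_defect S_sets)

lemma sum_indicator_S: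
  fixes c :: "'a set \<Rightarrow> real"
  assumes S: "S \<in> \<S>" and x: "x \<in> S" shows "(\<Sum>S'\<in>\<S>. indicator S' x * c S') = c S"
proof -
  have "(\<Sum>S'\<in>\<S>. indicator S' x * c S') = (\<Sum>S'\<in>\<S>. if S' = S then c S' else 0)"
  proof (intro sum.cong refl)
    fix S' assume "S' \<in> \<S>"
    from S_unique[OF S this x] x show "indicator S' x * c S' = (if S' = S then c S' else 0)"
      by (cases "x \<in> S'") auto
  qed
  also have "\<dots> = c S" using S sets_S(1) by simp
  finally show ?thesis .
qed

lemma qsd_mean_eq: "S \<in> \<S> \<Longrightarrow> x \<in> S \<Longrightarrow> qsd_mean h x = (\<integral>y. h y \<partial>\<nu> S)"
  unfolding qsd_mean_def by (rule sum_indicator_S)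

lemma integral_defect: assumes S: "S \<in> \<S>" and h: "bfun h" shows "(\<integral>y. defect h y \<partial>\<nu> S) = 0"
proof -
  interpret prob_space "\<nu> S" by (rule law_prob[OF nu_law[OF S]])
  have "(\<integral>y. qsd_mean h y \<partial>\<nu> S) = (\<integral>y. (\<integral>y. h y \<partial>\<nu> S) \<partial>\<nu> S)"
  proof (rule integral_cong_AE)
    show "AE y in \<nu> S. qsd_mean h y = (\<integral>y. h y \<partial>\<nu> S)"
      using AE_in_carrier[OF nu_law[OF S] S_sets[OF S] nu_S[OF S]]
      by eventually_elim (rule qsd_mean_eq[OF S])
    show "qsd_mean h \<in> borel_measurable (\<nu> S)"
      by (rule borel_measurable_integrable[OF integrable_bfun[OF nu_law[OF S] bfun_qsd_mean]])
  qed simp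
  then have "(\<integral>y. qsd_mean h y \<partial>\<nu> S) = (\<integral>y. h y \<partial>\<nu> S)" by (simp add: prob_space)
  then show ?thesis
    unfolding defect_def
    by (subst Bochner_Integration.integral_diff)
       (simp_all add: integrable_bfun[OF nu_law[OF S]] bfun_qsd_mean h)
qed

lemma within_power_defect:
  assumes S: "S \<in> \<S>" and h: "bfun h" and x: "x \<in> space Om"
  shows "(transition_within S ^^ T_corr) (defect h) x = 0"
  using exact_decorrelation_pointwise[OF S x] bfun_defect[OF h] integral_defect[OF S h] by fastforce

text \<open>
  If a path leaves \<open>S\<close> by its first step and then spends the \<open>T_corr\<close> positions from there on in
  another set \<open>S'\<close> of the family, it has made \<open>T_corr\<close> consecutive steps into \<open>S'\<close>, to which exact decorrelation applies.
\<close>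

lemma exit_mismatch:
  assumes S: "S \<in> \<S>" and h: "bfun h" and x: "x \<in> space Om"
  shows "transition (\<lambda>y. indicator (space Om - S) y * mismatch h y) x = 0"
proof -
  let ?w = "\<lambda>S'. (transition_within S' ^^ (T_corr - 1)) (defect h)"
  have bw: "bfun (?w S')" if "S' \<in> \<S>" for S'
    by (intro bfun_within_power bfun_defect S_sets that h)
  have "transition (\<lambda>y. indicator (space Om - S) y * mismatch h y) x =
      transition (\<lambda>y. \<Sum>S'\<in>\<S> - {S}. indicator S' y * ?w S' y) x"
  proof (rule transition_cong[OF _ x])
    fix y assume y: "y \<in> space Om"
    have "(\<Sum>S'\<in>\<S>. indicator (space Om - S) y * (indicator S' y * ?w S' y)) = (\<Sum>S'\<in>\<S> - {S}. indicator S' y * ?w S' y)"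
    proof (rule sum.mono_neutral_cong_right)
      show "\<forall>i\<in>\<S> - (\<S> - {S}). indicator (space Om - S) y * (indicator i y * ?w i y) = 0"
        by (auto simp: indicator_def)
      fix S' assume "S' \<in> \<S> - {S}"
      then show "indicator (space Om - S) y * (indicator S' y * ?w S' y) = indicator S' y * ?w S' y"
        using S_unique[of S S' y] S y by (auto simp: indicator_def)
    qed (use sets_S in auto)
    then show "indicator (space Om - S) y * mismatch h y = (\<Sum>S'\<in>\<S> - {S}. indicator S' y * ?w S' y)"
      by (simp add: mismatch_def sum_distrib_left)
  qed
  also have "\<dots> = (\<Sum>S'\<in>\<S> - {S}. transition (\<lambda>y. indicator S' y * ?w S' y) x)"
    by (intro transition_sum x bfun_mult bfun_indicator bw S_sets) auto
  also have "\<dots> = (\<Sum>S'\<in>\<S> - {S}. (transition_within S' ^^ T_corr) (defect h) x)"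
  proof (intro sum.cong refl)
    fix S' assume "S' \<in> \<S> - {S}"
    have "(transition_within S' ^^ T_corr) (defect h) = transition_within S' (?w S')"
      using T_corr by (cases T_corr) auto
    then show "transition (\<lambda>y. indicator S' y * ?w S' y) x = (transition_within S' ^^ T_corr) (defect h) x"
      by (simp add: transition_within_def)
  qed
  also have "\<dots> = 0" using within_power_defect[OF _ h x] by simp
  finally show ?thesis .
qed

lemma of_bool_decorrelated_first:
  assumes l: "l = T_corr - 1"
  shows "(of_bool (decorrelated \<S> T_corr \<omega> l) :: real) =
    (\<Sum>S\<in>\<S>. indicator S (\<omega> 0) * of_bool (\<forall>i\<in>{1..T_corr - 1}. \<omega> (0 + i) \<in> S))"
proof -
  have iff: "(\<forall>j<T_corr. \<omega> (l - j) \<in> S) \<longleftrightarrow> \<omega> 0 \<in> S \<and> (\<forall>i\<in>{1..T_corr - 1}. \<omega> (0 + i) \<in> S)" for S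
  proof (intro iffI conjI ballI allI impI)
    assume *: "\<forall>j<T_corr. \<omega> (l - j) \<in> S"
    show "\<omega> 0 \<in> S" using *[rule_format, of l] l T_corr by simp
    fix i assume i: "i \<in> {1..T_corr - 1}"
    then have "l - i < T_corr" "l - (l - i) = i" using l T_corr by auto
    then show "\<omega> (0 + i) \<in> S" using *[rule_format, of "l - i"] by (simp only: add_0)
  next
    fix j assume *: "\<omega> 0 \<in> S \<and> (\<forall>i\<in>{1..T_corr - 1}. \<omega> (0 + i) \<in> S)" "j < T_corr"
    show "\<omega> (l - j) \<in> S"
    proof (cases "l - j = 0")
      case False
      then have "l - j \<in> {1..T_corr - 1}" using l by auto
      from bspec[OF conjunct2[OF *(1)] this] show ?thesis by simp
    qed (use * in simp)
  qed
  show ?thesis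
  proof (cases "\<exists>S\<in>\<S>. \<forall>j<T_corr. \<omega> (l - j) \<in> S")
    case True
    then obtain S where S: "S \<in> \<S>" "\<forall>j<T_corr. \<omega> (l - j) \<in> S" by blast
    then have "\<omega> 0 \<in> S" "\<forall>i\<in>{1..T_corr - 1}. \<omega> (0 + i) \<in> S" using iff by blast+
    with sum_indicator_S[OF S(1), of "\<omega> 0" "\<lambda>S. of_bool (\<forall>i\<in>{1..T_corr - 1}. \<omega> (0 + i) \<in> S)"] True l
    show ?thesis by (simp add: decorrelated_def)
  next
    case False
    then have "indicator S (\<omega> 0) * of_bool (\<forall>i\<in>{1..T_corr - 1}. \<omega> (0 + i) \<in> S) = (0::real)" if "S \<in> \<S>" for S
      using that iff[of S] by (auto simp: indicator_def)
    then have "(\<Sum>S\<in>\<S>. indicator S (\<omega> 0) * of_bool (\<forall>i\<in>{1..T_corr - 1}. \<omega> (0 + i) \<in> S)) = (0::real)"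
      by (intro sum.neutral ballI)
    moreover have "\<not> decorrelated \<S> T_corr \<omega> l" using False unfolding decorrelated_def by blast
    ultimately show ?thesis by (simp only: of_bool_eq(1))
  qed
qed

text \<open>
  Decorrelation later than at the earliest possible time is preceded by an entrance into the set \<open>S\<close>
  in which it takes place: if \<open>X\<^sub>m\<close> were in \<open>S\<close> as well, the path would have decorrelated one step
  earlier.
\<close>

lemma decorrelated_first_time_iff:
  assumes S: "S \<in> \<S>" and first: "\<forall>i\<le>m. \<not> decorrelated \<S> T_corr \<omega> i"
    and in_S: "\<omega> (m + T_corr) \<in> S"
  shows "(\<forall>i<m + T_corr. \<not> decorrelated \<S> T_corr \<omega> i) \<and> decorrelated \<S> T_corr \<omega> (m + T_corr) \<longleftrightarrow>
     \<omega> m \<notin> S \<and> (\<forall>i\<in>{1..T_corr}. \<omega> (m + i) \<in> S)"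
proof (intro iffI conjI; (elim conjE)?)
  assume no: "\<forall>i<m + T_corr. \<not> decorrelated \<S> T_corr \<omega> i" and yes: "decorrelated \<S> T_corr \<omega> (m + T_corr)"
  obtain S' where S': "S' \<in> \<S>" "\<And>j. j < T_corr \<Longrightarrow> \<omega> (m + T_corr - j) \<in> S'"
    using yes by (auto simp: decorrelated_def)
  have "S' = S" using S'(2)[of 0] T_corr S_unique[OF S S'(1) in_S] by simp
  then show stay: "\<forall>i\<in>{1..T_corr}. \<omega> (m + i) \<in> S"
  proof (intro ballI)
    fix i assume "i \<in> {1..T_corr}"
    then show "\<omega> (m + i) \<in> S" using S'(2)[of "T_corr - i"] \<open>S' = S\<close> by simp
  qed
  show "\<omega> m \<notin> S"
  proof
    assume m: "\<omega> m \<in> S"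
    have "decorrelated \<S> T_corr \<omega> (m + (T_corr - 1))"
      unfolding decorrelated_def
    proof (intro conjI bexI[of _ S] allI impI S)
      fix j assume j: "j < T_corr"
      then have e: "m + (T_corr - 1) - j = m + (T_corr - 1 - j)" by simp
      show "\<omega> (m + (T_corr - 1) - j) \<in> S"
      proof (cases "T_corr - 1 - j = 0")
        case True
        show ?thesis unfolding e True using m by simp
      next
        case False
        then have "T_corr - 1 - j \<in> {1..T_corr}" by auto
        from bspec[OF stay this] show ?thesis unfolding e .
      qed
    qed simp
    moreover have "m + (T_corr - 1) < m + T_corr" using T_corr by simp
    ultimately show False using no by blast
  qed
next
  assume m: "\<omega> m \<notin> S" and stay: "\<forall>i\<in>{1..T_corr}. \<omega> (m + i) \<in> S"
  show "decorrelated \<S> T_corr \<omega> (m + T_corr)"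
    unfolding decorrelated_def
  proof (intro conjI bexI[of _ S] allI impI S)
    fix j assume j: "j < T_corr"
    then have "T_corr - j \<in> {1..T_corr}" "m + T_corr - j = m + (T_corr - j)" by auto
    then show "\<omega> (m + T_corr - j) \<in> S" using stay by metis
  qed simp
  show "\<forall>i<m + T_corr. \<not> decorrelated \<S> T_corr \<omega> i"
  proof (intro allI impI notI)
    fix i assume i: "i < m + T_corr" and d: "decorrelated \<S> T_corr \<omega> i"
    then have im: "m < i" using first by (metis not_le_imp_less)
    obtain S' where S': "S' \<in> \<S>" "\<And>j. j < T_corr \<Longrightarrow> \<omega> (i - j) \<in> S'"
      using d by (auto simp: decorrelated_def)
    have "\<omega> (m + 1) \<in> S'" using S'(2)[of "i - (m + 1)"] i im by simp
    moreover have "\<omega> (m + 1) \<in> S" using T_corr by (intro bspec[OF stay]) simp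
    ultimately have "S' = S" using S_unique S S'(1) by metis
    moreover have "\<omega> m \<in> S'" using S'(2)[of "i - m"] i im by simp
    ultimately show False using m by simp
  qed
qed

text \<open>
  Decomposition according to the time of decorrelation. Times before \<open>T_corr - 1\<close> are impossible, and
  the time \<open>T_corr - 1\<close> yields \<open>mismatch\<close>. For a later time \<open>m + T_corr\<close>, the event is that the path has
  not decorrelated up to time \<open>m\<close> and then makes \<open>T_corr\<close> steps into \<open>S\<close>; exact decorrelation at time
  \<open>m\<close> shows that the position is then distributed as \<open>\<nu>\<^sub>S\<close>, under which the jump has mean zero.
\<close>

lemma integral_defect_at_decorrelation:
  assumes h: "bfun h" and x: "x \<in> space Om"
  shows "(\<integral>\<omega>. defect h (\<omega> (decorrelation_time \<omega>)) \<partial>chain_law Om P (return Om x)) = mismatch h x"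
proof -
  let ?\<zeta> = "return Om x" let ?M = "chain_law Om P ?\<zeta>" let ?u = "defect h"
  let ?D = "decorrelated \<S> T_corr"
  have \<zeta>: "?\<zeta> \<in> space (prob_algebra Om)" by (rule return_in_prob_algebra[OF x])
  have u: "bfun ?u" by (rule bfun_defect[OF h])
  interpret prob_space ?M by (rule prob_space_chain[OF \<zeta>])
  have [measurable_cong]: "sets ?M = sets paths" by (rule sets_chain[OF \<zeta>])
  obtain C \<rho> where C: "0 \<le> \<rho>" "\<rho> < 1" and tail: "\<And>n. prob {\<omega>\<in>space ?M. \<forall>i<n. \<not> ?D \<omega> i} \<le> C * \<rho> ^ n"
    using decorrelation_tail \<zeta> by blast
  obtain B where B: "\<And>y. y \<in> space Om \<Longrightarrow> \<bar>?u y\<bar> \<le> B" using bfun_bound[OF u] by blast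
  have [measurable]: "?u \<in> borel_measurable Om" by (rule bfun_measurable[OF u])
  define term_l where "term_l l = (\<integral>\<omega>. of_bool (\<forall>i<l. \<not> ?D \<omega> i) * (of_bool (?D \<omega> l) * ?u (\<omega> l)) \<partial>?M)" for l
  have sums: "term_l sums (\<integral>\<omega>. ?u (\<omega> (decorrelation_time \<omega>)) \<partial>?M)"
    unfolding term_l_def[abs_def] decorrelation_time_def
  proof (rule geometric_stopping_value[OF _ tail C])
    show "\<bar>?u (\<omega> n)\<bar> \<le> B" if "\<omega> \<in> space ?M" for \<omega> n
      using that by (intro B) (simp add: space_chain[OF \<zeta>] space_PiM PiE_iff)
  qed measurable
  have early: "term_l l = 0" if "l < T_corr - 1" for l
  proof -
    have "\<not> l + 1 \<ge> T_corr" using that by linarith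
    then have "\<not> ?D \<omega> l" for \<omega> unfolding decorrelated_def by blast
    then show ?thesis by (simp add: term_l_def)
  qed
  have first: "term_l (T_corr - 1) = mismatch h x"
  proof -
    let ?l = "T_corr - 1"
    let ?G = "\<lambda>S \<omega>. indicator S (\<omega> 0) * (of_bool (\<forall>i\<in>{1..?l}. \<omega> (0 + i) \<in> S) * ?u (\<omega> (0 + ?l)))"
    have "\<not> i + 1 \<ge> T_corr" if "i < ?l" for i using that by linarith
    then have "\<not> ?D \<omega> i" if "i < ?l" for \<omega> i using that unfolding decorrelated_def by blast
    then have "term_l ?l = (\<integral>\<omega>. of_bool (?D \<omega> ?l) * ?u (\<omega> ?l) \<partial>?M)"
      by (simp add: term_l_def)
    also have "\<dots> = (\<integral>\<omega>. (\<Sum>S\<in>\<S>. ?G S \<omega>) \<partial>?M)"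
      by (simp only: of_bool_decorrelated_first[OF refl] sum_distrib_right mult.assoc add_0)
    also have "\<dots> = (\<Sum>S\<in>\<S>. \<integral>\<omega>. ?G S \<omega> \<partial>?M)"
    proof (rule Bochner_Integration.integral_sum)
      fix S assume S: "S \<in> \<S>"
      have [measurable]: "S \<in> sets Om" by (rule S_sets[OF S])
      have "adapted ?l (\<lambda>\<omega>. of_bool (\<forall>i\<in>{1..?l}. \<omega> (0 + i) \<in> S))"
        by (rule adapted_of_bool) auto
      then have "adapted ?l (?G S)"
        by (intro adapted_mult adapted_coordinate bfun_indicator u S_sets[OF S]) auto
      then show "integrable ?M (?G S)" by (rule integrable_adapted[OF \<zeta>])
    qed
    also have "\<dots> = mismatch h x"
      unfolding mismatch_def
    proof (intro sum.cong refl)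
      fix S assume S: "S \<in> \<S>"
      have "(\<integral>\<omega>. ?G S \<omega> \<partial>?M) = (\<integral>\<omega>. indicator S (\<omega> 0) * (transition_within S ^^ ?l) ?u (\<omega> 0) \<partial>?M)"
        by (intro integral_chain_within_power \<zeta> u adapted_coordinate bfun_indicator S_sets[OF S]) auto
      also have "\<dots> = (\<integral>y. indicator S y * (transition_within S ^^ ?l) ?u y \<partial>?\<zeta>)"
        by (intro integral_chain_start[OF \<zeta>] bfun_mult bfun_within_power u bfun_indicator S_sets[OF S])
      also have "\<dots> = indicator S x * (transition_within S ^^ ?l) ?u x"
        by (intro integral_return_bfun[OF x] bfun_mult bfun_within_power u bfun_indicator S_sets[OF S])
      finally show "(\<integral>\<omega>. ?G S \<omega> \<partial>?M) = indicator S x * (transition_within S ^^ ?l) ?u x" .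
    qed
    finally show ?thesis .
  qed
  have late: "term_l (m + T_corr) = 0" for m
  proof -
    let ?g = "\<lambda>S \<omega>. of_bool (\<forall>i\<le>m. \<not> ?D \<omega> i) * indicator (space Om - S) (\<omega> m)"
    let ?G = "\<lambda>S \<omega>. ?g S \<omega> * (of_bool (\<forall>i\<in>{1..T_corr}. \<omega> (m + i) \<in> S) * ?u (\<omega> (m + T_corr)))"
    have g: "adapted m (?g S)" if S: "S \<in> \<S>" for S
    proof (intro adapted_mult adapted_coordinate bfun_indicator)
      show "adapted m (\<lambda>\<omega>. of_bool (\<forall>i\<le>m. \<not> ?D \<omega> i))" by (rule adapted_not_decorrelated)
      show "space Om - S \<in> sets Om" using S_sets[OF S] by auto
    qed simp
    have "term_l (m + T_corr) = (\<integral>\<omega>. (\<Sum>S\<in>\<S>. ?G S \<omega>) \<partial>?M)"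
      unfolding term_l_def
    proof (intro Bochner_Integration.integral_cong refl)
      fix \<omega> assume "\<omega> \<in> space ?M"
      then have sp: "\<omega> i \<in> space Om" for i by (simp add: space_chain[OF \<zeta>] space_PiM PiE_iff)
      let ?l = "m + T_corr"
      \<comment> \<open>at most one summand is not zero: the one of the set that contains the last position\<close>
      have last: "?G S \<omega> = 0" if "\<omega> ?l \<notin> S" for S
      proof -
        have "\<not> (\<forall>i\<in>{1..T_corr}. \<omega> (m + i) \<in> S)" using that T_corr by auto
        then show ?thesis by (simp only: of_bool_eq(1) mult_zero_left mult_zero_right)
      qed
      show "of_bool (\<forall>i<?l. \<not> ?D \<omega> i) * (of_bool (?D \<omega> ?l) * ?u (\<omega> ?l)) = (\<Sum>S\<in>\<S>. ?G S \<omega>)"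
      proof (cases "(\<forall>i\<le>m. \<not> ?D \<omega> i) \<and> (\<exists>S\<in>\<S>. \<omega> ?l \<in> S)")
        case True
        then obtain S where S: "S \<in> \<S>" "\<omega> ?l \<in> S" by blast
        have "(\<Sum>S'\<in>\<S>. ?G S' \<omega>) = (\<Sum>S'\<in>\<S>. indicator S' (\<omega> ?l) * ?G S' \<omega>)"
        proof (intro sum.cong refl)
          fix S'
          show "?G S' \<omega> = indicator S' (\<omega> ?l) * ?G S' \<omega>"
            using last[of S'] by (cases "\<omega> ?l \<in> S'") simp_all
        qed
        also have "\<dots> = ?G S \<omega>" by (rule sum_indicator_S[OF S])
        also have "\<dots> = of_bool (\<omega> m \<notin> S \<and> (\<forall>i\<in>{1..T_corr}. \<omega> (m + i) \<in> S)) * ?u (\<omega> ?l)"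
          using True sp[of m] by (auto simp: indicator_def)
        also have "\<dots> = of_bool ((\<forall>i<?l. \<not> ?D \<omega> i) \<and> ?D \<omega> ?l) * ?u (\<omega> ?l)"
          using decorrelated_first_time_iff[OF S(1) conjunct1[OF True] S(2)] by (simp only:)
        finally show ?thesis by (simp add: of_bool_conj mult.assoc)
      next
        case False
        have "of_bool (\<forall>i<?l. \<not> ?D \<omega> i) * (of_bool (?D \<omega> ?l) * ?u (\<omega> ?l)) = 0"
        proof (rule ccontr)
          assume "\<not> ?thesis"
          then have *: "\<forall>i<?l. \<not> ?D \<omega> i" "?D \<omega> ?l" by (auto split: if_splits)
          have "\<forall>i\<le>m. \<not> ?D \<omega> i" using *(1) T_corr by simp
          moreover obtain S where "S \<in> \<S>" "\<forall>j<T_corr. \<omega> (?l - j) \<in> S" using *(2) unfolding decorrelated_def by blast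
          then have "\<exists>S\<in>\<S>. \<omega> ?l \<in> S" using T_corr by (intro bexI[of _ S]) (auto dest: spec[of _ 0])
          ultimately show False using False by blast
        qed
        moreover have "?G S \<omega> = 0" if "S \<in> \<S>" for S
        proof (cases "\<forall>i\<le>m. \<not> ?D \<omega> i")
          case True
          then have "\<omega> ?l \<notin> S" using False that by blast
          then show ?thesis by (rule last)
        next
          case no: False
          show ?thesis by (simp only: no of_bool_eq(1) mult_zero_left)
        qed
        then have "(\<Sum>S\<in>\<S>. ?G S \<omega>) = 0" by (intro sum.neutral ballI)
        ultimately show ?thesis by (simp only:)
      qed
    qed
    also have "\<dots> = (\<Sum>S\<in>\<S>. \<integral>\<omega>. ?G S \<omega> \<partial>?M)"
    proof (rule Bochner_Integration.integral_sum)
      fix S assume S: "S \<in> \<S>"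
      have [measurable]: "S \<in> sets Om" by (rule S_sets[OF S])
      have "adapted (m + T_corr) (\<lambda>\<omega>. of_bool (\<forall>i\<in>{1..T_corr}. \<omega> (m + i) \<in> S))"
        by (rule adapted_of_bool) auto
      then have "adapted (m + T_corr) (?G S)"
        by (intro adapted_mult[of _ "?g S"] adapted_mono[OF g[OF S]] adapted_mult[of _ "\<lambda>\<omega>. of_bool (\<forall>i\<in>{1..T_corr}. \<omega> (m + i) \<in> S)"] adapted_coordinate u) auto
      then show "integrable ?M (?G S)" by (rule integrable_adapted[OF \<zeta>])
    qed
    also have "\<dots> = (\<Sum>S\<in>\<S>. 0)"
    proof (intro sum.cong refl)
      fix S assume S: "S \<in> \<S>"
      have "(\<integral>\<omega>. ?G S \<omega> \<partial>?M) = (\<integral>\<omega>. ?g S \<omega> * (transition_within S ^^ T_corr) ?u (\<omega> m) \<partial>?M)"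
        by (rule integral_chain_within_power[OF \<zeta> g[OF S] u S_sets[OF S]])
      also have "\<dots> = (\<integral>\<omega>. 0 \<partial>?M)"
      proof (intro Bochner_Integration.integral_cong refl)
        fix \<omega> assume "\<omega> \<in> space ?M"
        then have sp: "\<omega> m \<in> space Om" by (simp add: space_chain[OF \<zeta>] space_PiM PiE_iff)
        show "?g S \<omega> * (transition_within S ^^ T_corr) ?u (\<omega> m) = 0"
          unfolding within_power_defect[OF S h sp] by simp
      qed
      finally show "(\<integral>\<omega>. ?G S \<omega> \<partial>?M) = 0" by simp
    qed
    finally show ?thesis by simp
  qed
  have "term_l = (\<lambda>l. if l = T_corr - 1 then mismatch h x else 0)"
  proof (rule ext)
    fix l
    show "term_l l = (if l = T_corr - 1 then mismatch h x else 0)"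
    proof (cases "l < T_corr")
      case True
      then show ?thesis using early[of l] first by auto
    next
      case False
      then show ?thesis using late[of "l - T_corr"] T_corr by auto
    qed
  qed
  then have "term_l sums mismatch h x" using sums_single[of "T_corr - 1" "\<lambda>_. mismatch h x"] by (simp only:)
  then show ?thesis using sums sums_unique2 by blast
qed

text \<open>
  On the event, determined by the past, that the path has not yet decorrelated at time \<open>l\<close>, the
  Poisson equation identifies the mean of \<open>\<phi>(X\<^sub>l\<^sub>+\<^sub>1)\<close> with that of \<open>h(X\<^sub>l) - h(X\<^sub>l\<^sub>+\<^sub>1)\<close>. The sum of the latter
  telescopes to \<open>h(x) - h(X\<^sub>\<sigma>)\<close>, and the jump at \<open>X\<^sub>\<sigma>\<close> is compensated by \<open>mismatch\<close>.
\<close>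

lemma decorrelation_increment:
  assumes h: "bfun h" and \<phi>: "bfun \<phi>" and poisson: "\<And>x. x \<in> space Om \<Longrightarrow> h x - transition h x = transition \<phi> x"
  defines "Z \<equiv> \<lambda>x \<omega>. (\<Sum>l<decorrelation_time \<omega>. \<phi> (\<omega> (Suc l))) + qsd_mean h (\<omega> (decorrelation_time \<omega>)) - (h x + mismatch h x)"
  shows "\<exists>C. \<forall>x\<in>space Om. integrable (chain_law Om P (return Om x)) (Z x) \<and>
    (\<integral>\<omega>. Z x \<omega> \<partial>chain_law Om P (return Om x)) = 0 \<and>
    (\<integral>\<^sup>+\<omega>. ennreal ((Z x \<omega>)\<^sup>2) \<partial>chain_law Om P (return Om x)) \<le> ennreal C"
proof -
  let ?D = "decorrelated \<S> T_corr" let ?\<sigma> = decorrelation_time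
  obtain C \<rho> where C: "0 \<le> C" "0 \<le> \<rho>" "\<rho> < 1" and tail: "\<And>\<zeta> n. \<zeta> \<in> space (prob_algebra Om) \<Longrightarrow>
    \<P>(\<omega> in chain_law Om P \<zeta>. \<forall>i<n. \<not> ?D \<omega> i) \<le> C * \<rho> ^ n"
    using decorrelation_tail by blast
  obtain b where b: "0 < b" "\<And>y. y \<in> space Om \<Longrightarrow> \<bar>\<phi> y\<bar> \<le> b" using bfun_bound[OF \<phi>] by blast
  obtain bh where bh: "0 < bh" "\<And>y. y \<in> space Om \<Longrightarrow> \<bar>h y\<bar> \<le> bh" using bfun_bound[OF h] by blast
  obtain bq where bq: "0 < bq" "\<And>y. y \<in> space Om \<Longrightarrow> \<bar>qsd_mean h y\<bar> \<le> bq" using bfun_bound[OF bfun_qsd_mean] by blast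
  obtain bm where bm: "0 < bm" "\<And>y. y \<in> space Om \<Longrightarrow> \<bar>mismatch h y\<bar> \<le> bm" using bfun_bound[OF bfun_mismatch[OF h]] by blast
  have [measurable]: "\<phi> \<in> borel_measurable Om" "h \<in> borel_measurable Om" "qsd_mean h \<in> borel_measurable Om"
    "transition h \<in> borel_measurable Om" "defect h \<in> borel_measurable Om"
    by (intro bfun_measurable \<phi> h bfun_qsd_mean bfun_transition bfun_defect)+
  define b' where "b' = bq + bh + bm"
  define K where "K = 2 * b\<^sup>2 * (2 * C / (1 - \<rho>)\<^sup>2) + 2 * b'\<^sup>2"
  have "integrable (chain_law Om P (return Om x)) (Z x) \<and> (\<integral>\<omega>. Z x \<omega> \<partial>chain_law Om P (return Om x)) = 0 \<and>
    (\<integral>\<^sup>+\<omega>. ennreal ((Z x \<omega>)\<^sup>2) \<partial>chain_law Om P (return Om x)) \<le> ennreal K" if x: "x \<in> space Om" for x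
  proof -
    let ?\<zeta> = "return Om x" let ?M = "chain_law Om P ?\<zeta>"
    have \<zeta>: "?\<zeta> \<in> space (prob_algebra Om)" by (rule return_in_prob_algebra[OF x])
    interpret prob_space ?M by (rule prob_space_chain[OF \<zeta>])
    have [measurable_cong]: "sets ?M = sets paths" by (rule sets_chain[OF \<zeta>])
    have sp: "\<omega> i \<in> space Om" if "\<omega> \<in> space ?M" for \<omega> i
      using that by (simp add: space_chain[OF \<zeta>] space_PiM PiE_iff)
    have D[measurable]: "Measurable.pred ?M (\<lambda>\<omega>. ?D \<omega> n)" for n by measurable
    have \<sigma>m[measurable]: "?\<sigma> \<in> ?M \<rightarrow>\<^sub>M count_space UNIV" unfolding decorrelation_time_def[abs_def] by measurable
    have at\<sigma>: "(\<lambda>\<omega>. \<psi> (\<omega> (?\<sigma> \<omega>))) \<in> borel_measurable ?M" if [measurable]: "\<psi> \<in> borel_measurable Om" for \<psi> :: "'a \<Rightarrow> real"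
      by (rule measurable_compose_countable[OF _ \<sigma>m]) measurable
    have int\<sigma>: "integrable ?M (\<lambda>\<omega>. \<psi> (\<omega> (?\<sigma> \<omega>)))" if \<psi>: "bfun \<psi>" for \<psi>
    proof -
      obtain B where B: "\<And>y. y \<in> space Om \<Longrightarrow> \<bar>\<psi> y\<bar> \<le> B" using bfun_bound[OF \<psi>] by blast
      show ?thesis
        by (rule integrable_const_bound[of _ B, OF AE_I2 at\<sigma>[OF bfun_measurable[OF \<psi>]]]) (simp add: B sp)
    qed
    have sum_facts: "integrable ?M (\<lambda>\<omega>. \<Sum>l<?\<sigma> \<omega>. a l \<omega>)"
      "(\<lambda>l. \<integral>\<omega>. of_bool (\<forall>i\<le>l. \<not> ?D \<omega> i) * a l \<omega> \<partial>?M) sums (\<integral>\<omega>. (\<Sum>l<?\<sigma> \<omega>. a l \<omega>) \<partial>?M)"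
      if "\<And>n. a n \<in> borel_measurable ?M" "\<And>n \<omega>. \<omega> \<in> space ?M \<Longrightarrow> \<bar>a n \<omega>\<bar> \<le> B" for a :: "nat \<Rightarrow> (nat \<Rightarrow> 'a) \<Rightarrow> real" and B
      unfolding decorrelation_time_def
      by (rule geometric_stopping_sum_upto[OF D tail[OF \<zeta>] C(2,3) that], assumption)+
    let ?a = "\<lambda>l \<omega>. \<phi> (\<omega> (Suc l))"
    let ?a' = "\<lambda>l \<omega>. h (\<omega> l) - h (\<omega> (Suc l))"
    have a: "?a n \<in> borel_measurable ?M" "?a' n \<in> borel_measurable ?M" for n by measurable
    have ab: "\<bar>?a n \<omega>\<bar> \<le> b" "\<bar>?a' n \<omega>\<bar> \<le> 2 * bh" if "\<omega> \<in> space ?M" for n \<omega>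
      using b(2)[OF sp[OF that, of "Suc n"]] bh(2)[OF sp[OF that, of n]] bh(2)[OF sp[OF that, of "Suc n"]] by linarith+
    have eq: "(\<integral>\<omega>. of_bool (\<forall>i\<le>l. \<not> ?D \<omega> i) * ?a l \<omega> \<partial>?M) = (\<integral>\<omega>. of_bool (\<forall>i\<le>l. \<not> ?D \<omega> i) * ?a' l \<omega> \<partial>?M)" for l
    proof -
      let ?g = "\<lambda>\<omega>. of_bool (\<forall>i\<le>l. \<not> ?D \<omega> i) :: real"
      have g: "adapted l ?g" by (rule adapted_not_decorrelated)
      have "(\<integral>\<omega>. ?g \<omega> * ?a l \<omega> \<partial>?M) = (\<integral>\<omega>. ?g \<omega> * transition \<phi> (\<omega> l) \<partial>?M)"
        by (rule integral_chain_step[OF \<zeta> g \<phi>])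
      also have "\<dots> = (\<integral>\<omega>. ?g \<omega> * h (\<omega> l) - ?g \<omega> * transition h (\<omega> l) \<partial>?M)"
      proof (intro Bochner_Integration.integral_cong refl)
        fix \<omega> assume "\<omega> \<in> space ?M"
        from poisson[OF sp[OF this, of l]]
        show "?g \<omega> * transition \<phi> (\<omega> l) = ?g \<omega> * h (\<omega> l) - ?g \<omega> * transition h (\<omega> l)"
          by (simp add: right_diff_distrib[symmetric])
      qed
      also have "\<dots> = (\<integral>\<omega>. ?g \<omega> * h (\<omega> l) \<partial>?M) - (\<integral>\<omega>. ?g \<omega> * transition h (\<omega> l) \<partial>?M)"
        by (rule Bochner_Integration.integral_diff)
           (rule integrable_adapted[OF \<zeta> adapted_mult[OF g adapted_coordinate]]; (intro h bfun_transition le_refl))+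
      also have "(\<integral>\<omega>. ?g \<omega> * transition h (\<omega> l) \<partial>?M) = (\<integral>\<omega>. ?g \<omega> * h (\<omega> (Suc l)) \<partial>?M)"
        by (rule integral_chain_step[OF \<zeta> g h, symmetric])
      also have "(\<integral>\<omega>. ?g \<omega> * h (\<omega> l) \<partial>?M) - (\<integral>\<omega>. ?g \<omega> * h (\<omega> (Suc l)) \<partial>?M) = (\<integral>\<omega>. ?g \<omega> * h (\<omega> l) - ?g \<omega> * h (\<omega> (Suc l)) \<partial>?M)"
      proof (rule Bochner_Integration.integral_diff[symmetric])
        show "integrable ?M (\<lambda>\<omega>. ?g \<omega> * h (\<omega> l))"
          by (rule integrable_adapted[OF \<zeta> adapted_mult[OF g adapted_coordinate[OF h le_refl]]])
        show "integrable ?M (\<lambda>\<omega>. ?g \<omega> * h (\<omega> (Suc l)))"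
          by (rule integrable_adapted[OF \<zeta> adapted_mult[OF adapted_mono[OF g] adapted_coordinate[OF h le_refl]]]) simp
      qed
      finally show ?thesis by (simp only: right_diff_distrib)
    qed
    have "(\<integral>\<omega>. (\<Sum>l<?\<sigma> \<omega>. ?a l \<omega>) \<partial>?M) = (\<integral>\<omega>. (\<Sum>l<?\<sigma> \<omega>. ?a' l \<omega>) \<partial>?M)"
    proof (rule sums_unique2)
      let ?e = "\<lambda>l. \<integral>\<omega>. of_bool (\<forall>i\<le>l. \<not> ?D \<omega> i) * ?a' l \<omega> \<partial>?M"
      show "?e sums (\<integral>\<omega>. (\<Sum>l<?\<sigma> \<omega>. ?a l \<omega>) \<partial>?M)"
        unfolding eq[symmetric] by (rule sum_facts(2)[of ?a b]) (rule a ab(1), assumption?)+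
      show "?e sums (\<integral>\<omega>. (\<Sum>l<?\<sigma> \<omega>. ?a' l \<omega>) \<partial>?M)"
        by (rule sum_facts(2)[of ?a' "2 * bh"]) (rule a ab(2), assumption?)+
    qed
    also have "\<dots> = (\<integral>\<omega>. h (\<omega> 0) - h (\<omega> (?\<sigma> \<omega>)) \<partial>?M)"
      by (simp only: sum_lessThan_telescope'[of "\<lambda>l. h (\<omega> l)" for \<omega>])
    also have "\<dots> = (\<integral>\<omega>. h (\<omega> 0) \<partial>?M) - (\<integral>\<omega>. h (\<omega> (?\<sigma> \<omega>)) \<partial>?M)"
      by (rule Bochner_Integration.integral_diff[OF integrable_adapted[OF \<zeta> adapted_coordinate[OF h le_refl]] int\<sigma>[OF h]])
    also have "(\<integral>\<omega>. h (\<omega> 0) \<partial>?M) = h x"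
      unfolding integral_chain_start[OF \<zeta> h] by (rule integral_return_bfun[OF x h])
    finally have A: "(\<integral>\<omega>. (\<Sum>l<?\<sigma> \<omega>. ?a l \<omega>) \<partial>?M) = h x - (\<integral>\<omega>. h (\<omega> (?\<sigma> \<omega>)) \<partial>?M)" .
    have "mismatch h x = (\<integral>\<omega>. qsd_mean h (\<omega> (?\<sigma> \<omega>)) - h (\<omega> (?\<sigma> \<omega>)) \<partial>?M)"
      using integral_defect_at_decorrelation[OF h x] by (simp only: defect_def)
    also have "\<dots> = (\<integral>\<omega>. qsd_mean h (\<omega> (?\<sigma> \<omega>)) \<partial>?M) - (\<integral>\<omega>. h (\<omega> (?\<sigma> \<omega>)) \<partial>?M)"
      by (rule Bochner_Integration.integral_diff[OF int\<sigma>[OF bfun_qsd_mean] int\<sigma>[OF h]])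
    finally have W: "mismatch h x = (\<integral>\<omega>. qsd_mean h (\<omega> (?\<sigma> \<omega>)) \<partial>?M) - (\<integral>\<omega>. h (\<omega> (?\<sigma> \<omega>)) \<partial>?M)" .
    have i1: "integrable ?M (\<lambda>\<omega>. \<Sum>l<?\<sigma> \<omega>. ?a l \<omega>)" by (rule sum_facts(1)[of ?a b]) (rule a ab(1), assumption?)+
    have iZ: "integrable ?M (Z x)"
      unfolding Z_def by (intro Bochner_Integration.integrable_diff Bochner_Integration.integrable_add i1 int\<sigma> bfun_qsd_mean integrable_const)
    have "(\<integral>\<omega>. Z x \<omega> \<partial>?M) = (\<integral>\<omega>. (\<Sum>l<?\<sigma> \<omega>. ?a l \<omega>) \<partial>?M) + (\<integral>\<omega>. qsd_mean h (\<omega> (?\<sigma> \<omega>)) \<partial>?M) - (h x + mismatch h x)"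
      unfolding Z_def using i1 int\<sigma>[OF bfun_qsd_mean, of h] by (simp add: prob_space)
    then have Z0: "(\<integral>\<omega>. Z x \<omega> \<partial>?M) = 0" using A W by simp
    have Zb: "\<bar>Z x \<omega>\<bar> \<le> b * real (?\<sigma> \<omega>) + b'" if \<omega>: "\<omega> \<in> space ?M" for \<omega>
    proof -
      have "\<bar>\<Sum>l<?\<sigma> \<omega>. ?a l \<omega>\<bar> \<le> (\<Sum>l<?\<sigma> \<omega>. \<bar>?a l \<omega>\<bar>)" by (rule sum_abs)
      also have "\<dots> \<le> (\<Sum>l<?\<sigma> \<omega>. b)" by (rule sum_mono) (rule ab(1)[OF \<omega>])
      finally have "\<bar>\<Sum>l<?\<sigma> \<omega>. ?a l \<omega>\<bar> \<le> b * real (?\<sigma> \<omega>)" by (simp add: mult.commute)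
      then show ?thesis
        using bq(2)[OF sp[OF \<omega>, of "?\<sigma> \<omega>"]] bh(2)[OF x] bm(2)[OF x] unfolding Z_def b'_def by linarith
    qed
    have "(\<integral>\<^sup>+\<omega>. ennreal ((real (?\<sigma> \<omega>))\<^sup>2) \<partial>?M) \<le> ennreal (2 * C / (1 - \<rho>)\<^sup>2)"
      unfolding decorrelation_time_def by (rule geometric_stopping_square[OF D tail[OF \<zeta>] C(2,3,1)])
    then have "(\<integral>\<^sup>+\<omega>. ennreal ((Z x \<omega>)\<^sup>2) \<partial>?M) \<le> ennreal K"
      unfolding K_def by (rule second_moment_le_affine[OF \<sigma>m _ _ Zb]) (use C in simp)
    then show ?thesis using iZ Z0 by blast
  qed
  then show ?thesis by blast
qed

end

section \<open>Reading the replicas one poll at a time\<close>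

lemma integral_PiM_prod:
  fixes f :: "'i \<Rightarrow> 'a \<Rightarrow> real"
  assumes I: "finite I" and M: "\<And>i. i \<in> I \<Longrightarrow> prob_space (M i)" and f: "\<And>i. i \<in> I \<Longrightarrow> integrable (M i) (f i)"
  shows "(\<integral>x. (\<Prod>i\<in>I. f i (x i)) \<partial>Pi\<^sub>M I M) = (\<Prod>i\<in>I. integral\<^sup>L (M i) (f i))"
proof -
  \<comment> \<open>the product theorem is about families over the whole index type, so outside \<open>I\<close> a Dirac mass is put in\<close>
  define K where "K i = (if i \<in> I then M i else return (count_space UNIV) undefined)" for i
  interpret product_prob_space K
    using M by (intro product_prob_spaceI) (auto simp: K_def prob_space_return)
  have "Pi\<^sub>M I M = Pi\<^sub>M I K" by (intro PiM_cong) (auto simp: K_def)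
  moreover have "(\<integral>x. (\<Prod>i\<in>I. f i (x i)) \<partial>Pi\<^sub>M I K) = (\<Prod>i\<in>I. integral\<^sup>L (K i) (f i))"
    by (rule product_integral_prod[OF I]) (simp add: K_def f)
  ultimately show ?thesis by (simp add: K_def)
qed

text \<open>
  Number the polls consecutively from \<open>0\<close>: all times of a window for replica \<open>1\<close>, then for
  replica \<open>2\<close>, and so on up to replica \<open>N\<close>, then the next window. Poll \<open>n = a * (N * T) + b * T + c\<close> with
  \<open>b < N\<close> and \<open>c < T\<close> thus is the one in round \<open>a + 1\<close> of replica \<open>b + 1\<close> at its time \<open>a * T + c + 1\<close>.
\<close>

locale polling =
  fixes N T :: nat
  assumes N: "1 \<le> N" and T: "1 \<le> T"
begin

definition replica :: "nat \<Rightarrow> nat" where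
  "replica n = Suc (n mod (N * T) div T)"

definition local_time :: "nat \<Rightarrow> nat" where
  "local_time n = Suc (n div (N * T) * T + n mod T)"

text \<open>
  The number of polls of replica \<open>i\<close> among the first \<open>n\<close> ones. As the polls of a replica come in the
  order of time, these polls are exactly those at the times \<open>1, ..., polled n i\<close>.
\<close>

definition polled :: "nat \<Rightarrow> nat \<Rightarrow> nat" where
  "polled n i = n div (N * T) * T + (if i < replica n then T else if i = replica n then n mod T else 0)"

lemma digits:
  assumes "b < N" "c < T"
  shows "(a * (N * T) + b * T + c) div (N * T) = a"
    and "(a * (N * T) + b * T + c) mod (N * T) div T = b"
    and "(a * (N * T) + b * T + c) mod T = c"
proof -
  have "b * T + c < Suc b * T" using assms by simp
  also have "Suc b * T \<le> N * T" using assms by (intro mult_le_mono1) simp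
  finally have lt: "b * T + c < N * T" .
  have quot: "(x * m + r) div m = x" "(x * m + r) mod m = r" if "r < m" for x m r :: nat
    using that by auto
  show "(a * (N * T) + b * T + c) div (N * T) = a"
    unfolding add.assoc by (rule quot(1)[OF lt])
  have "(a * (N * T) + b * T + c) mod (N * T) = b * T + c"
    unfolding add.assoc by (rule quot(2)[OF lt])
  then show "(a * (N * T) + b * T + c) mod (N * T) div T = b" using assms by simp
  have "a * (N * T) + b * T + c = (a * N + b) * T + c" by (simp add: algebra_simps)
  then show "(a * (N * T) + b * T + c) mod T = c" using assms by simp
qed

lemma digits_exist: "\<exists>a b c. b < N \<and> c < T \<and> n = a * (N * T) + b * T + c"
proof (intro exI conjI)
  have "n mod (N * T) < N * T" using N T by simp
  then show "n mod (N * T) div T < N" by (simp add: less_mult_imp_div_less)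
  show "n mod (N * T) mod T < T" using T by simp
  show "n = n div (N * T) * (N * T) + n mod (N * T) div T * T + n mod (N * T) mod T"
    by (simp only: add.assoc div_mult_mod_eq)
qed

lemma poll_eqs:
  assumes "b < N" "c < T"
  shows "replica (a * (N * T) + b * T + c) = Suc b"
    and "local_time (a * (N * T) + b * T + c) = Suc (a * T + c)"
    and "polled (a * (N * T) + b * T + c) i = a * T + (if i < Suc b then T else if i = Suc b then c else 0)"
  by (simp_all only: replica_def local_time_def polled_def digits[OF assms])

lemma replica_range: "replica n \<in> {1..N}"
proof -
  obtain a b c where "b < N" "c < T" and n: "n = a * (N * T) + b * T + c" using digits_exist by blast
  then show ?thesis unfolding n by (simp only: poll_eqs) simp
qed

lemma local_time_eq: "local_time n = Suc (polled n (replica n))"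
  by (simp add: local_time_def polled_def)

lemma polled_0: "i \<in> {1..N} \<Longrightarrow> polled 0 i = 0"
  by (auto simp: polled_def replica_def)

lemma polled_Suc:
  assumes i: "i \<in> {1..N}"
  shows "polled (Suc n) i = polled n i + (if i = replica n then 1 else 0)"
proof -
  obtain a b c where bc: "b < N" "c < T" and n: "n = a * (N * T) + b * T + c" using digits_exist by blast
  note old = poll_eqs[OF bc, of a, folded n]
  consider "Suc c < T" | "Suc c = T" "Suc b < N" | "Suc c = T" "Suc b = N" using bc by linarith
  then show ?thesis
  proof cases
    case 1
    have "Suc n = a * (N * T) + b * T + Suc c" by (simp add: n)
    note new = poll_eqs[OF bc(1) 1, of a, folded this]
    show ?thesis unfolding new old by auto
  next
    case 2
    have "Suc n = a * (N * T) + Suc b * T + 0" using 2 by (simp add: n)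
    note new = poll_eqs[OF 2(2), of 0 a, folded this]
    show ?thesis unfolding new(3)[OF less_le_trans[OF zero_less_one T]] old using 2 by auto
  next
    case 3
    have N0: "0 < N" "0 < T" using N T by auto
    have "N * T = b * T + Suc c" using 3 by (metis add.commute mult_Suc)
    then have "Suc n = Suc a * (N * T) + 0 * T + 0" by (simp add: n)
    note new = poll_eqs[OF N0, of "Suc a", folded this]
    show ?thesis unfolding new old using 3 i by auto
  qed
qed

lemma sum_polled: "(\<Sum>i\<in>{1..N}. polled n i) = n"
proof (induction n)
  case (Suc n)
  have "(\<Sum>i\<in>{1..N}. polled (Suc n) i) = (\<Sum>i\<in>{1..N}. polled n i) + (\<Sum>i\<in>{1..N}. if i = replica n then 1 else 0)"
    by (simp add: polled_Suc sum.distrib)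
  also have "\<dots> = Suc n" using Suc replica_range[of n] by simp
  finally show ?case .
qed (simp add: polled_0)

definition poll :: "(nat \<Rightarrow> nat \<Rightarrow> 'a) \<Rightarrow> nat \<Rightarrow> 'a" where
  "poll Y n = Y (replica n) (local_time n)"

lemma poll_in_iff:
  "(\<forall>l<n. poll Y l \<in> S) \<longleftrightarrow> (\<forall>i\<in>{1..N}. \<forall>t\<in>{1..polled n i}. Y i t \<in> S)"
proof (induction n)
  case (Suc n)
  have "{1..polled (Suc n) i} = (if i = replica n then insert (local_time n) {1..polled n i} else {1..polled n i})"
    if "i \<in> {1..N}" for i
    using polled_Suc[OF that, of n] by (auto simp: local_time_eq)
  then have "(\<forall>i\<in>{1..N}. \<forall>t\<in>{1..polled (Suc n) i}. Y i t \<in> S) \<longleftrightarrow>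
      (\<forall>i\<in>{1..N}. \<forall>t\<in>{1..polled n i}. Y i t \<in> S) \<and> poll Y n \<in> S"
    using replica_range[of n] unfolding poll_def by (metis (no_types, lifting) insert_iff)
  then show ?case using Suc by (auto simp: less_Suc_eq)
qed (simp add: polled_0)

lemma poll_digits: "b < N \<Longrightarrow> c < T \<Longrightarrow> poll Y (a * (N * T) + b * T + c) = Y (Suc b) (Suc (a * T + c))"
  by (simp only: poll_def poll_eqs)

lemma digits_less:
  assumes "b < N" "c < T" "c' < T" "b' < N" "a' < a \<or> a' = a \<and> (b' < b \<or> b' = b \<and> c' < c)"
  shows "a' * (N * T) + b' * T + c' < a * (N * T) + b * T + c"
proof -
  have *: "y * m + z < x * m" if "y < x" "z < m" for x y z m :: nat
  proof -
    have "y * m + z < Suc y * m" using that by simp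
    also have "\<dots> \<le> x * m" using that by (intro mult_le_mono1) simp
    finally show ?thesis .
  qed
  have "b' * T + c' < N * T" by (rule *) fact+
  from *[OF _ this] have 1: "a' < a \<Longrightarrow> a' * (N * T) + (b' * T + c') < a * (N * T)" .
  from *[OF _ assms(3)] have 2: "b' < b \<Longrightarrow> b' * T + c' < b * T" .
  show ?thesis using assms(5) 1 2 by auto
qed

lemma window_eq: "poll_window T (Suc a) = (\<lambda>c. Suc (a * T + c)) ` {..<T}"
proof -
  have "poll_window T (Suc a) = {Suc (a * T) ..< Suc (a * T) + T}" unfolding poll_window_def by auto
  also have "\<dots> = (\<lambda>c. c + Suc (a * T)) ` {0..<T}" by (simp only: image_add_atLeastLessThan') (simp add: add.commute)
  finally show ?thesis by (simp add: lessThan_atLeast0 add.commute)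
qed

lemma sum_window: "(\<Sum>j\<in>poll_window T (Suc a). g j) = (\<Sum>c<T. g (Suc (a * T + c)))"
  unfolding window_eq by (subst sum.reindex) (auto simp: inj_on_def)

lemma leaves_iff:
  "b < N \<Longrightarrow> leaves S T Y (Suc a) (Suc b) \<longleftrightarrow> (\<exists>c<T. poll Y (a * (N * T) + b * T + c) \<notin> S)"
  unfolding leaves_def window_eq by (auto simp: poll_digits)

lemma sum_blocks:
  fixes g :: "nat \<Rightarrow> real"
  shows "(\<Sum>l<Suc (a * (N * T) + b * T + c). g l) =
    (\<Sum>m<a. \<Sum>i<N. \<Sum>c<T. g (m * (N * T) + i * T + c)) + (\<Sum>i<b. \<Sum>c<T. g (a * (N * T) + i * T + c)) + (\<Sum>j\<le>c. g (a * (N * T) + b * T + j))"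
proof -
  have split: "(\<Sum>l<x + y. k l) = (\<Sum>l<x. k l) + (\<Sum>l<y. k (x + l))" for x y and k :: "nat \<Rightarrow> real"
    by (induction y) (auto simp: add.assoc)
  have group: "(\<Sum>l<x * y. k l) = (\<Sum>i<x. \<Sum>c<y. k (i * y + c))" for x y and k :: "nat \<Rightarrow> real"
  proof (induction x)
    case (Suc x)
    have "(\<Sum>l<Suc x * y. k l) = (\<Sum>l<x * y + y. k l)" by (simp add: add.commute)
    then show ?case using Suc by (simp add: split)
  qed simp
  have "(\<Sum>l<Suc (a * (N * T) + b * T + c). g l) = (\<Sum>l<a * (N * T) + (b * T + Suc c). g l)"
    by (simp add: add.assoc)
  also have "\<dots> = (\<Sum>l<a * (N * T). g l) + (\<Sum>l<b * T. g (a * (N * T) + l)) + (\<Sum>l<Suc c. g (a * (N * T) + (b * T + l)))"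
    by (simp only: split add.assoc)
  also have "(\<Sum>l<a * (N * T). g l) = (\<Sum>m<a. \<Sum>i<N. \<Sum>c<T. g (m * (N * T) + i * T + c))"
    by (simp only: group add.assoc)
  also have "(\<Sum>l<b * T. g (a * (N * T) + l)) = (\<Sum>i<b. \<Sum>c<T. g (a * (N * T) + i * T + c))"
    by (simp only: group add.assoc)
  also have "(\<Sum>l<Suc c. g (a * (N * T) + (b * T + l))) = (\<Sum>j\<le>c. g (a * (N * T) + b * T + j))"
    by (simp only: lessThan_Suc_atMost add.assoc)
  finally show ?thesis .
qed

text \<open>
  In the order of the polls the bookkeeping of the parallel step becomes that of a single path: it
  runs until the first poll outside \<open>S\<close>, adding \<open>f\<close> over all polls and one unit of time for each.
\<close>

lemma parallel_update_eq:
  assumes ex: "\<exists>n. poll Y n \<notin> S"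
  defines "n \<equiv> (LEAST n. poll Y n \<notin> S)"
  shows "parallel_update N T f S s Y = (True, poll Y n, f_sim s + (\<Sum>l\<le>n. f (poll Y l)), T_sim s + Suc n)"
proof -
  obtain a b c where bc: "b < N" "c < T" and n: "n = a * (N * T) + b * T + c" using digits_exist by blast
  have out: "poll Y (a * (N * T) + b * T + c) \<notin> S"
    unfolding n[symmetric] n_def using ex by (rule LeastI_ex)
  have before: "poll Y (a' * (N * T) + b' * T + c') \<in> S"
    if "b' < N" "c' < T" "a' < a \<or> a' = a \<and> (b' < b \<or> b' = b \<and> c' < c)" for a' b' c'
    using not_less_Least[of "a' * (N * T) + b' * T + c'" "\<lambda>n. poll Y n \<notin> S"] digits_less[OF bc that(2,1,3)]
    unfolding n_def[symmetric] n[symmetric] by blast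
  have leave: "leaves S T Y (Suc a) (Suc b)" using out bc by (auto simp: leaves_iff)
  have M: "(LEAST M. M \<ge> 1 \<and> (\<exists>i\<in>{1..N}. leaves S T Y M i)) = Suc a"
  proof (rule Least_equality)
    show "1 \<le> Suc a \<and> (\<exists>i\<in>{1..N}. leaves S T Y (Suc a) i)"
      using leave bc(1) by (intro conjI bexI[of _ "Suc b"]) auto
    fix M assume M: "1 \<le> M \<and> (\<exists>i\<in>{1..N}. leaves S T Y M i)"
    then obtain a' i where a': "M = Suc a'" and i: "i \<in> {1..N}" "leaves S T Y M i" by (cases M) auto
    then obtain b' where b': "i = Suc b'" "b' < N" by (cases i) auto
    obtain c' where "c' < T" "poll Y (a' * (N * T) + b' * T + c') \<notin> S"
      using i(2) b' unfolding a' b' by (auto simp: leaves_iff)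
    then have "\<not> a' < a" using before[of b' c' a'] b' by blast
    then show "Suc a \<le> M" unfolding a' by simp
  qed
  have K: "(LEAST i. i \<in> {1..N} \<and> leaves S T Y (Suc a) i) = Suc b"
  proof (rule Least_equality)
    show "Suc b \<in> {1..N} \<and> leaves S T Y (Suc a) (Suc b)" using leave bc(1) by simp
    fix i assume i: "i \<in> {1..N} \<and> leaves S T Y (Suc a) i"
    then obtain b' where b': "i = Suc b'" "b' < N" by (cases i) auto
    obtain c' where "c' < T" "poll Y (a * (N * T) + b' * T + c') \<notin> S"
      using i b' by (auto simp: leaves_iff)
    then have "\<not> b' < b" using before[of b' c' a] b' by blast
    then show "Suc b \<le> i" unfolding b' by simp
  qed
  have \<tau>: "(LEAST j. j \<in> poll_window T (Suc a) \<and> Y (Suc b) j \<notin> S) = Suc (a * T + c)"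
  proof (rule Least_equality)
    show "Suc (a * T + c) \<in> poll_window T (Suc a) \<and> Y (Suc b) (Suc (a * T + c)) \<notin> S"
      using out bc by (auto simp: window_eq poll_digits)
    fix j assume j: "j \<in> poll_window T (Suc a) \<and> Y (Suc b) j \<notin> S"
    then obtain c' where c': "c' < T" "j = Suc (a * T + c')" unfolding window_eq by auto
    have "\<not> c' < c" using before[of b c' a] j bc c' by (auto simp: poll_digits)
    then show "Suc (a * T + c) \<le> j" unfolding c' by simp
  qed
  have ex': "\<exists>M\<ge>1. \<exists>i\<in>{1..N}. leaves S T Y M i"
    using leave bc(1) by (intro exI[of _ "Suc a"] conjI bexI[of _ "Suc b"]) auto
  have s1: "(\<Sum>m=1..<Suc a. \<Sum>i=1..N. \<Sum>j\<in>poll_window T m. f (Y i j)) =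
      (\<Sum>m<a. \<Sum>i<N. \<Sum>c<T. f (poll Y (m * (N * T) + i * T + c)))"
  proof -
    have "(\<Sum>m=1..<Suc a. \<Sum>i=1..N. \<Sum>j\<in>poll_window T m. f (Y i j)) =
        (\<Sum>m<a. \<Sum>i=1..N. \<Sum>j\<in>poll_window T (Suc m). f (Y i j))"
      by (simp only: One_nat_def sum.shift_bounds_Suc_ivl lessThan_atLeast0)
    also have "\<dots> = (\<Sum>m<a. \<Sum>i<N. \<Sum>j\<in>poll_window T (Suc m). f (Y (Suc i) j))"
      by (simp only: One_nat_def sum.atLeast_Suc_atMost_Suc_shift sum.atLeast1_atMost_eq)
    also have "\<dots> = (\<Sum>m<a. \<Sum>i<N. \<Sum>c<T. f (poll Y (m * (N * T) + i * T + c)))"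
      by (rule sum.cong[OF refl], rule sum.cong[OF refl]) (auto simp: sum_window poll_digits)
    finally show ?thesis .
  qed
  have s2: "(\<Sum>i=1..<Suc b. \<Sum>j\<in>poll_window T (Suc a). f (Y i j)) =
      (\<Sum>i<b. \<Sum>c<T. f (poll Y (a * (N * T) + i * T + c)))"
  proof -
    have "(\<Sum>i=1..<Suc b. \<Sum>j\<in>poll_window T (Suc a). f (Y i j)) = (\<Sum>i<b. \<Sum>j\<in>poll_window T (Suc a). f (Y (Suc i) j))"
      by (simp only: One_nat_def sum.shift_bounds_Suc_ivl lessThan_atLeast0)
    also have "\<dots> = (\<Sum>i<b. \<Sum>c<T. f (poll Y (a * (N * T) + i * T + c)))"
      using bc(1) by (intro sum.cong[OF refl]) (auto simp: sum_window poll_digits)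
    finally show ?thesis .
  qed
  have s3: "(\<Sum>j=(Suc a - 1) * T + 1..Suc (a * T + c). f (Y (Suc b) j)) = (\<Sum>j\<le>c. f (poll Y (a * (N * T) + b * T + j)))"
  proof -
    have "{(Suc a - 1) * T + 1..Suc (a * T + c)} = (\<lambda>j. Suc (a * T + j)) ` {..c}"
    proof -
      have "{(Suc a - 1) * T + 1..Suc (a * T + c)} = {0 + Suc (a * T)..c + Suc (a * T)}" by (auto simp: add.commute)
      also have "\<dots> = (\<lambda>j. j + Suc (a * T)) ` {0..c}" by (rule image_add_atLeastAtMost'[symmetric])
      finally show ?thesis by (simp add: atMost_atLeast0 add.commute)
    qed
    then have "(\<Sum>j=(Suc a - 1) * T + 1..Suc (a * T + c). f (Y (Suc b) j)) = (\<Sum>j\<le>c. f (Y (Suc b) (Suc (a * T + j))))"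
      by (simp only:) (subst sum.reindex, auto simp: inj_on_def)
    also have "\<dots> = (\<Sum>j\<le>c. f (poll Y (a * (N * T) + b * T + j)))"
      using bc by (intro sum.cong refl) (auto simp: poll_digits)
    finally show ?thesis .
  qed
  have "(\<Sum>l\<le>n. f (poll Y l)) = (\<Sum>m<a. \<Sum>i<N. \<Sum>c<T. f (poll Y (m * (N * T) + i * T + c)))
    + (\<Sum>i<b. \<Sum>c<T. f (poll Y (a * (N * T) + i * T + c))) + (\<Sum>j\<le>c. f (poll Y (a * (N * T) + b * T + j)))"
    using sum_blocks[of "\<lambda>l. f (poll Y l)" a b c] by (simp only: n lessThan_Suc_atMost)
  moreover have "(Suc a - 1) * (N * T) + (Suc b - 1) * T + (Suc (a * T + c) - (Suc a - 1) * T) = Suc n"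
    by (simp add: n)
  moreover have "Y (Suc b) (Suc (a * T + c)) = poll Y n" using bc by (simp only: n poll_digits)
  ultimately show ?thesis
    unfolding parallel_update_def Let_def M K \<tau> s1 s2 s3 using ex' by (simp only: if_True add.assoc)
qed

end

section \<open>Mean excess of a parallel step\<close>

locale replicated_kernel = decorrelating_kernel Om P \<mu> \<S> \<nu> T_corr + polling N T_poll
  for Om :: "'a measure" and P \<mu> \<S> \<nu> T_corr N T_poll
begin

abbreviation replicas :: "'a set \<Rightarrow> (nat \<Rightarrow> nat \<Rightarrow> 'a) measure" where
  "replicas S \<equiv> replica_law Om P N (\<Pi>\<^sub>M i\<in>{1..N}. \<nu> S)"

abbreviation replica_paths :: "(nat \<Rightarrow> nat \<Rightarrow> 'a) measure" where
  "replica_paths \<equiv> \<Pi>\<^sub>M i\<in>{1..N}. paths"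

lemma product_qsd: "S \<in> \<S> \<Longrightarrow> (\<Pi>\<^sub>M i\<in>{1..N}. \<nu> S) \<in> space (prob_algebra (\<Pi>\<^sub>M i\<in>{1..N}. Om))"
  using nu_law[of S] by (auto simp: space_prob_algebra intro!: sets_PiM_cong prob_space_PiM)

lemma replicas_law: "S \<in> \<S> \<Longrightarrow> replicas S \<in> space (prob_algebra replica_paths)"
  by (rule measurable_replica_law[OF kernel product_qsd])

lemma replicas_facts:
  assumes "S \<in> \<S>"
  shows prob_space_replicas: "prob_space (replicas S)"
    and sets_replicas: "sets (replicas S) = sets replica_paths"
    and space_replicas: "space (replicas S) = space replica_paths"
  using replicas_law[OF assms] by (auto simp: space_prob_algebra dest: sets_eq_imp_space_eq)

lemma measurable_poll: "(\<lambda>Y. poll Y n) \<in> replica_paths \<rightarrow>\<^sub>M Om"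
proof -
  have "(\<lambda>Y. Y (replica n)) \<in> replica_paths \<rightarrow>\<^sub>M paths"
    by (rule measurable_component_singleton[OF replica_range])
  then show ?thesis unfolding poll_def by (rule measurable_compose) (rule measurable_component_singleton, simp)
qed

lemma poll_in_space: "Y \<in> space replica_paths \<Longrightarrow> poll Y n \<in> space Om"
  by (rule measurable_space[OF measurable_poll])

lemma integral_replicas_prod:
  assumes S: "S \<in> \<S>" and F: "\<And>i. i \<in> {1..N} \<Longrightarrow> adapted (m i) (F i)"
    and \<Psi>: "\<And>i. i \<in> {1..N} \<Longrightarrow> bfun (\<Psi> i)"
    and eq: "\<And>i x. i \<in> {1..N} \<Longrightarrow> x \<in> space Om \<Longrightarrow> (\<integral>\<omega>. F i \<omega> \<partial>chain_law Om P (return Om x)) = \<Psi> i x"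
  shows "(\<integral>Y. (\<Prod>i\<in>{1..N}. F i (Y i)) \<partial>replicas S) = (\<Prod>i\<in>{1..N}. (\<integral>x. \<Psi> i x \<partial>\<nu> S))"
proof -
  let ?D = "\<Pi>\<^sub>M i\<in>{1..N}. \<nu> S"
  let ?K = "\<lambda>x. \<Pi>\<^sub>M i\<in>{1..N}. chain_law Om P (return Om (x i))"
  interpret D: prob_space ?D using product_qsd[OF S] by (simp add: space_prob_algebra)
  have sD: "sets ?D = sets (\<Pi>\<^sub>M i\<in>{1..N}. Om)" using product_qsd[OF S] by (simp add: space_prob_algebra)
  have K: "?K \<in> (\<Pi>\<^sub>M i\<in>{1..N}. Om) \<rightarrow>\<^sub>M prob_algebra replica_paths"
    by (intro measurable_PiM_prob measurable_compose[OF _ measurable_chain_law[OF kernel]]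
       measurable_compose[OF _ measurable_return_prob_space] measurable_component_singleton) auto
  then have KD: "?K \<in> ?D \<rightarrow>\<^sub>M subprob_algebra replica_paths"
    unfolding measurable_cong_sets[OF sD refl] by (rule measurable_prob_algebraD)
  have F_path: "F i \<in> borel_measurable paths" if "i \<in> {1..N}" for i
    using F[OF that] by (rule adapted_measurable)
  have "\<exists>B. \<forall>\<omega>\<in>space paths. \<bar>F i \<omega>\<bar> \<le> B" if "i \<in> {1..N}" for i
    using F[OF that] by (simp add: adapted_def)
  then obtain B where B: "\<And>i \<omega>. i \<in> {1..N} \<Longrightarrow> \<omega> \<in> space paths \<Longrightarrow> \<bar>F i \<omega>\<bar> \<le> B i" by metis
  have "(\<integral>Y. (\<Prod>i\<in>{1..N}. F i (Y i)) \<partial>replicas S) = (\<integral>x. \<integral>Y. (\<Prod>i\<in>{1..N}. F i (Y i)) \<partial>(?K x) \<partial>?D)"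
    unfolding replica_law_def
  proof (rule integral_bind[OF _ _ KD D.finite_measure_axioms])
    show "(\<lambda>Y. \<Prod>i\<in>{1..N}. F i (Y i)) \<in> borel_measurable replica_paths"
    proof (rule borel_measurable_prod)
      fix i assume i: "i \<in> {1..N}"
      show "(\<lambda>Y. F i (Y i)) \<in> borel_measurable replica_paths"
        by (rule measurable_compose[OF measurable_component_singleton[OF i] F_path[OF i]])
    qed
    show "\<bar>\<Prod>i\<in>{1..N}. F i (Y i)\<bar> \<le> (\<Prod>i\<in>{1..N}. B i)" if "Y \<in> space replica_paths" for Y
      unfolding abs_prod using that by (intro prod_mono conjI abs_ge_zero B) (auto simp: space_PiM PiE_iff)
    show "AE x in ?D. emeasure (?K x) (space (?K x)) \<le> ennreal 1"
    proof (rule AE_I2)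
      fix x assume "x \<in> space ?D"
      then have "?K x \<in> space (subprob_algebra replica_paths)" by (rule measurable_space[OF KD])
      then show "emeasure (?K x) (space (?K x)) \<le> ennreal 1"
        by (auto simp: space_subprob_algebra dest: subprob_space.emeasure_space_le_1)
    qed
  qed
  also have "\<dots> = (\<integral>x. (\<Prod>i\<in>{1..N}. \<Psi> i (x i)) \<partial>?D)"
  proof (intro Bochner_Integration.integral_cong refl)
    fix x assume "x \<in> space ?D"
    then have x: "x i \<in> space Om" if "i \<in> {1..N}" for i
      using that by (simp add: space_PiM PiE_iff law_prob(3)[OF nu_law[OF S]])
    have "(\<integral>Y. (\<Prod>i\<in>{1..N}. F i (Y i)) \<partial>(?K x)) = (\<Prod>i\<in>{1..N}. \<integral>\<omega>. F i \<omega> \<partial>chain_law Om P (return Om (x i)))"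
    proof (rule integral_PiM_prod)
      fix i assume i: "i \<in> {1..N}"
      have \<zeta>: "return Om (x i) \<in> space (prob_algebra Om)" by (rule return_in_prob_algebra[OF x[OF i]])
      show "prob_space (chain_law Om P (return Om (x i)))" by (rule prob_space_chain[OF \<zeta>])
      show "integrable (chain_law Om P (return Om (x i))) (F i)" by (rule integrable_adapted[OF \<zeta> F[OF i]])
    qed simp
    also have "\<dots> = (\<Prod>i\<in>{1..N}. \<Psi> i (x i))"
      by (intro prod.cong refl eq x)
    finally show "(\<integral>Y. (\<Prod>i\<in>{1..N}. F i (Y i)) \<partial>(?K x)) = (\<Prod>i\<in>{1..N}. \<Psi> i (x i))" .
  qed
  also have "\<dots> = (\<Prod>i\<in>{1..N}. (\<integral>x. \<Psi> i x \<partial>\<nu> S))"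
    by (rule integral_PiM_prod) (simp_all add: law_prob[OF nu_law[OF S]] integrable_bfun[OF nu_law[OF S] \<Psi>])
  finally show ?thesis .
qed

text \<open>
  That the first \<open>n\<close> polls lie in \<open>S\<close> means that each replica \<open>i\<close> stays in \<open>S\<close> up to its time \<open>polled n i\<close>.
  The replicas are independent, and by quasistationarity each has probability \<open>stay S ^ polled n i\<close> to
  do so and is then again distributed as \<open>\<nu>\<^sub>S\<close>. The exponents add up to \<open>n\<close>.
\<close>

lemma integral_poll:
  assumes S: "S \<in> \<S>" and \<psi>: "bfun \<psi>"
  shows "(\<integral>Y. of_bool (\<forall>l<n. poll Y l \<in> S) * \<psi> (poll Y n) \<partial>replicas S) = stay S ^ n * (\<integral>x. transition \<psi> x \<partial>\<nu> S)"
proof -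
  let ?r = "replica n" and ?p = "polled n"
  have Sm[measurable]: "S \<in> sets Om" by (rule S_sets[OF S])
  define F where "F i \<omega> = of_bool (\<forall>t\<in>{1..?p i}. \<omega> t \<in> S) * (if i = ?r then \<psi> (\<omega> (local_time n)) else 1)" for i \<omega>
  define \<Psi> where "\<Psi> i = (transition_within S ^^ ?p i) (if i = ?r then transition \<psi> else (\<lambda>_. 1))" for i
  have ad: "adapted (?p i) (\<lambda>\<omega>. of_bool (\<forall>t\<in>{1..?p i}. \<omega> t \<in> S))" for i
    by (rule adapted_of_bool) auto
  have "of_bool (\<forall>l<n. poll Y l \<in> S) * \<psi> (poll Y n) = (\<Prod>i\<in>{1..N}. F i (Y i))" for Y
  proof -
    have "(\<Prod>i\<in>{1..N}. F i (Y i)) = (\<Prod>i\<in>{1..N}. of_bool (\<forall>t\<in>{1..?p i}. Y i t \<in> S)) *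
        (\<Prod>i\<in>{1..N}. if i = ?r then \<psi> (Y i (local_time n)) else 1)"
      by (simp only: F_def prod.distrib)
    also have "(\<Prod>i\<in>{1..N}. if i = ?r then \<psi> (Y i (local_time n)) else 1) = \<psi> (poll Y n)"
      using replica_range[of n] by (simp add: poll_def)
    also have "(\<Prod>i\<in>{1..N}. of_bool (\<forall>t\<in>{1..?p i}. Y i t \<in> S)) = (of_bool (\<forall>l<n. poll Y l \<in> S) :: real)"
    proof (cases "\<forall>l<n. poll Y l \<in> S")
      case True
      then have *: "\<forall>i\<in>{1..N}. \<forall>t\<in>{1..?p i}. Y i t \<in> S" by (simp only: poll_in_iff)
      then have "(\<Prod>i\<in>{1..N}. of_bool (\<forall>t\<in>{1..?p i}. Y i t \<in> S)) = (1::real)"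
        by (intro prod.neutral ballI) simp
      then show ?thesis using True by simp
    next
      case False
      then obtain i where "i \<in> {1..N}" "\<not> (\<forall>t\<in>{1..?p i}. Y i t \<in> S)" using poll_in_iff[of n Y S] by blast
      then have "(\<Prod>i\<in>{1..N}. of_bool (\<forall>t\<in>{1..?p i}. Y i t \<in> S)) = (0::real)"
        by (intro prod_zero bexI[of _ i]) (simp_all only: of_bool_eq(1) finite_atLeastAtMost)
      then show ?thesis using False by (simp only: of_bool_eq(1))
    qed
    finally show ?thesis by simp
  qed
  then have "(\<integral>Y. of_bool (\<forall>l<n. poll Y l \<in> S) * \<psi> (poll Y n) \<partial>replicas S) = (\<integral>Y. (\<Prod>i\<in>{1..N}. F i (Y i)) \<partial>replicas S)"
    by (simp only:)
  also have "\<dots> = (\<Prod>i\<in>{1..N}. (\<integral>x. \<Psi> i x \<partial>\<nu> S))"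
  proof (rule integral_replicas_prod[OF S])
    show "adapted (Suc (?p i)) (F i)" for i
      unfolding F_def
    proof (rule adapted_mult[OF adapted_mono[OF ad]])
      show "adapted (Suc (?p i)) (\<lambda>\<omega>. if i = ?r then \<psi> (\<omega> (local_time n)) else 1)"
        using adapted_coordinate[OF \<psi>, of "local_time n" "Suc (?p ?r)"] local_time_eq[of n]
        by (cases "i = ?r") (simp_all add: adapted_const)
    qed simp
    show "bfun (\<Psi> i)" for i
      unfolding \<Psi>_def by (intro bfun_within_power Sm) (simp add: bfun_transition \<psi>)
    fix i x assume x: "x \<in> space Om"
    let ?\<zeta> = "return Om x"
    have \<zeta>: "?\<zeta> \<in> space (prob_algebra Om)" by (rule return_in_prob_algebra[OF x])
    define \<eta> where "\<eta> = (if i = ?r then transition \<psi> else (\<lambda>_. 1))"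
    have \<eta>: "bfun \<eta>" by (simp add: \<eta>_def bfun_transition \<psi>)
    have "(\<integral>\<omega>. F i \<omega> \<partial>chain_law Om P ?\<zeta>) = (\<integral>\<omega>. of_bool (\<forall>t\<in>{1..?p i}. \<omega> t \<in> S) * \<eta> (\<omega> (?p i)) \<partial>chain_law Om P ?\<zeta>)"
    proof (cases "i = ?r")
      case True
      show ?thesis
        using integral_chain_step[OF \<zeta> ad \<psi>, of i] by (simp add: F_def \<eta>_def True local_time_eq)
    next
      case False
      then show ?thesis by (simp add: F_def \<eta>_def)
    qed
    also have "\<dots> = (\<integral>y. (transition_within S ^^ ?p i) \<eta> y \<partial>?\<zeta>)"
      by (rule integral_chain_within[OF \<zeta> \<eta> Sm])
    also have "\<dots> = (transition_within S ^^ ?p i) \<eta> x"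
      by (intro integral_return_bfun[OF x] bfun_within_power Sm \<eta>)
    finally show "(\<integral>\<omega>. F i \<omega> \<partial>chain_law Om P ?\<zeta>) = \<Psi> i x" by (simp add: \<Psi>_def \<eta>_def)
  qed
  also have "\<dots> = (\<Prod>i\<in>{1..N}. stay S ^ ?p i * (if i = ?r then (\<integral>x. transition \<psi> x \<partial>\<nu> S) else 1))"
  proof (intro prod.cong refl)
    fix i
    interpret prob_space "\<nu> S" by (rule law_prob[OF nu_law[OF S]])
    have "bfun (if i = ?r then transition \<psi> else (\<lambda>_. 1))" by (simp add: bfun_transition \<psi>)
    from qsd_within_power[OF S this]
    show "(\<integral>x. \<Psi> i x \<partial>\<nu> S) = stay S ^ ?p i * (if i = ?r then (\<integral>x. transition \<psi> x \<partial>\<nu> S) else 1)"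
      by (simp add: \<Psi>_def prob_space)
  qed
  also have "\<dots> = stay S ^ (\<Sum>i\<in>{1..N}. ?p i) * (\<integral>x. transition \<psi> x \<partial>\<nu> S)"
    using replica_range[of n] by (simp add: prod.distrib power_sum)
  finally show ?thesis by (simp only: sum_polled)
qed

definition exit_poll :: "'a set \<Rightarrow> (nat \<Rightarrow> nat \<Rightarrow> 'a) \<Rightarrow> nat" where
  "exit_poll S Y = (LEAST n. poll Y n \<notin> S)"

lemma exit_tail:
  assumes S: "S \<in> \<S>"
  shows "\<P>(Y in replicas S. \<forall>i<n. \<not> poll Y i \<notin> S) \<le> 1 * stay S ^ n"
proof -
  interpret prob_space "replicas S" by (rule prob_space_replicas[OF S])
  interpret nu: prob_space "\<nu> S" by (rule law_prob[OF nu_law[OF S]])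
  have [measurable_cong]: "sets (replicas S) = sets replica_paths" by (rule sets_replicas[OF S])
  note [measurable] = S_sets[OF S] measurable_poll
  define E where "E = {Y\<in>space (replicas S). \<forall>i<n. \<not> poll Y i \<notin> S}"
  have "E \<subseteq> space (replicas S)" unfolding E_def by blast
  then have "prob E = (\<integral>Y. indicator E Y \<partial>replicas S)"
    by (subst Bochner_Integration.integral_indicator) (simp only: Int_absorb2)
  also have "\<dots> = (\<integral>Y. of_bool (\<forall>l<n. poll Y l \<in> S) * 1 \<partial>replicas S)"
  proof (rule Bochner_Integration.integral_cong[OF refl])
    fix Y assume Y: "Y \<in> space (replicas S)"
    show "indicator E Y = (of_bool (\<forall>l<n. poll Y l \<in> S) * 1 :: real)"
      by (cases "\<forall>l<n. poll Y l \<in> S") (use Y in \<open>simp_all add: E_def\<close>)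
  qed
  also have "\<dots> = stay S ^ n * (\<integral>x. transition (\<lambda>_. 1) x \<partial>\<nu> S)"
    by (rule integral_poll[OF S bfun_const])
  also have "(\<integral>x. transition (\<lambda>_. 1) x \<partial>\<nu> S) = (\<integral>x. 1 \<partial>\<nu> S)"
    by (intro Bochner_Integration.integral_cong refl transition_const) (simp add: law_prob[OF nu_law[OF S]])
  also have "\<dots> = 1" by (simp add: nu.prob_space)
  finally show ?thesis unfolding E_def by (simp only: mult_1_left mult_1_right order_refl)
qed

lemma AE_exit: assumes S: "S \<in> \<S>" shows "AE Y in replicas S. \<exists>n. poll Y n \<notin> S"
proof -
  interpret prob_space "replicas S" by (rule prob_space_replicas[OF S])
  have [measurable_cong]: "sets (replicas S) = sets replica_paths" by (rule sets_replicas[OF S])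
  note [measurable] = S_sets[OF S] measurable_poll
  show ?thesis
    by (rule geometric_stopping_AE[OF _ exit_tail[OF S] stay_nonneg stay_less_1[OF S]]) measurable
qed

text \<open>
  By \<open>integral_poll\<close> the mean excess is the geometric series \<open>\<nu>\<^sub>S(P \<phi>) / (1 - q)\<close> with \<open>q = stay S\<close>, and
  the exit point has the law of \<open>X\<^sub>1\<close> under \<open>\<nu>\<^sub>S\<close> conditioned on \<open>X\<^sub>1 \<notin> S\<close>. Splitting \<open>\<nu>\<^sub>S(P h)\<close> according to
  whether \<open>X\<^sub>1 \<in> S\<close> gives \<open>q \<nu>\<^sub>S(h) + (1 - q) E h(exit)\<close>, so that by the Poisson equation the mean
  excess is \<open>\<nu>\<^sub>S(h) - E h(exit)\<close>. The additional term \<open>mismatch h\<close> has mean zero at the exit point.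
\<close>

lemma parallel_increment:
  assumes S: "S \<in> \<S>" and h: "bfun h" and \<phi>: "bfun \<phi>"
    and poisson: "\<And>x. x \<in> space Om \<Longrightarrow> h x - transition h x = transition \<phi> x"
  defines "Z \<equiv> \<lambda>Y. (\<Sum>l\<le>exit_poll S Y. \<phi> (poll Y l)) + (h (poll Y (exit_poll S Y)) + mismatch h (poll Y (exit_poll S Y))) - (\<integral>y. h y \<partial>\<nu> S)"
  shows "\<exists>C. integrable (replicas S) Z \<and> (\<integral>Y. Z Y \<partial>replicas S) = 0 \<and>
    (\<integral>\<^sup>+Y. ennreal ((Z Y)\<^sup>2) \<partial>replicas S) \<le> ennreal C"
proof -
  let ?M = "replicas S" let ?q = "stay S" let ?\<tau> = "exit_poll S"
  let ?m = "\<lambda>x. h x + mismatch h x" let ?c = "\<integral>y. h y \<partial>\<nu> S"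
  interpret prob_space ?M by (rule prob_space_replicas[OF S])
  interpret nu: prob_space "\<nu> S" by (rule law_prob[OF nu_law[OF S]])
  have [measurable_cong]: "sets ?M = sets replica_paths" by (rule sets_replicas[OF S])
  have Sm[measurable]: "S \<in> sets Om" by (rule S_sets[OF S])
  note [measurable] = measurable_poll
  have m: "bfun ?m" by (intro bfun_add h bfun_mismatch)
  obtain b where b: "0 < b" "\<And>y. y \<in> space Om \<Longrightarrow> \<bar>\<phi> y\<bar> \<le> b" using bfun_bound[OF \<phi>] by blast
  obtain bm where bm: "0 < bm" "\<And>y. y \<in> space Om \<Longrightarrow> \<bar>?m y\<bar> \<le> bm" using bfun_bound[OF m] by blast
  have [measurable]: "\<phi> \<in> borel_measurable Om" "?m \<in> borel_measurable Om" by (intro bfun_measurable \<phi> m)+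
  have sp: "poll Y n \<in> space Om" if "Y \<in> space ?M" for Y n
    using that poll_in_space unfolding space_replicas[OF S] by blast
  have D[measurable]: "Measurable.pred ?M (\<lambda>Y. poll Y n \<notin> S)" for n by measurable
  have \<tau>m[measurable]: "?\<tau> \<in> ?M \<rightarrow>\<^sub>M count_space UNIV" unfolding exit_poll_def[abs_def] by measurable
  have q: "0 \<le> ?q" "?q < 1" by (rule stay_nonneg, rule stay_less_1[OF S])
  note tail = exit_tail[OF S]
  have geo: "(\<lambda>n. ?q ^ n * c) sums (c / (1 - ?q))" for c
    using sums_mult2[OF geometric_sums[of ?q], of c] q by simp
  let ?b = "\<lambda>l Y. of_bool (\<forall>i<l. poll Y i \<in> S) * \<phi> (poll Y l)"
  have sum_facts: "integrable ?M (\<lambda>Y. \<Sum>l\<le>(LEAST n. poll Y n \<notin> S). ?b l Y)"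
      "(\<lambda>l. \<integral>Y. ?b l Y \<partial>?M) sums (\<integral>Y. (\<Sum>l\<le>(LEAST n. poll Y n \<notin> S). ?b l Y) \<partial>?M)"
  proof -
    have m: "?b n \<in> borel_measurable ?M" for n by measurable
    have bb: "\<bar>?b n Y\<bar> \<le> b" if "Y \<in> space ?M" for n Y
      using b(1) b(2)[OF sp[OF that, of n]] by simp
    have z: "?b n Y = 0" if "i < n" "poll Y i \<notin> S" for n i Y
      using that by auto
    show "integrable ?M (\<lambda>Y. \<Sum>l\<le>(LEAST n. poll Y n \<notin> S). ?b l Y)"
      by (rule geometric_stopping_sums(1)[where b="?b" and D="\<lambda>n Y. poll Y n \<notin> S", OF D tail q m bb z])
    show "(\<lambda>l. \<integral>Y. ?b l Y \<partial>?M) sums (\<integral>Y. (\<Sum>l\<le>(LEAST n. poll Y n \<notin> S). ?b l Y) \<partial>?M)"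
      by (rule geometric_stopping_sums(2)[where b="?b" and D="\<lambda>n Y. poll Y n \<notin> S", OF D tail q m bb z])
  qed
  have seq: "(\<Sum>l\<le>(LEAST n. poll Y n \<notin> S). ?b l Y) = (\<Sum>l\<le>?\<tau> Y. \<phi> (poll Y l))" for Y
    unfolding exit_poll_def
  proof (intro sum.cong refl)
    fix l assume l: "l \<in> {..LEAST n. poll Y n \<notin> S}"
    have "poll Y i \<in> S" if "i < l" for i
      using not_less_Least[of i "\<lambda>n. poll Y n \<notin> S"] that l by auto
    then show "?b l Y = \<phi> (poll Y l)" by simp
  qed
  have i1: "integrable ?M (\<lambda>Y. \<Sum>l\<le>?\<tau> Y. \<phi> (poll Y l))" using sum_facts(1) unfolding seq .
  have E1: "(\<integral>Y. (\<Sum>l\<le>?\<tau> Y. \<phi> (poll Y l)) \<partial>?M) = (\<integral>x. transition \<phi> x \<partial>\<nu> S) / (1 - ?q)"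
    using sums_unique2[OF sum_facts(2)[unfolded seq integral_poll[OF S \<phi>]] geo] .
  have i2: "integrable ?M (\<lambda>Y. ?m (poll Y (?\<tau> Y)))"
  proof (rule integrable_const_bound[of _ bm, OF AE_I2])
    show "(\<lambda>Y. ?m (poll Y (?\<tau> Y))) \<in> borel_measurable ?M"
      by (rule measurable_compose_countable[OF _ \<tau>m]) measurable
  qed (simp only: real_norm_def bm(2) sp)
  let ?e = "\<lambda>\<psi> y. indicator (space Om - S) y * \<psi> y"
  have be: "bfun (?e \<psi>)" if "bfun \<psi>" for \<psi>
    using Sm by (intro bfun_mult bfun_indicator that) auto
  have E2: "(\<integral>Y. ?m (poll Y (?\<tau> Y)) \<partial>?M) = (\<integral>x. transition (?e ?m) x \<partial>\<nu> S) / (1 - ?q)"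
  proof (rule sums_unique2[OF _ geo])
    have "(\<lambda>l. \<integral>Y. of_bool (\<forall>i<l. \<not> poll Y i \<notin> S) * (of_bool (poll Y l \<notin> S) * ?m (poll Y l)) \<partial>?M) sums (\<integral>Y. ?m (poll Y (LEAST n. poll Y n \<notin> S)) \<partial>?M)"
      by (rule geometric_stopping_value[OF D tail q _ bm(2)[OF sp]]) measurable
    also have "(\<lambda>l. \<integral>Y. of_bool (\<forall>i<l. \<not> poll Y i \<notin> S) * (of_bool (poll Y l \<notin> S) * ?m (poll Y l)) \<partial>?M) =
        (\<lambda>l. \<integral>Y. of_bool (\<forall>i<l. poll Y i \<in> S) * ?e ?m (poll Y l) \<partial>?M)"
    proof (intro ext Bochner_Integration.integral_cong refl)
      fix l Y assume "Y \<in> space ?M"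
      from sp[OF this, of l] show "of_bool (\<forall>i<l. \<not> poll Y i \<notin> S) * (of_bool (poll Y l \<notin> S) * ?m (poll Y l)) =
         of_bool (\<forall>i<l. poll Y i \<in> S) * ?e ?m (poll Y l)" by (simp add: indicator_def)
    qed
    finally show "(\<lambda>l. ?q ^ l * (\<integral>x. transition (?e ?m) x \<partial>\<nu> S)) sums (\<integral>Y. ?m (poll Y (?\<tau> Y)) \<partial>?M)"
      unfolding integral_poll[OF S be[OF m]] exit_poll_def .
  qed
  have t1: "(\<integral>x. transition (?e ?m) x \<partial>\<nu> S) = (\<integral>x. transition (?e h) x \<partial>\<nu> S)"
  proof (intro Bochner_Integration.integral_cong refl)
    fix x assume "x \<in> space (\<nu> S)"
    then have x: "x \<in> space Om" by (simp add: law_prob[OF nu_law[OF S]])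
    have "transition (?e ?m) x = transition (\<lambda>y. ?e h y + ?e (mismatch h) y) x" by (simp only: distrib_left)
    also have "\<dots> = transition (?e h) x + transition (?e (mismatch h)) x"
      by (intro transition_add be h bfun_mismatch x)
    finally show "transition (?e ?m) x = transition (?e h) x" by (simp only: exit_mismatch[OF S h x] add_0_right)
  qed
  have t2: "(\<integral>x. transition h x \<partial>\<nu> S) = ?q * ?c + (\<integral>x. transition (?e h) x \<partial>\<nu> S)"
  proof -
    have "(\<integral>x. transition h x \<partial>\<nu> S) = (\<integral>x. transition_within S h x + transition (?e h) x \<partial>\<nu> S)"
    proof (intro Bochner_Integration.integral_cong refl)
      fix x assume "x \<in> space (\<nu> S)"
      then have x: "x \<in> space Om" by (simp add: law_prob[OF nu_law[OF S]])
      have "transition h x = transition (\<lambda>y. indicator S y * h y + ?e h y) x"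
        by (rule transition_cong[OF _ x]) (simp add: indicator_def)
      also have "\<dots> = transition_within S h x + transition (?e h) x"
        unfolding transition_within_def by (intro transition_add be h bfun_mult bfun_indicator Sm x)
      finally show "transition h x = transition_within S h x + transition (?e h) x" .
    qed
    also have "\<dots> = (\<integral>x. transition_within S h x \<partial>\<nu> S) + (\<integral>x. transition (?e h) x \<partial>\<nu> S)"
      by (intro Bochner_Integration.integral_add integrable_bfun[OF nu_law[OF S]] bfun_within bfun_transition be h Sm)
    finally show ?thesis by (simp only: qsd_within[OF S h])
  qed
  have t3: "(\<integral>x. transition \<phi> x \<partial>\<nu> S) = ?c - (\<integral>x. transition h x \<partial>\<nu> S)"
  proof -
    have "(\<integral>x. transition \<phi> x \<partial>\<nu> S) = (\<integral>x. h x - transition h x \<partial>\<nu> S)"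
      by (intro Bochner_Integration.integral_cong refl) (simp add: poisson law_prob[OF nu_law[OF S]])
    also have "\<dots> = ?c - (\<integral>x. transition h x \<partial>\<nu> S)"
      by (intro Bochner_Integration.integral_diff integrable_bfun[OF nu_law[OF S]] bfun_transition h)
    finally show ?thesis .
  qed
  have iZ: "integrable ?M Z"
    unfolding Z_def by (intro Bochner_Integration.integrable_diff Bochner_Integration.integrable_add[OF i1 i2] integrable_const)
  have "(\<integral>Y. Z Y \<partial>?M) = (\<integral>Y. (\<Sum>l\<le>?\<tau> Y. \<phi> (poll Y l)) \<partial>?M) + (\<integral>Y. ?m (poll Y (?\<tau> Y)) \<partial>?M) - ?c"
    unfolding Z_def
    by (subst Bochner_Integration.integral_diff[OF Bochner_Integration.integrable_add[OF i1 i2] integrable_const],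
        subst Bochner_Integration.integral_add[OF i1 i2])
       (simp only: lebesgue_integral_const prob_space scaleR_one)
  also have "\<dots> = (?c - ?q * ?c) / (1 - ?q) - ?c"
    unfolding E1 E2 t1 t3 t2 by (simp add: add_divide_distrib[symmetric])
  also have "\<dots> = 0"
  proof -
    have "?c - ?q * ?c = ?c * (1 - ?q)" by (simp add: algebra_simps)
    then show ?thesis using q by simp
  qed
  finally have Z0: "(\<integral>Y. Z Y \<partial>?M) = 0" .
  define b' where "b' = b + bm + \<bar>?c\<bar>"
  have Zb: "\<bar>Z Y\<bar> \<le> b * real (?\<tau> Y) + b'" if Y: "Y \<in> space ?M" for Y
  proof -
    have "\<bar>\<Sum>l\<le>?\<tau> Y. \<phi> (poll Y l)\<bar> \<le> (\<Sum>l\<le>?\<tau> Y. \<bar>\<phi> (poll Y l)\<bar>)" by (rule sum_abs)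
    also have "\<dots> \<le> (\<Sum>l\<le>?\<tau> Y. b)" by (rule sum_mono) (rule b(2)[OF sp[OF Y]])
    finally have "\<bar>\<Sum>l\<le>?\<tau> Y. \<phi> (poll Y l)\<bar> \<le> b * real (?\<tau> Y) + b" by (simp add: algebra_simps)
    then show ?thesis
      using bm(2)[OF sp[OF Y, of "?\<tau> Y"]] unfolding Z_def b'_def by linarith
  qed
  have "(\<integral>\<^sup>+Y. ennreal ((real (?\<tau> Y))\<^sup>2) \<partial>?M) \<le> ennreal (2 * 1 / (1 - ?q)\<^sup>2)"
    unfolding exit_poll_def by (rule geometric_stopping_square[OF D tail q]) simp
  then have "(\<integral>\<^sup>+Y. ennreal ((Z Y)\<^sup>2) \<partial>?M) \<le> ennreal (2 * b\<^sup>2 * (2 * 1 / (1 - ?q)\<^sup>2) + 2 * b'\<^sup>2)"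
    by (rule second_moment_le_affine[OF \<tau>m _ _ Zb]) simp
  then show ?thesis using iZ Z0 by blast
qed

end

section \<open>The algorithm as a martingale\<close>

lemma second_moment_shift:
  assumes M: "prob_space M" and Z: "integrable M Z" "(\<integral>x. Z x \<partial>M) = (0::real)"
    and sq: "(\<integral>\<^sup>+x. ennreal ((Z x)\<^sup>2) \<partial>M) \<le> ennreal C" and C: "0 \<le> C"
  shows "(\<integral>\<^sup>+x. ennreal ((a + Z x)\<^sup>2) \<partial>M) \<le> ennreal (a\<^sup>2 + C)"
proof -
  interpret prob_space M by fact
  have [measurable]: "Z \<in> borel_measurable M" using Z by auto
  have i2: "integrable M (\<lambda>x. (Z x)\<^sup>2)"
    using sq by (intro integrableI_bounded) (auto simp: less_top[symmetric] top_unique)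
  have iz: "integrable M (\<lambda>x. 2 * a * Z x)" using Z by simp
  have i: "integrable M (\<lambda>x. a\<^sup>2 + 2 * a * Z x + (Z x)\<^sup>2)" using iz i2 by simp
  have eq: "(a + Z x)\<^sup>2 = a\<^sup>2 + 2 * a * Z x + (Z x)\<^sup>2" for x by (simp add: power2_eq_square algebra_simps)
  have "(\<integral>\<^sup>+x. ennreal ((a + Z x)\<^sup>2) \<partial>M) = ennreal (\<integral>x. (a + Z x)\<^sup>2 \<partial>M)"
    using i unfolding eq[symmetric] by (intro nn_integral_eq_integral) auto
  also have "(\<integral>x. (a + Z x)\<^sup>2 \<partial>M) = a\<^sup>2 + (\<integral>x. (Z x)\<^sup>2 \<partial>M)"
    unfolding eq using iz i2 Z by (simp add: prob_space)
  also have "(\<integral>x. (Z x)\<^sup>2 \<partial>M) \<le> C"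
  proof -
    have "ennreal (\<integral>x. (Z x)\<^sup>2 \<partial>M) \<le> ennreal C"
      using sq i2 by (subst nn_integral_eq_integral[symmetric]) auto
    then show ?thesis using C by (simp add: ennreal_le_iff)
  qed
  finally show ?thesis by (simp add: ennreal_leI)
qed

text \<open>
  In the application \<open>c\<close> is \<open>\<mu>(f)\<close> and \<open>h\<close> is the solution of the Poisson equation for \<open>f - c\<close>.
\<close>

locale parrep_algorithm = replicated_kernel Om P \<mu> \<S> \<nu> T_corr N T_poll
  for Om :: "'a measure" and P \<mu> \<S> \<nu> T_corr N T_poll +
  fixes f h :: "'a \<Rightarrow> real" and c :: real
  assumes f: "bfun f" and h: "bfun h"
    and poisson: "\<And>x. x \<in> space Om \<Longrightarrow> h x - transition h x = transition (\<lambda>y. f y - c) x"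
begin

text \<open>
  After an even number of steps the next step is a decorrelation step from the current state; after
  an odd number the current state only matters through the set that contains it.
\<close>

definition potential :: "nat \<Rightarrow> 'a \<Rightarrow> real" where
  "potential k x = (if even k then h x + mismatch h x else qsd_mean h x)"

definition compensated :: "nat \<Rightarrow> 'a pr_state \<Rightarrow> real" where
  "compensated k s = f_sim s - c * real (T_sim s) + potential k (X_cur s)"

definition regular :: "nat \<Rightarrow> 'a pr_state \<Rightarrow> bool" where
  "regular k s \<longleftrightarrow> running s \<and> (odd k \<longrightarrow> (\<exists>S\<in>\<S>. X_cur s \<in> S))"

text \<open>
  The transition law of the algorithm when dephasing is exact; it depends on the history only through
  the current state.
\<close>

definition step :: "nat \<Rightarrow> 'a pr_state \<Rightarrow> 'a pr_state measure" where
  "step k s = (if even k then decorrelation_step Om P \<S> T_corr f s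
     else dephasing_parallel_step Om P \<S> N T_poll f (\<lambda>S. \<Pi>\<^sub>M i\<in>{1..N}. \<nu> S) s)"

lemma bfun_potential: "bfun (potential k)"
  unfolding potential_def[abs_def]
  by (cases "even k") (simp_all add: bfun_add h bfun_mismatch bfun_qsd_mean)

lemma measurable_compensated[measurable]: "compensated k \<in> borel_measurable (pr_space Om)"
proof -
  have [measurable]: "potential k \<in> borel_measurable Om" by (rule bfun_measurable[OF bfun_potential])
  show ?thesis unfolding compensated_def[abs_def] by measurable
qed

lemma pred_X_cur: "S \<in> sets Om \<Longrightarrow> Measurable.pred (pr_space Om) (\<lambda>s. X_cur s \<in> S)"
  by (intro pred_sets2[OF _ measurable_state(2)])

lemma measurable_regular[measurable]: "Measurable.pred (pr_space Om) (regular k)"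
proof -
  have [measurable]: "Measurable.pred (pr_space Om) (\<lambda>s. \<exists>S\<in>\<S>. X_cur s \<in> S)"
    by (intro pred_intros_finite(4) sets_S(1) pred_X_cur S_sets)
  show ?thesis unfolding regular_def[abs_def] by measurable
qed

lemma X_cur_in_space: "s \<in> space (pr_space Om) \<Longrightarrow> X_cur s \<in> space Om"
  by (rule measurable_space[OF measurable_state(2)])

lemma measurable_step_even: "decorrelation_step Om P \<S> T_corr f \<in> pr_space Om \<rightarrow>\<^sub>M prob_algebra (pr_space Om)"
proof -
  have [measurable]: "(\<lambda>s. distr (chain_law Om P (return Om (X_cur s))) (pr_space Om) (decorrelation_update \<S> T_corr f s))
      \<in> pr_space Om \<rightarrow>\<^sub>M prob_algebra (pr_space Om)"
    by (intro measurable_distr_prob_space2[OF _ measurable_decorrelation_update] sets_S bfun_measurable f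
         measurable_compose[OF _ measurable_chain_law[OF kernel]]) measurable
  show ?thesis unfolding decorrelation_step_def[abs_def] by measurable
qed

lemma the_S: "S \<in> \<S> \<Longrightarrow> x \<in> S \<Longrightarrow> (THE S. S \<in> \<S> \<and> x \<in> S) = S"
  using S_unique by (intro the_equality) auto

text \<open>
  The step depends on the state through the current set, which takes finitely many values, and
  measurably for each fixed value of it.
\<close>

lemma measurable_step_odd:
  "dephasing_parallel_step Om P \<S> N T_poll f (\<lambda>S. \<Pi>\<^sub>M i\<in>{1..N}. \<nu> S) \<in> pr_space Om \<rightarrow>\<^sub>M prob_algebra (pr_space Om)"
proof -
  \<comment> \<open>\<open>None\<close> for the states in which the algorithm is stuck\<close>
  define label where "label s = (if running s \<and> (\<exists>S\<in>\<S>. X_cur s \<in> S) then Some (THE S. S \<in> \<S> \<and> X_cur s \<in> S) else None)" for s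
  define g where "g l s = (case l of None \<Rightarrow> return (pr_space Om) (stuck s)
    | Some S \<Rightarrow> distr (replicas S) (pr_space Om) (parallel_update N T_poll f S s))" for l s
  let ?L = "insert None (Some ` \<S>)"
  have label_Some: "label s = Some S \<longleftrightarrow> running s \<and> X_cur s \<in> S" if "S \<in> \<S>" for s S
    using that the_S[of _ "X_cur s"] by (auto simp: label_def)
  have label_range: "label s \<in> ?L" for s
    using the_S[of _ "X_cur s"] by (auto simp: label_def)
  have "label \<in> pr_space Om \<rightarrow>\<^sub>M count_space ?L"
  proof (subst measurable_count_space_eq2)
    show "finite ?L" using sets_S(1) by simp
    have S: "label -` {Some S} \<inter> space (pr_space Om) \<in> sets (pr_space Om)" if "S \<in> \<S>" for S
    proof -
      have [measurable]: "Measurable.pred (pr_space Om) (\<lambda>s. X_cur s \<in> S)" by (rule pred_X_cur[OF S_sets[OF that]])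
      have "label -` {Some S} \<inter> space (pr_space Om) = {s\<in>space (pr_space Om). running s \<and> X_cur s \<in> S}"
        using label_Some[OF that] by auto
      also have "\<dots> \<in> sets (pr_space Om)" by measurable
      finally show ?thesis .
    qed
    have "label -` {None} \<inter> space (pr_space Om) = space (pr_space Om) - (\<Union>S\<in>\<S>. label -` {Some S} \<inter> space (pr_space Om))"
      using label_range by (auto, metis imageE)
    also have "\<dots> \<in> sets (pr_space Om)" by (intro sets.Diff sets.top sets.finite_UN sets_S(1) S)
    finally show "label \<in> space (pr_space Om) \<rightarrow> ?L \<and> (\<forall>a\<in>?L. label -` {a} \<inter> space (pr_space Om) \<in> sets (pr_space Om))"
      using label_range S by auto
  qed
  note label = this
  have g: "g l \<in> pr_space Om \<rightarrow>\<^sub>M prob_algebra (pr_space Om)" if "l \<in> ?L" for l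
  proof (cases l)
    case None
    have "(\<lambda>s. return (pr_space Om) (stuck s)) \<in> pr_space Om \<rightarrow>\<^sub>M prob_algebra (pr_space Om)" by measurable
    then show ?thesis by (simp add: g_def[abs_def] None)
  next
    case (Some S)
    then have S: "S \<in> \<S>" using that by auto
    have "(\<lambda>s. distr (replicas S) (pr_space Om) (parallel_update N T_poll f S s)) \<in> pr_space Om \<rightarrow>\<^sub>M prob_algebra (pr_space Om)"
      by (rule measurable_distr_prob_space2[OF measurable_const[OF replicas_law[OF S]]
            measurable_parallel_update[OF S_sets[OF S] bfun_measurable[OF f]]])
    then show ?thesis unfolding g_def[abs_def] Some by (simp only: option.case)
  qed
  have "(\<lambda>s. g (label s) s) \<in> pr_space Om \<rightarrow>\<^sub>M prob_algebra (pr_space Om)"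
    by (rule measurable_compose_countable'[OF g label]) (use sets_S(1) in \<open>simp_all add: countable_finite\<close>)
  also have "(\<lambda>s. g (label s) s) = dephasing_parallel_step Om P \<S> N T_poll f (\<lambda>S. \<Pi>\<^sub>M i\<in>{1..N}. \<nu> S)"
  proof (rule ext)
    fix s
    show "g (label s) s = dephasing_parallel_step Om P \<S> N T_poll f (\<lambda>S. \<Pi>\<^sub>M i\<in>{1..N}. \<nu> S) s"
      unfolding g_def label_def dephasing_parallel_step_def Let_def
      by (cases "running s \<and> (\<exists>S\<in>\<S>. X_cur s \<in> S)") (simp_all only: simp_thms if_True if_False option.case)
  qed
  finally show ?thesis .
qed

lemma measurable_step: "step k \<in> pr_space Om \<rightarrow>\<^sub>M prob_algebra (pr_space Om)"
  using measurable_step_even measurable_step_odd unfolding step_def[abs_def] by (cases "even k") (simp_all only: if_True if_False simp_thms)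

text \<open>
  In both kinds of step the increment of \<open>compensated\<close> is a centred random variable on the space of the
  simulated paths. The constant \<open>a\<close> is kept free: with \<open>a\<close> the current value the estimate controls the
  growth of the second moment of \<open>compensated\<close>, with \<open>a = 0\<close> the size of a single increment.
\<close>

lemma distr_step_facts:
  assumes M: "prob_space M" and upd: "upd \<in> M \<rightarrow>\<^sub>M pr_space Om" and C: "0 \<le> C"
    and Z: "integrable M Z" "(\<integral>x. Z x \<partial>M) = 0" "(\<integral>\<^sup>+x. ennreal ((Z x)\<^sup>2) \<partial>M) \<le> ennreal C"
    and eq: "AE x in M. compensated (Suc k) (upd x) - compensated k s = Z x"
    and reg: "AE x in M. regular (Suc k) (upd x) \<and> T_sim (upd x) \<ge> t"
  shows "AE s' in distr M (pr_space Om) upd. regular (Suc k) s' \<and> T_sim s' \<ge> t"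
    and "(\<integral>\<^sup>+s'. ennreal ((a + (compensated (Suc k) s' - compensated k s))\<^sup>2) \<partial>distr M (pr_space Om) upd) \<le> ennreal (a\<^sup>2 + C)"
proof -
  have "{s'\<in>space (pr_space Om). regular (Suc k) s' \<and> T_sim s' \<ge> t} \<in> sets (pr_space Om)" by measurable
  then show "AE s' in distr M (pr_space Om) upd. regular (Suc k) s' \<and> T_sim s' \<ge> t"
    using reg by (subst AE_distr_iff[OF upd])
  have "(\<integral>\<^sup>+s'. ennreal ((a + (compensated (Suc k) s' - compensated k s))\<^sup>2) \<partial>distr M (pr_space Om) upd) =
      (\<integral>\<^sup>+x. ennreal ((a + (compensated (Suc k) (upd x) - compensated k s))\<^sup>2) \<partial>M)"
    by (rule nn_integral_distr[OF upd]) measurable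
  also have "\<dots> = (\<integral>\<^sup>+x. ennreal ((a + Z x)\<^sup>2) \<partial>M)"
  proof (rule nn_integral_cong_AE)
    show "AE x in M. ennreal ((a + (compensated (Suc k) (upd x) - compensated k s))\<^sup>2) = ennreal ((a + Z x)\<^sup>2)"
      using eq by eventually_elim (simp only:)
  qed
  also have "\<dots> \<le> ennreal (a\<^sup>2 + C)" by (rule second_moment_shift[OF M Z C])
  finally show "(\<integral>\<^sup>+s'. ennreal ((a + (compensated (Suc k) s' - compensated k s))\<^sup>2) \<partial>distr M (pr_space Om) upd) \<le> ennreal (a\<^sup>2 + C)" .
qed

lemma decorrelation_step_facts:
  "\<exists>C\<ge>0. \<forall>k s. even k \<longrightarrow> s \<in> space (pr_space Om) \<longrightarrow> regular k s \<longrightarrow>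
     (AE s' in step k s. regular (Suc k) s' \<and> T_sim s' \<ge> T_sim s) \<and>
     (\<forall>a. (\<integral>\<^sup>+s'. ennreal ((a + (compensated (Suc k) s' - compensated k s))\<^sup>2) \<partial>step k s) \<le> ennreal (a\<^sup>2 + C))"
proof -
  let ?\<phi> = "\<lambda>y. f y - c"
  have \<phi>: "bfun ?\<phi>" by (intro bfun_diff f bfun_const)
  define Z where "Z x \<omega> = (\<Sum>l<decorrelation_time \<omega>. ?\<phi> (\<omega> (Suc l))) + qsd_mean h (\<omega> (decorrelation_time \<omega>)) - (h x + mismatch h x)" for x \<omega>
  obtain C where C: "\<And>x. x \<in> space Om \<Longrightarrow> integrable (chain_law Om P (return Om x)) (Z x)"
    "\<And>x. x \<in> space Om \<Longrightarrow> (\<integral>\<omega>. Z x \<omega> \<partial>chain_law Om P (return Om x)) = 0"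
    "\<And>x. x \<in> space Om \<Longrightarrow> (\<integral>\<^sup>+\<omega>. ennreal ((Z x \<omega>)\<^sup>2) \<partial>chain_law Om P (return Om x)) \<le> ennreal C"
    using decorrelation_increment[OF h \<phi> poisson] unfolding Z_def by blast
  define C' where "C' = max 0 C"
  have C': "0 \<le> C'" "ennreal C \<le> ennreal C'" by (auto simp: C'_def intro: ennreal_leI)
  have "(AE s' in step k s. regular (Suc k) s' \<and> T_sim s' \<ge> T_sim s) \<and>
     (\<forall>a. (\<integral>\<^sup>+s'. ennreal ((a + (compensated (Suc k) s' - compensated k s))\<^sup>2) \<partial>step k s) \<le> ennreal (a\<^sup>2 + C'))"
    if k: "even k" and s: "s \<in> space (pr_space Om)" and reg: "regular k s" for k s
  proof -
    define x where "x = X_cur s"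
    have x: "x \<in> space Om" unfolding x_def by (rule X_cur_in_space[OF s])
    let ?M = "chain_law Om P (return Om x)" let ?upd = "decorrelation_update \<S> T_corr f s"
    have \<zeta>: "return Om x \<in> space (prob_algebra Om)" by (rule return_in_prob_algebra[OF x])
    interpret prob_space ?M by (rule prob_space_chain[OF \<zeta>])
    have [measurable_cong]: "sets ?M = sets paths" by (rule sets_chain[OF \<zeta>])
    have upd: "?upd \<in> ?M \<rightarrow>\<^sub>M pr_space Om"
      using measurable_compose[OF measurable_Pair1'[OF s] measurable_decorrelation_update[OF sets_S(1,2) bfun_measurable[OF f]]]
      by (simp add: measurable_chain_iff[OF \<zeta>])
    have step: "step k s = distr ?M (pr_space Om) ?upd"
      using k reg by (simp add: step_def decorrelation_step_def regular_def x_def)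
    obtain B \<rho> where "0 \<le> \<rho>" "\<rho> < 1" "\<And>n. prob {\<omega>\<in>space ?M. \<forall>i<n. \<not> decorrelated \<S> T_corr \<omega> i} \<le> B * \<rho> ^ n"
      using decorrelation_tail \<zeta> by blast
    then have AE: "AE \<omega> in ?M. \<exists>n. decorrelated \<S> T_corr \<omega> n"
      by (intro geometric_stopping_AE) measurable
    have upd_eq: "?upd \<omega> = (True, \<omega> (decorrelation_time \<omega>), f_sim s + (\<Sum>n=1..decorrelation_time \<omega>. f (\<omega> n)), T_sim s + decorrelation_time \<omega>)"
      if "\<exists>n. decorrelated \<S> T_corr \<omega> n" for \<omega>
      using that unfolding decorrelation_update_def Let_def decorrelation_time_def by (simp only: if_True)
    have shift: "(\<Sum>n=1..m. g n) = (\<Sum>l<m. g (Suc l))" for m and g :: "nat \<Rightarrow> real"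
      by (simp only: One_nat_def sum.atLeast1_atMost_eq)
    have eq: "AE \<omega> in ?M. compensated (Suc k) (?upd \<omega>) - compensated k s = Z x \<omega>"
      using AE
    proof eventually_elim
      case (elim \<omega>)
      show ?case
        using k unfolding upd_eq[OF elim] compensated_def Z_def shift potential_def x_def
        by (simp add: f_sim_def T_sim_def X_cur_def sum_subtractf algebra_simps)
    qed
    have regs: "AE \<omega> in ?M. regular (Suc k) (?upd \<omega>) \<and> T_sim (?upd \<omega>) \<ge> T_sim s"
      using AE
    proof eventually_elim
      case (elim \<omega>)
      then have "decorrelated \<S> T_corr \<omega> (decorrelation_time \<omega>)" unfolding decorrelation_time_def by (rule LeastI_ex)
      then obtain S where "S \<in> \<S>" "\<forall>j<T_corr. \<omega> (decorrelation_time \<omega> - j) \<in> S" unfolding decorrelated_def by blast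
      then have "S \<in> \<S>" "\<omega> (decorrelation_time \<omega>) \<in> S" using T_corr by (auto dest: spec[of _ 0])
      then show ?case unfolding upd_eq[OF elim] regular_def by (auto simp: running_def X_cur_def T_sim_def)
    qed
    show ?thesis
      unfolding step
      using distr_step_facts[OF prob_space_chain[OF \<zeta>] upd C'(1) C(1)[OF x] C(2)[OF x] order_trans[OF C(3)[OF x] C'(2)] eq regs]
      by blast
  qed
  with C'(1) show ?thesis by blast
qed

lemma parallel_step_facts:
  "\<exists>C\<ge>0. \<forall>k s. odd k \<longrightarrow> s \<in> space (pr_space Om) \<longrightarrow> regular k s \<longrightarrow>
     (AE s' in step k s. regular (Suc k) s' \<and> T_sim s' \<ge> Suc (T_sim s)) \<and>
     (\<forall>a. (\<integral>\<^sup>+s'. ennreal ((a + (compensated (Suc k) s' - compensated k s))\<^sup>2) \<partial>step k s) \<le> ennreal (a\<^sup>2 + C))"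
proof -
  let ?\<phi> = "\<lambda>y. f y - c"
  have \<phi>: "bfun ?\<phi>" by (intro bfun_diff f bfun_const)
  define Z where "Z S Y = (\<Sum>l\<le>exit_poll S Y. ?\<phi> (poll Y l)) + (h (poll Y (exit_poll S Y)) + mismatch h (poll Y (exit_poll S Y))) - (\<integral>y. h y \<partial>\<nu> S)" for S Y
  have "\<forall>S\<in>\<S>. \<exists>C. integrable (replicas S) (Z S) \<and> (\<integral>Y. Z S Y \<partial>replicas S) = 0 \<and>
    (\<integral>\<^sup>+Y. ennreal ((Z S Y)\<^sup>2) \<partial>replicas S) \<le> ennreal C"
    using parallel_increment[OF _ h \<phi> poisson] unfolding Z_def by blast
  then obtain C where C: "\<And>S. S \<in> \<S> \<Longrightarrow> integrable (replicas S) (Z S)"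
    "\<And>S. S \<in> \<S> \<Longrightarrow> (\<integral>Y. Z S Y \<partial>replicas S) = 0"
    "\<And>S. S \<in> \<S> \<Longrightarrow> (\<integral>\<^sup>+Y. ennreal ((Z S Y)\<^sup>2) \<partial>replicas S) \<le> ennreal (C S)"
    by metis
  define C' where "C' = (\<Sum>S\<in>\<S>. \<bar>C S\<bar>)"
  have C'0: "0 \<le> C'" by (simp add: C'_def sum_nonneg)
  have C'1: "ennreal (C S) \<le> ennreal C'" if "S \<in> \<S>" for S
  proof -
    have "\<bar>C S\<bar> \<le> C'" unfolding C'_def using that sets_S(1) by (intro member_le_sum) auto
    then show ?thesis by (intro ennreal_leI) linarith
  qed
  have "(AE s' in step k s. regular (Suc k) s' \<and> T_sim s' \<ge> Suc (T_sim s)) \<and>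
     (\<forall>a. (\<integral>\<^sup>+s'. ennreal ((a + (compensated (Suc k) s' - compensated k s))\<^sup>2) \<partial>step k s) \<le> ennreal (a\<^sup>2 + C'))"
    if k: "odd k" and s: "s \<in> space (pr_space Om)" and reg: "regular k s" for k s
  proof -
    obtain S where S: "S \<in> \<S>" "X_cur s \<in> S" using k reg by (auto simp: regular_def)
    have run: "running s" using reg by (simp add: regular_def)
    let ?M = "replicas S" let ?upd = "parallel_update N T_poll f S s"
    have upd: "?upd \<in> ?M \<rightarrow>\<^sub>M pr_space Om"
      using measurable_compose[OF measurable_Pair1'[OF s] measurable_parallel_update[OF S_sets[OF S(1)] bfun_measurable[OF f], of N T_poll]]
      unfolding measurable_cong_sets[OF sets_replicas[OF S(1)] refl] by simp
    have cond: "running s \<and> (\<exists>S\<in>\<S>. X_cur s \<in> S)" using S run by blast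
    have step: "step k s = distr ?M (pr_space Om) ?upd"
      using k cond unfolding step_def dephasing_parallel_step_def Let_def the_S[OF S] by (simp only: simp_thms if_True if_False)
    have upd_eq: "?upd Y = (True, poll Y (exit_poll S Y), f_sim s + (\<Sum>l\<le>exit_poll S Y. f (poll Y l)), T_sim s + Suc (exit_poll S Y))"
      if "\<exists>n. poll Y n \<notin> S" for Y
      unfolding exit_poll_def by (rule parallel_update_eq[OF that])
    have eq: "AE Y in ?M. compensated (Suc k) (?upd Y) - compensated k s = Z S Y"
      using AE_exit[OF S(1)]
    proof eventually_elim
      case (elim Y)
      show ?case
        using k unfolding upd_eq[OF elim] compensated_def Z_def potential_def
        by (simp add: f_sim_def T_sim_def X_cur_def[of "(_, _)"] sum_subtractf algebra_simps qsd_mean_eq[OF S])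
    qed
    have regs: "AE Y in ?M. regular (Suc k) (?upd Y) \<and> T_sim (?upd Y) \<ge> Suc (T_sim s)"
      using AE_exit[OF S(1)]
    proof eventually_elim
      case (elim Y)
      show ?case using k unfolding upd_eq[OF elim] regular_def by (auto simp: running_def T_sim_def)
    qed
    show ?thesis
      unfolding step
      using distr_step_facts[OF prob_space_replicas[OF S(1)] upd C'0 C(1)[OF S(1)] C(2)[OF S(1)] order_trans[OF C(3)[OF S(1)] C'1[OF S(1)]] eq regs]
      by blast
  qed
  with C'0 show ?thesis by blast
qed

lemma step_facts:
  "\<exists>C\<ge>0. \<forall>k s. s \<in> space (pr_space Om) \<longrightarrow> regular k s \<longrightarrow>
     (AE s' in step k s. regular (Suc k) s' \<and> T_sim s' \<ge> T_sim s + (if odd k then 1 else 0)) \<and>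
     (\<forall>a. (\<integral>\<^sup>+s'. ennreal ((a + (compensated (Suc k) s' - compensated k s))\<^sup>2) \<partial>step k s) \<le> ennreal (a\<^sup>2 + C))"
proof -
  obtain C1 where C1: "0 \<le> C1" "\<And>k s. even k \<Longrightarrow> s \<in> space (pr_space Om) \<Longrightarrow> regular k s \<Longrightarrow>
     (AE s' in step k s. regular (Suc k) s' \<and> T_sim s' \<ge> T_sim s) \<and>
     (\<forall>a. (\<integral>\<^sup>+s'. ennreal ((a + (compensated (Suc k) s' - compensated k s))\<^sup>2) \<partial>step k s) \<le> ennreal (a\<^sup>2 + C1))"
    using decorrelation_step_facts by blast
  obtain C2 where C2: "0 \<le> C2" "\<And>k s. odd k \<Longrightarrow> s \<in> space (pr_space Om) \<Longrightarrow> regular k s \<Longrightarrow>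
     (AE s' in step k s. regular (Suc k) s' \<and> T_sim s' \<ge> Suc (T_sim s)) \<and>
     (\<forall>a. (\<integral>\<^sup>+s'. ennreal ((a + (compensated (Suc k) s' - compensated k s))\<^sup>2) \<partial>step k s) \<le> ennreal (a\<^sup>2 + C2))"
    using parallel_step_facts by blast
  have up: "ennreal (a\<^sup>2 + C1) \<le> ennreal (a\<^sup>2 + (C1 + C2))" "ennreal (a\<^sup>2 + C2) \<le> ennreal (a\<^sup>2 + (C1 + C2))" for a
    using C1(1) C2(1) by (auto intro!: ennreal_leI)
  show ?thesis
  proof (rule exI[of _ "C1 + C2"], intro conjI allI impI)
    show "0 \<le> C1 + C2" using C1(1) C2(1) by simp
    fix k s assume s: "s \<in> space (pr_space Om)" "regular k s"
    show "AE s' in step k s. regular (Suc k) s' \<and> T_sim s' \<ge> T_sim s + (if odd k then 1 else 0)"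
      using C1(2)[OF _ s] C2(2)[OF _ s] by (cases "even k") simp_all
    fix a
    show "(\<integral>\<^sup>+s'. ennreal ((a + (compensated (Suc k) s' - compensated k s))\<^sup>2) \<partial>step k s) \<le> ennreal (a\<^sup>2 + (C1 + C2))"
      using C1(2)[OF _ s, THEN conjunct2, THEN spec, of a] C2(2)[OF _ s, THEN conjunct2, THEN spec, of a] up[of a]
      by (cases "even k") (meson order_trans)+
  qed
qed

end

locale parrep_process = parrep_algorithm Om P \<mu> \<S> \<nu> T_corr N T_poll f h c
  for Om :: "'a measure" and P \<mu> \<S> \<nu> T_corr N T_poll f h c +
  fixes deph :: "'a dephasing" and \<xi> :: "'a measure"
  assumes exact_dephasing: "exact_dephasing Om \<S> N \<nu> deph"
    and xi: "\<xi> \<in> space (prob_algebra Om)"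
begin

abbreviation law :: "(nat \<Rightarrow> 'a pr_state) measure" where
  "law \<equiv> parrep_law Om P \<S> N T_corr T_poll deph f \<xi>"

abbreviation histories :: "(nat \<Rightarrow> 'a pr_state) measure" where
  "histories \<equiv> \<Pi>\<^sub>M j\<in>(UNIV::nat set). pr_space Om"

abbreviation start :: "'a pr_state measure" where
  "start \<equiv> distr \<xi> (pr_space Om) (\<lambda>x. (True, x, 0, 0))"

lemma measurable_initial: "(\<lambda>x. (True, x, 0, 0)) \<in> Om \<rightarrow>\<^sub>M pr_space Om"
  unfolding pr_space_def by measurable

lemma parrep_kernel_0: "parrep_kernel Om P \<S> N T_corr T_poll deph f \<xi> 0 \<eta> = start"
  by (simp add: parrep_kernel_def)

lemma parrep_kernel_Suc:
  assumes \<eta>: "\<eta> \<in> space (\<Pi>\<^sub>M j\<in>{0..<Suc k}. pr_space Om)"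
  shows "parrep_kernel Om P \<S> N T_corr T_poll deph f \<xi> (Suc k) \<eta> = step k (\<eta> k)"
proof (cases "even k")
  case True
  then show ?thesis by (simp add: parrep_kernel_def step_def)
next
  case False
  have "\<eta> \<in> space (\<Pi>\<^sub>M j\<in>{0..k}. pr_space Om)" using \<eta> by (simp add: atLeastLessThanSuc_atLeastAtMost)
  then have deph: "deph k \<eta> S = (\<Pi>\<^sub>M i\<in>{1..N}. \<nu> S)" if "S \<in> \<S>" for S
    using exact_dephasing that unfolding exact_dephasing_def by blast
  have "dephasing_parallel_step Om P \<S> N T_poll f (deph k \<eta>) (\<eta> k) =
      dephasing_parallel_step Om P \<S> N T_poll f (\<lambda>S. \<Pi>\<^sub>M i\<in>{1..N}. \<nu> S) (\<eta> k)"
  proof (cases "running (\<eta> k) \<and> (\<exists>S\<in>\<S>. X_cur (\<eta> k) \<in> S)")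
    case True
    then obtain S where S: "S \<in> \<S>" "X_cur (\<eta> k) \<in> S" by blast
    show ?thesis unfolding dephasing_parallel_step_def Let_def the_S[OF S] deph[OF S(1)] ..
  next
    case False
    then show ?thesis unfolding dephasing_parallel_step_def by (simp only: if_False)
  qed
  then show ?thesis using False by (simp add: parrep_kernel_def step_def)
qed

lemma measurable_parrep_kernel:
  "parrep_kernel Om P \<S> N T_corr T_poll deph f \<xi> i \<in> (\<Pi>\<^sub>M j\<in>{0..<i}. pr_space Om) \<rightarrow>\<^sub>M prob_algebra (pr_space Om)"
proof (cases i)
  case 0
  have "start \<in> space (prob_algebra (pr_space Om))"
    by (rule measurable_space[OF measurable_distr_prob_space[OF measurable_initial] xi])
  then show ?thesis unfolding 0 parrep_kernel_0[abs_def] by (rule measurable_const)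
next
  case (Suc k)
  have "(\<lambda>\<eta>. \<eta> k) \<in> (\<Pi>\<^sub>M j\<in>{0..<Suc k}. pr_space Om) \<rightarrow>\<^sub>M pr_space Om"
    by (rule measurable_component_singleton) simp
  from measurable_compose[OF this measurable_step]
  have "(\<lambda>\<eta>. step k (\<eta> k)) \<in> (\<Pi>\<^sub>M j\<in>{0..<Suc k}. pr_space Om) \<rightarrow>\<^sub>M prob_algebra (pr_space Om)" .
  then show ?thesis unfolding Suc by (subst measurable_cong[OF parrep_kernel_Suc])
qed

lemma law_facts: "prob_space law" "sets law = sets histories" "space law = space histories"
  using ionescu_tulcea_law_prob[OF measurable_parrep_kernel]
  by (auto simp: parrep_law_def space_prob_algebra dest: sets_eq_imp_space_eq)

lemma state_in_space: "\<omega> \<in> space law \<Longrightarrow> \<omega> k \<in> space (pr_space Om)"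
  by (simp add: law_facts space_PiM PiE_iff)

lemma pr_space_not_empty: "space (pr_space Om) \<noteq> {}"
proof -
  obtain x where "x \<in> space Om" using space_not_empty[OF xi] by blast
  from measurable_space[OF measurable_initial this] show ?thesis by blast
qed

lemma nn_integral_law_step:
  assumes H: "(\<lambda>(s, s'). H s s') \<in> borel_measurable (pr_space Om \<Otimes>\<^sub>M pr_space Om)"
  shows "(\<integral>\<^sup>+\<omega>. H (\<omega> k) (\<omega> (Suc k)) \<partial>law) = (\<integral>\<^sup>+\<omega>. (\<integral>\<^sup>+s'. H (\<omega> k) s' \<partial>step k (\<omega> k)) \<partial>law)"
proof -
  let ?H = "\<lambda>\<omega>. H (\<omega> k) (\<omega> (Suc k))" let ?Q = "parrep_kernel Om P \<S> N T_corr T_poll deph f \<xi>"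
  have "(\<integral>\<^sup>+\<omega>. ?H \<omega> \<partial>law) = (\<integral>\<^sup>+\<omega>. \<integral>\<^sup>+y. ?H (fun_upd \<omega> (Suc k) y) \<partial>(?Q (Suc k) (restrict \<omega> {0..<Suc k})) \<partial>law)"
    unfolding parrep_law_def
  proof (rule nn_integral_ionescu_tulcea_step[OF measurable_parrep_kernel pr_space_not_empty])
    have "(\<lambda>\<omega>. (\<omega> k, \<omega> (Suc k))) \<in> histories \<rightarrow>\<^sub>M pr_space Om \<Otimes>\<^sub>M pr_space Om" by measurable
    from measurable_compose[OF this H] show "?H \<in> borel_measurable histories" by simp
    fix \<omega> \<omega>' :: "nat \<Rightarrow> 'a pr_state" assume "\<forall>i\<le>Suc k. \<omega> i = \<omega>' i"
    then show "?H \<omega> = ?H \<omega>'" by simp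
  qed
  also have "\<dots> = (\<integral>\<^sup>+\<omega>. (\<integral>\<^sup>+s'. H (\<omega> k) s' \<partial>step k (\<omega> k)) \<partial>law)"
  proof (intro nn_integral_cong)
    fix \<omega> assume "\<omega> \<in> space law"
    then have "restrict \<omega> {0..<Suc k} \<in> space (\<Pi>\<^sub>M j\<in>{0..<Suc k}. pr_space Om)"
      using state_in_space by (auto simp: space_PiM)
    from parrep_kernel_Suc[OF this]
    show "(\<integral>\<^sup>+y. ?H (fun_upd \<omega> (Suc k) y) \<partial>(?Q (Suc k) (restrict \<omega> {0..<Suc k}))) = (\<integral>\<^sup>+s'. H (\<omega> k) s' \<partial>step k (\<omega> k))"
      by simp
  qed
  finally show ?thesis .
qed

lemma nn_integral_law_start:
  assumes H[measurable]: "H \<in> borel_measurable (pr_space Om)"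
  shows "(\<integral>\<^sup>+\<omega>. H (\<omega> 0) \<partial>law) = (\<integral>\<^sup>+x. H (True, x, 0, 0) \<partial>\<xi>)"
proof -
  interpret prob_space law by (rule law_facts)
  let ?H = "\<lambda>\<omega>. H (\<omega> (0::nat))" let ?Q = "parrep_kernel Om P \<S> N T_corr T_poll deph f \<xi>"
  have "(\<integral>\<^sup>+\<omega>. ?H \<omega> \<partial>law) = (\<integral>\<^sup>+\<omega>. \<integral>\<^sup>+y. ?H (fun_upd \<omega> 0 y) \<partial>(?Q 0 (restrict \<omega> {0..<0})) \<partial>law)"
    unfolding parrep_law_def
  proof (rule nn_integral_ionescu_tulcea_step[OF measurable_parrep_kernel pr_space_not_empty])
    show "?H \<in> borel_measurable histories" by measurable
    fix \<omega> \<omega>' :: "nat \<Rightarrow> 'a pr_state" assume "\<forall>i\<le>0. \<omega> i = \<omega>' i"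
    then show "?H \<omega> = ?H \<omega>'" by simp
  qed
  also have "\<dots> = (\<integral>\<^sup>+s. H s \<partial>start)"
    unfolding parrep_kernel_0 by (simp add: emeasure_space_1)
  also have "\<dots> = (\<integral>\<^sup>+x. H (True, x, 0, 0) \<partial>\<xi>)"
    using measurable_initial by (intro nn_integral_distr) (simp_all add: measurable_cong_sets[OF law_prob(2)[OF xi] refl])
  finally show ?thesis .
qed

lemma AE_regular: "AE \<omega> in law. regular k (\<omega> k)"
  and AE_T_sim_step: "AE \<omega> in law. T_sim (\<omega> (Suc k)) \<ge> T_sim (\<omega> k) + (if odd k then 1 else 0)"
proof -
  have [measurable_cong]: "sets law = sets histories" by (rule law_facts)
  obtain C where C: "\<And>k s. s \<in> space (pr_space Om) \<Longrightarrow> regular k s \<Longrightarrow>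
     AE s' in step k s. regular (Suc k) s' \<and> T_sim s' \<ge> T_sim s + (if odd k then 1 else 0)"
    using step_facts by blast
  have next_state: "AE \<omega> in law. regular (Suc k) (\<omega> (Suc k)) \<and> T_sim (\<omega> (Suc k)) \<ge> T_sim (\<omega> k) + (if odd k then 1 else 0)"
    if reg: "AE \<omega> in law. regular k (\<omega> k)" for k
  proof -
    define H where "H s s' = (if regular (Suc k) s' \<and> T_sim s' \<ge> T_sim s + (if odd k then 1 else 0) then 0 else 1 :: ennreal)" for s s' :: "'a pr_state"
    have Hm[measurable]: "(\<lambda>(s, s'). H s s') \<in> borel_measurable (pr_space Om \<Otimes>\<^sub>M pr_space Om)"
    proof -
      have [measurable]: "(\<lambda>x. real (T_sim (fst x))) \<in> borel_measurable (pr_space Om \<Otimes>\<^sub>M pr_space Om)"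
        "(\<lambda>x. real (T_sim (snd x))) \<in> borel_measurable (pr_space Om \<Otimes>\<^sub>M pr_space Om)"
        by measurable
      have [measurable]: "Measurable.pred (pr_space Om \<Otimes>\<^sub>M pr_space Om) (\<lambda>x. regular (Suc k) (snd x))"
        by (rule measurable_compose[OF measurable_snd measurable_regular])
      have "Measurable.pred (pr_space Om \<Otimes>\<^sub>M pr_space Om) (\<lambda>x. real n + real (T_sim (fst x)) \<le> real (T_sim (snd x)))" for n
        by measurable
      then have "Measurable.pred (pr_space Om \<Otimes>\<^sub>M pr_space Om) (\<lambda>x. n + T_sim (fst x) \<le> T_sim (snd x))" for n
        by (simp only: of_nat_add[symmetric] of_nat_le_iff)
      from this[of "if odd k then 1 else 0"]
      have [measurable]: "Measurable.pred (pr_space Om \<Otimes>\<^sub>M pr_space Om) (\<lambda>x. T_sim (fst x) + (if odd k then 1 else 0) \<le> T_sim (snd x))"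
        by (simp only: add.commute)
      show ?thesis unfolding H_def split_beta' by measurable
    qed
    have "(\<integral>\<^sup>+\<omega>. H (\<omega> k) (\<omega> (Suc k)) \<partial>law) = (\<integral>\<^sup>+\<omega>. (\<integral>\<^sup>+s'. H (\<omega> k) s' \<partial>step k (\<omega> k)) \<partial>law)"
      by (rule nn_integral_law_step[OF Hm])
    also have "\<dots> = (\<integral>\<^sup>+\<omega>. 0 \<partial>law)"
    proof (rule nn_integral_cong_AE)
      show "AE \<omega> in law. (\<integral>\<^sup>+s'. H (\<omega> k) s' \<partial>step k (\<omega> k)) = 0"
        using reg AE_space
      proof eventually_elim
        case (elim \<omega>)
        have "(\<integral>\<^sup>+s'. H (\<omega> k) s' \<partial>step k (\<omega> k)) = (\<integral>\<^sup>+s'. 0 \<partial>step k (\<omega> k))"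
        proof (rule nn_integral_cong_AE)
          show "AE s' in step k (\<omega> k). H (\<omega> k) s' = 0"
            using C[OF state_in_space[OF elim(2)] elim(1)] by eventually_elim (simp add: H_def)
        qed
        then show ?case by simp
      qed
    qed
    finally have zero: "(\<integral>\<^sup>+\<omega>. H (\<omega> k) (\<omega> (Suc k)) \<partial>law) = 0" by simp
    have "(\<lambda>\<omega>. (\<omega> k, \<omega> (Suc k))) \<in> law \<rightarrow>\<^sub>M pr_space Om \<Otimes>\<^sub>M pr_space Om" by measurable
    from measurable_compose[OF this Hm] have "(\<lambda>\<omega>. H (\<omega> k) (\<omega> (Suc k))) \<in> borel_measurable law" by simp
    from nn_integral_0_iff_AE[OF this] zero have "AE \<omega> in law. H (\<omega> k) (\<omega> (Suc k)) = 0" by simp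
    then show ?thesis by eventually_elim (simp add: H_def split: if_split_asm)
  qed
  show reg: "AE \<omega> in law. regular k (\<omega> k)" for k
  proof (induction k)
    case 0
    define H where "H s = (if regular 0 s then 0 else 1 :: ennreal)" for s :: "'a pr_state"
    have [measurable]: "H \<in> borel_measurable (pr_space Om)" unfolding H_def[abs_def] by measurable
    have "(\<integral>\<^sup>+\<omega>. H (\<omega> 0) \<partial>law) = (\<integral>\<^sup>+x. H (True, x, 0, 0) \<partial>\<xi>)" by (rule nn_integral_law_start) measurable
    also have "\<dots> = 0" by (simp add: H_def regular_def running_def)
    finally have "AE \<omega> in law. H (\<omega> 0) = 0" by (subst nn_integral_0_iff_AE[symmetric]) measurable
    then show ?case by eventually_elim (simp add: H_def split: if_split_asm)
  next
    case (Suc k)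
    from next_state[OF Suc] show ?case by eventually_elim blast
  qed
  from next_state[OF reg] show "AE \<omega> in law. T_sim (\<omega> (Suc k)) \<ge> T_sim (\<omega> k) + (if odd k then 1 else 0)"
    by eventually_elim blast
qed

text \<open>
  Each step adds at most a constant to the second moment of \<open>compensated\<close>, which therefore grows at
  most linearly in the number of steps.
\<close>

lemma AE_compensated_average: "AE \<omega> in law. (\<lambda>k. compensated k (\<omega> k) / real k) \<longlonglongrightarrow> 0"
proof -
  have [measurable_cong]: "sets law = sets histories" by (rule law_facts)
  interpret prob_space law by (rule law_facts)
  interpret xi: prob_space \<xi> by (rule law_prob[OF xi])
  obtain C where C0: "0 \<le> C" and C: "\<And>k s a. s \<in> space (pr_space Om) \<Longrightarrow> regular k s \<Longrightarrow>
     (\<integral>\<^sup>+s'. ennreal ((a + (compensated (Suc k) s' - compensated k s))\<^sup>2) \<partial>step k s) \<le> ennreal (a\<^sup>2 + C)"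
    using step_facts by blast
  obtain B where B: "0 < B" "\<And>x. x \<in> space Om \<Longrightarrow> \<bar>potential 0 x\<bar> \<le> B" using bfun_bound[OF bfun_potential] by blast
  have H: "(\<lambda>(s, s'). ennreal ((a * compensated k s + (compensated (Suc k) s' - compensated k s))\<^sup>2)) \<in> borel_measurable (pr_space Om \<Otimes>\<^sub>M pr_space Om)" for a k
    by measurable
  have second: "(\<integral>\<^sup>+\<omega>. ennreal ((a * compensated k (\<omega> k) + (compensated (Suc k) (\<omega> (Suc k)) - compensated k (\<omega> k)))\<^sup>2) \<partial>law)
      \<le> (\<integral>\<^sup>+\<omega>. ennreal ((a * compensated k (\<omega> k))\<^sup>2 + C) \<partial>law)" for a k
    unfolding nn_integral_law_step[OF H]
  proof (rule nn_integral_mono_AE)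
    show "AE \<omega> in law. (\<integral>\<^sup>+s'. ennreal ((a * compensated k (\<omega> k) + (compensated (Suc k) s' - compensated k (\<omega> k)))\<^sup>2) \<partial>step k (\<omega> k))
        \<le> ennreal ((a * compensated k (\<omega> k))\<^sup>2 + C)"
      using AE_regular[of k] AE_space by eventually_elim (intro C state_in_space)
  qed
  have incr: "(\<integral>\<^sup>+\<omega>. ennreal ((compensated (Suc k) (\<omega> (Suc k)) - compensated k (\<omega> k))\<^sup>2) \<partial>law) \<le> ennreal C" for k
    using second[of 0 k] by (simp add: emeasure_space_1)
  have total: "(\<integral>\<^sup>+\<omega>. ennreal ((compensated k (\<omega> k))\<^sup>2) \<partial>law) \<le> ennreal ((B\<^sup>2 + C) * (real k + 1))" for k
  proof (induction k)
    case 0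
    have "(\<integral>\<^sup>+\<omega>. ennreal ((compensated 0 (\<omega> 0))\<^sup>2) \<partial>law) = (\<integral>\<^sup>+x. ennreal ((compensated 0 (True, x, 0, 0))\<^sup>2) \<partial>\<xi>)"
      by (rule nn_integral_law_start) measurable
    also have "\<dots> \<le> (\<integral>\<^sup>+x. ennreal (B\<^sup>2) \<partial>\<xi>)"
    proof (intro nn_integral_mono ennreal_leI)
      fix x assume "x \<in> space \<xi>"
      then have "\<bar>potential 0 x\<bar> \<le> B" by (intro B) (simp add: law_prob[OF xi])
      then have "(potential 0 x)\<^sup>2 \<le> B\<^sup>2" by (metis abs_ge_zero power2_abs power_mono)
      then show "(compensated 0 (True, x, 0, 0))\<^sup>2 \<le> B\<^sup>2"
        by (simp add: compensated_def f_sim_def T_sim_def X_cur_def)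
    qed
    also have "\<dots> \<le> ennreal ((B\<^sup>2 + C) * (real 0 + 1))"
      using C0 by (simp add: xi.emeasure_space_1 ennreal_leI)
    finally show ?case .
  next
    case (Suc k)
    have "(\<integral>\<^sup>+\<omega>. ennreal ((compensated (Suc k) (\<omega> (Suc k)))\<^sup>2) \<partial>law) \<le> (\<integral>\<^sup>+\<omega>. ennreal ((compensated k (\<omega> k))\<^sup>2 + C) \<partial>law)"
      using second[of 1 k] by simp
    also have "\<dots> = (\<integral>\<^sup>+\<omega>. ennreal ((compensated k (\<omega> k))\<^sup>2) + ennreal C \<partial>law)"
      using C0 by simp
    also have "\<dots> = (\<integral>\<^sup>+\<omega>. ennreal ((compensated k (\<omega> k))\<^sup>2) \<partial>law) + (\<integral>\<^sup>+\<omega>. ennreal C \<partial>law)"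
      by (rule nn_integral_add) measurable
    also have "\<dots> \<le> ennreal ((B\<^sup>2 + C) * (real k + 1)) + ennreal C"
      using Suc by (intro add_mono) (simp_all add: emeasure_space_1)
    also have "\<dots> = ennreal ((B\<^sup>2 + C) * (real k + 1) + C)" using C0 by (intro ennreal_plus[symmetric]) auto
    also have "\<dots> \<le> ennreal ((B\<^sup>2 + C) * (real (Suc k) + 1))"
      using C0 by (intro ennreal_leI) (simp add: algebra_simps)
    finally show ?case .
  qed
  show ?thesis
  proof (rule AE_average_tendsto_0)
    show "(\<lambda>\<omega>. compensated k (\<omega> k)) \<in> borel_measurable law" for k by measurable
    show "0 \<le> B\<^sup>2 + C" using C0 by simp
    show "(\<integral>\<^sup>+\<omega>. ennreal ((compensated k (\<omega> k))\<^sup>2) \<partial>law) \<le> ennreal ((B\<^sup>2 + C) * (real k + 1))" for k by (rule total)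
    show "(\<integral>\<^sup>+\<omega>. ennreal ((compensated (Suc k) (\<omega> (Suc k)) - compensated k (\<omega> k))\<^sup>2) \<partial>law) \<le> ennreal (B\<^sup>2 + C)" for k
      using incr[of k] by (rule order_trans) (simp add: ennreal_leI)
  qed
qed

lemma AE_converges:
  "AE \<omega> in law. (\<forall>k. running (\<omega> k)) \<and> filterlim (\<lambda>k. T_sim (\<omega> k)) at_top sequentially \<and>
     (\<lambda>k. f_sim (\<omega> k) / real (T_sim (\<omega> k))) \<longlonglongrightarrow> c"
proof -
  obtain B0 where B0: "\<And>x. x \<in> space Om \<Longrightarrow> \<bar>potential 0 x\<bar> \<le> B0" using bfun_bound[OF bfun_potential] by blast
  obtain B1 where B1: "\<And>x. x \<in> space Om \<Longrightarrow> \<bar>potential 1 x\<bar> \<le> B1" using bfun_bound[OF bfun_potential] by blast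
  define B where "B = max B0 B1"
  have B: "\<bar>potential k x\<bar> \<le> B" if "x \<in> space Om" for k x
    using B0[OF that] B1[OF that] by (cases "even k") (auto simp: potential_def B_def)
  have "AE \<omega> in law. \<forall>k. regular k (\<omega> k)" using AE_regular by (simp add: AE_all_countable)
  moreover have "AE \<omega> in law. \<forall>k. T_sim (\<omega> (Suc k)) \<ge> T_sim (\<omega> k) + (if odd k then 1 else 0)"
    using AE_T_sim_step by (simp only: AE_all_countable) simp
  ultimately show ?thesis using AE_compensated_average AE_space
  proof eventually_elim
    case (elim \<omega>)
    have T: "k div 2 \<le> T_sim (\<omega> k)" for k
    proof (induction k)
      case (Suc k)
      then show ?case using elim(2)[rule_format, of k] by (cases "even k") (auto elim!: evenE oddE)
    qed simp
    have top: "filterlim (\<lambda>k. T_sim (\<omega> k)) at_top sequentially"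
      unfolding filterlim_at_top
    proof
      fix Z
      show "\<forall>\<^sub>F k in sequentially. Z \<le> T_sim (\<omega> k)"
        using eventually_ge_at_top[of "2 * Z"]
      proof eventually_elim
        case (elim k)
        then have "Z \<le> k div 2" by simp
        then show ?case using T[of k] by linarith
      qed
    qed
    have "(\<lambda>k. B * inverse (real (T_sim (\<omega> k)))) \<longlonglongrightarrow> B * 0"
      by (intro tendsto_mult tendsto_const filterlim_compose[OF lim_inverse_n top])
    then have l1: "(\<lambda>k. B * inverse (real (T_sim (\<omega> k)))) \<longlonglongrightarrow> 0" by simp
    have "(\<lambda>k. 3 * \<bar>compensated k (\<omega> k) / real k\<bar>) \<longlonglongrightarrow> 3 * \<bar>0\<bar>"
      by (intro tendsto_intros elim(3))
    then have "(\<lambda>k. 3 * \<bar>compensated k (\<omega> k) / real k\<bar> + B * inverse (real (T_sim (\<omega> k)))) \<longlonglongrightarrow> 0 + 0"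
      using l1 by (intro tendsto_add) simp_all
    then have bound: "(\<lambda>k. 3 * \<bar>compensated k (\<omega> k) / real k\<bar> + B * inverse (real (T_sim (\<omega> k)))) \<longlonglongrightarrow> 0" by simp
    have "(\<lambda>k. f_sim (\<omega> k) / real (T_sim (\<omega> k)) - c) \<longlonglongrightarrow> 0"
    proof (rule Lim_null_comparison[OF _ bound])
      show "\<forall>\<^sub>F k in sequentially. norm (f_sim (\<omega> k) / real (T_sim (\<omega> k)) - c)
          \<le> 3 * \<bar>compensated k (\<omega> k) / real k\<bar> + B * inverse (real (T_sim (\<omega> k)))"
        using eventually_ge_at_top[of 2]
      proof eventually_elim
        case (elim k)
        define t where "t = real (T_sim (\<omega> k))"
        \<comment> \<open>\<open>T_sim\<close> is at least \<open>k div 2\<close>, and \<open>k \<le> 3 * (k div 2)\<close> once \<open>k \<ge> 2\<close>\<close>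
        have "k \<le> 2 * (k div 2) + 1" "1 \<le> k div 2" using elim by auto
        then have "k \<le> 3 * T_sim (\<omega> k)" "1 \<le> T_sim (\<omega> k)" using T[of k] by linarith+
        then have t: "real k \<le> 3 * t" "1 \<le> t" unfolding t_def by linarith+
        have k: "0 < real k" using elim by simp
        have "f_sim (\<omega> k) / t - c = (compensated k (\<omega> k) - potential k (X_cur (\<omega> k))) / t"
          using t by (simp add: compensated_def t_def[symmetric] diff_divide_distrib)
        also have "\<bar>\<dots>\<bar> \<le> \<bar>compensated k (\<omega> k)\<bar> / t + \<bar>potential k (X_cur (\<omega> k))\<bar> / t"
          using t by (simp add: abs_divide add_divide_distrib[symmetric] divide_right_mono abs_triangle_ineq4)
        also have "\<dots> \<le> 3 * \<bar>compensated k (\<omega> k)\<bar> / real k + B / t"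
        proof (rule add_mono)
          have "\<bar>compensated k (\<omega> k)\<bar> * real k \<le> \<bar>compensated k (\<omega> k)\<bar> * (3 * t)"
            using t by (intro mult_left_mono) auto
          then show "\<bar>compensated k (\<omega> k)\<bar> / t \<le> 3 * \<bar>compensated k (\<omega> k)\<bar> / real k"
            using t k by (simp add: divide_simps mult.commute mult.left_commute)
          have "\<bar>potential k (X_cur (\<omega> k))\<bar> \<le> B"
            by (rule B[OF X_cur_in_space[OF state_in_space[OF \<open>\<omega> \<in> space law\<close>]]])
          then show "\<bar>potential k (X_cur (\<omega> k))\<bar> / t \<le> B / t" using t by (intro divide_right_mono) auto
        qed
        finally show ?case by (simp add: t_def[symmetric] abs_divide divide_inverse)
      qed
    qed
    then have "(\<lambda>k. f_sim (\<omega> k) / real (T_sim (\<omega> k))) \<longlonglongrightarrow> c" by (simp add: LIM_zero_iff)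
    moreover have "\<forall>k. running (\<omega> k)" using elim(1) by (simp add: regular_def)
    ultimately show ?case using top by blast
  qed
qed

lemma prob_converges:
  "\<P>(\<omega> in law. (\<forall>k. running (\<omega> k)) \<and> filterlim (\<lambda>k. T_sim (\<omega> k)) at_top sequentially \<and>
     (\<lambda>k. f_sim (\<omega> k) / real (T_sim (\<omega> k))) \<longlonglongrightarrow> c) = 1"
proof -
  have [measurable_cong]: "sets law = sets histories" by (rule law_facts)
  interpret prob_space law by (rule law_facts)
  have "Measurable.pred law (\<lambda>\<omega>. filterlim (\<lambda>k. T_sim (\<omega> k)) at_top sequentially)"
    unfolding filterlim_at_top eventually_sequentially by measurable
  then have "{\<omega>\<in>space law. (\<forall>k. running (\<omega> k)) \<and> filterlim (\<lambda>k. T_sim (\<omega> k)) at_top sequentially \<and>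
     (\<lambda>k. f_sim (\<omega> k) / real (T_sim (\<omega> k))) \<longlonglongrightarrow> c} \<in> events" by measurable
  then show ?thesis using AE_converges by (subst prob_Collect_eq_1)
qed

end

theorem theorem10:
  fixes Om :: "'a measure" and P :: "'a \<Rightarrow> 'a measure"
    and \<S> :: "'a set set" and \<nu> :: "'a set \<Rightarrow> 'a measure"
    and N T_corr T_poll :: nat and deph :: "'a dephasing"
    and \<mu> \<xi> :: "'a measure" and f :: "'a \<Rightarrow> real"
  assumes standard_borel: "standard_borel Om"
    and kernel: "P \<in> Om \<rightarrow>\<^sub>M prob_algebra Om"
    and sets_S: "finite \<S>" "\<S> \<subseteq> sets Om" "disjoint \<S>"
    and qsd: "\<forall>S\<in>\<S>. \<forall>\<rho>. quasistationary Om P S \<rho> \<longleftrightarrow> \<rho> = \<nu> S"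
    and params: "N \<ge> 1" "T_corr \<ge> 1" "T_poll \<ge> 1"
    and exact_dephasing: "exact_dephasing Om \<S> N \<nu> deph"
    and exact_decorrelation:
      "\<forall>S\<in>\<S>. \<forall>A\<in>sets Om. A \<subseteq> S \<longrightarrow> (\<forall>\<zeta>\<in>space (prob_algebra Om).
         \<P>(\<omega> in chain_law Om P \<zeta>. \<forall>i\<in>{1..T_corr}. \<omega> i \<in> S) > 0 \<longrightarrow>
         \<P>(\<omega> in chain_law Om P \<zeta>. \<omega> T_corr \<in> A \<bar> \<forall>i\<in>{1..T_corr}. \<omega> i \<in> S) = measure (\<nu> S) A)"
    and mu: "\<mu> \<in> space (prob_algebra Om)"
    and uniform_ergodicity:
      "(\<lambda>n. SUP \<zeta>\<in>space (prob_algebra Om).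
         tv_dist (distr (chain_law Om P \<zeta>) Om (\<lambda>\<omega>. \<omega> n)) \<mu>) \<longlonglongrightarrow> 0"
    and doeblin:
      "\<exists>\<alpha>::real. 0 < \<alpha> \<and> \<alpha> < 1 \<and>
         (\<exists>S\<in>\<S>. measure \<mu> S > 0 \<and>
           (\<exists>\<theta>\<in>space (prob_algebra Om). measure \<theta> S = 1 \<and>
             (\<forall>x\<in>S. \<forall>C\<in>sets Om. C \<subseteq> S \<longrightarrow>
               \<P>(\<omega> in chain_law Om P (return Om x). \<omega> 1 \<in> C) \<ge> \<alpha> * measure \<theta> C)))"
    and escape_rates:
      "\<exists>\<delta>>0. \<forall>S\<in>\<S>. \<P>(\<omega> in chain_law Om P (\<nu> S). \<omega> 1 \<notin> S) \<ge> \<delta>"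
    and xi: "\<xi> \<in> space (prob_algebra Om)"
    and f: "f \<in> borel_measurable Om" "\<exists>B. \<forall>x\<in>space Om. \<bar>f x\<bar> \<le> B"
  shows "\<P>(\<omega> in parrep_law Om P \<S> N T_corr T_poll deph f \<xi>.
           (\<forall>k. running (\<omega> k)) \<and>
           filterlim (\<lambda>k. T_sim (\<omega> k)) at_top sequentially \<and>
           (\<lambda>k. f_sim (\<omega> k) / real (T_sim (\<omega> k))) \<longlonglongrightarrow> (\<integral>x. f x \<partial>\<mu>)) = 1"
proof -
  interpret ergodic_kernel Om P \<mu>
    by unfold_locales (fact kernel mu uniform_ergodicity)+
  have bf: "bfun f" using f unfolding bfun_def by blast
  let ?c = "\<integral>x. f x \<partial>\<mu>"
  have centred: "bfun (\<lambda>y. f y - ?c)" by (intro bfun_diff bf bfun_const)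
  have mean: "(\<integral>y. f y - ?c \<partial>\<mu>) = 0"
  proof -
    interpret M: prob_space \<mu> by (rule law_prob[OF mu])
    show ?thesis
      by (subst Bochner_Integration.integral_diff[OF integrable_bfun[OF mu bf] M.integrable_const]) (simp add: M.prob_space)
  qed
  obtain h where h: "bfun h" "\<And>x. x \<in> space Om \<Longrightarrow> h x - transition h x = transition (\<lambda>y. f y - ?c) x"
    using poisson_equation[OF centred mean] by blast
  interpret parrep_process Om P \<mu> \<S> \<nu> T_corr N T_poll f h ?c deph \<xi>
    by unfold_locales
       (fact sets_S qsd params exact_decorrelation doeblin escape_rates bf h exact_dephasing xi)+
  show ?thesis by (rule prob_converges)
qed

end
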